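(* Let $(X,d)$ be a hyperbolic space with base point $o$, and let $d_a$ be the fixed metric on $X\cup\partial X$ described in the context. Let $G$ be a subgroup of the group of isometries of $(X,d)$ which acts properly discontinuously and is non-elementary. Then for every $\epsilon>0$ there exists on $G$ a symmetric probability measure $\mu$ (i.e. $\mu(g^{-1})=\mu(g)$ for all $g\in G$) with a finite first moment, whose support generates $G$, and such that the harmonic measure $\nu$ associated with $(G,\mu)$ satisfies, for $\nu$-almost every $\xi\in\partial X$, $$\overline{\dim}_P\,\nu(\xi)=\limsup_{r\to 0}\frac{\log \nu(B(\xi,r))}{\log r}<\epsilon,$$ where $B(\xi,r)$ is the ball of radius $r$ centred at $\xi$ in $(\partial X,d_a)$.
   Context: Hyperbolic space: a proper geodesic metric space $(X,d)$ for which there is $\delta\ge 0$ such that, with $(x|y)_o=\frac12[d(o,x)+d(o,y)-d(x,y)]$, one has $(x|z)_o\ge\min\{(x|y)_o,(y|z)_o\}-\delta$ for all $x,y,z,o\in X$. A base point $o\in X$ is fixed and $(x|y):=(x|y)_o$. The hyperbolic boundary $\partial X$ is the set of geodesic rays modulo equivalence (two rays are equivalent if they stay at bounded distance, $\sup_t d(\sigma_1(t),\sigma_2(t))<\infty$); the Gromov product extends to $X\cup\partial X$ by $(x|y)=\inf\liminf_n(x_n|y_n)$ over sequences $x_n\to x$, $y_n\to y$ in $X$, and $X\cup\partial X$ carries its usual compact topology, in which $x_n\to\xi\in\partial X$ iff $(\xi|x_n)\to\infty$. Isometries of $X$ act continuously on $\partial X$. Metric: a parameter $a>1$ (in the admissible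 range $1<a<a_0$) and a metric $d_a$ on $X\cup\partial X$ inducing on it the usual compact topology of $X\cup\partial X$ (in which $x_n\to\xi\in\partial X$ iff $(\xi|x_n)\to\infty$) are fixed, such that for some constant $\lambda>0$: $d_a(x,y)\le\lambda a^{-(x|y)}$ for all $x,y\in X\cup\partial X$, and $d_a(x,y)\ge\lambda^{-1}a^{-(x|y)}$ for all $x,y\in\partial X$. Properly discontinuous: for every compact $K\subset X$ the set $\{g\in G: gK\cap K\neq\emptyset\}$ is finite. The limit set $\Lambda_G$ is the set of accumulation points in $\partial X$ of an orbit $Gx$, $x \in X$ (independent of $x$); $G$ is non-elementary if $\Lambda_G$ has more than two elements. Finite first moment: $\sum_{g\in G}\mu(g)d(o,go)<\infty$. Random walk: $x_0=e$, $x_n=h_1\cdots h_n$ with $(h_i)$ i.i.d. of law $\mu$. When the support of $\mu$ generates $G$, $x_no$ converges almost surely to a point $x_\infty\in\partial X$ (known fact); the harmonic measure $\nu$ associated with $(G,\mu)$ is the distribution of $x_\infty$. *)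

theory Defs
  imports "HOL-Probability.Probability" "HOL-Algebra.Generated_Groups"
begin

definition gromov_product :: "'a::metric_space \<Rightarrow> 'a \<Rightarrow> 'a \<Rightarrow> real" where
  "gromov_product b x y = (dist b x + dist b y - dist x y) / 2"

class gromov_hyperbolic_space = metric_space +
  assumes proper: "\<And>x r. compact (cball x r)"
    and geodesic: "\<And>x y. \<exists>\<gamma>. \<gamma> 0 = x \<and> \<gamma> (dist x y) = y \<and>
      (\<forall>s\<in>{0..dist x y}. \<forall>t\<in>{0..dist x y}. dist (\<gamma> s) (\<gamma> t) = \<bar>s - t\<bar>)"
    and hyperbolic: "\<exists>\<delta>\<ge>0. \<forall>x y z b.
      gromov_product b x z \<ge> min (gromov_product b x y) (gromov_product b y z) - \<delta>"

text \<open>Rays are total functions on the reals of which only the values on the nonnegative half-line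
  matter; rays agreeing there are identified by the equivalence relation.\<close>

definition geodesic_rays :: "(real \<Rightarrow> 'a::metric_space) set" where
  "geodesic_rays = {\<sigma>. \<forall>s\<ge>0. \<forall>t\<ge>0. dist (\<sigma> s) (\<sigma> t) = \<bar>s - t\<bar>}"

definition ray_rel :: "((real \<Rightarrow> 'a::metric_space) \<times> (real \<Rightarrow> 'a)) set" where
  "ray_rel = {(\<sigma>, \<tau>). \<sigma> \<in> geodesic_rays \<and> \<tau> \<in> geodesic_rays \<and>
     bdd_above ((\<lambda>t. dist (\<sigma> t) (\<tau> t)) ` {0..})}"

text \<open>Points of the space are tagged by \<open>Inl\<close>, boundary points are classes of rays tagged by
  \<open>Inr\<close>. Only the classes in \<open>ideal_boundary\<close> are meaningful.\<close>

type_synonym 'a bord = "'a + (real \<Rightarrow> 'a) set"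

definition ideal_boundary :: "'a::metric_space bord set" where
  "ideal_boundary = Inr ` (geodesic_rays // ray_rel)"

definition bordification :: "'a::metric_space bord set" where
  "bordification = range Inl \<union> ideal_boundary"

text \<open>Convergence of a sequence of points of the space, needed before the topology on the
  compactification is available: a sequence \<open>u\<close> tends to the class of a ray \<open>\<sigma>\<close> if
  \<open>(u n | \<sigma> t)\<close> tends to infinity as \<open>n\<close> and \<open>t\<close> do. In a hyperbolic space this does not depend on
  the base point nor on the ray in its class.\<close>

definition seq_tends_to :: "'a::metric_space \<Rightarrow> (nat \<Rightarrow> 'a) \<Rightarrow> 'a bord \<Rightarrow> bool" where
  "seq_tends_to b u p = (case p of
     Inl x \<Rightarrow> u \<longlonglongrightarrow> x
   | Inr c \<Rightarrow> (\<forall>\<sigma>\<in>c. filterlim (\<lambda>(n, t). gromov_product b (u n) (\<sigma> t)) at_top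
                        (sequentially \<times>\<^sub>F at_top)))"

definition ext_gromov_product :: "'a::metric_space \<Rightarrow> 'a bord \<Rightarrow> 'a bord \<Rightarrow> ereal" where
  "ext_gromov_product b p q =
     (INF (u, v) \<in> {(u, v). seq_tends_to b u p \<and> seq_tends_to b v q}.
        liminf (\<lambda>n. ereal (gromov_product b (u n) (v n))))"

text \<open>The usual topology: the space is embedded as an open subspace, and the sets
  \<open>{y. (\<xi>|y) > R}\<close> form a neighbourhood basis of a boundary point \<open>\<xi>\<close>.\<close>

definition bord_topology :: "'a::metric_space \<Rightarrow> 'a bord topology" where
  "bord_topology b = topology (\<lambda>U. U \<subseteq> bordification \<and> open (Inl -` U) \<and>
     (\<forall>\<xi>\<in>U \<inter> ideal_boundary. \<exists>R::real. \<forall>y\<in>bordification.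
        ext_gromov_product b \<xi> y > ereal R \<longrightarrow> y \<in> U))"

lemma openin_bord_topology:
  "openin (bord_topology b) U \<longleftrightarrow> U \<subseteq> bordification \<and> open (Inl -` U) \<and>
     (\<forall>\<xi>\<in>U \<inter> ideal_boundary. \<exists>R::real. \<forall>y\<in>bordification.
        ext_gromov_product b \<xi> y > ereal R \<longrightarrow> y \<in> U)"
proof -
  let ?L = "\<lambda>U. U \<subseteq> bordification \<and> open (Inl -` U) \<and>
     (\<forall>\<xi>\<in>U \<inter> ideal_boundary. \<exists>R::real. \<forall>y\<in>bordification.
        ext_gromov_product b \<xi> y > ereal R \<longrightarrow> y \<in> U)"
  have "?L (S \<inter> T)" if S: "?L S" and T: "?L T" for S T
  proof (intro conjI ballI)
    show "S \<inter> T \<subseteq> bordification" "open (Inl -` (S \<inter> T))"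
      using S T by auto
    fix \<xi> assume \<xi>: "\<xi> \<in> S \<inter> T \<inter> ideal_boundary"
    obtain R1 R2 :: real where
      R1: "\<And>y. y \<in> bordification \<Longrightarrow> ext_gromov_product b \<xi> y > ereal R1 \<Longrightarrow> y \<in> S" and
      R2: "\<And>y. y \<in> bordification \<Longrightarrow> ext_gromov_product b \<xi> y > ereal R2 \<Longrightarrow> y \<in> T"
      using S T \<xi> by (metis IntD1 IntD2 IntI)
    have "y \<in> S \<inter> T" if "y \<in> bordification" "ext_gromov_product b \<xi> y > ereal (max R1 R2)" for y
      using R1[OF that(1)] R2[OF that(1)] that(2)
      by (metis IntI ereal_less_eq(3) max.cobounded1 max.cobounded2 order_le_less_trans)
    then show "\<exists>R::real. \<forall>y\<in>bordification. ext_gromov_product b \<xi> y > ereal R \<longrightarrow> y \<in> S \<inter> T"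
      by blast
  qed
  moreover have "?L (\<Union>K)" if K: "\<forall>S\<in>K. ?L S" for K
  proof (intro conjI ballI)
    show "\<Union>K \<subseteq> bordification" "open (Inl -` \<Union>K)"
      using K by (auto simp: vimage_Union)
    fix \<xi> assume "\<xi> \<in> \<Union>K \<inter> ideal_boundary"
    then obtain S where S: "S \<in> K" "\<xi> \<in> S \<inter> ideal_boundary"
      by blast
    then show "\<exists>R::real. \<forall>y\<in>bordification. ext_gromov_product b \<xi> y > ereal R \<longrightarrow> y \<in> \<Union>K"
      using K by (metis UnionI)
  qed
  ultimately have "istopology ?L"
    unfolding istopology_def by (intro conjI allI impI) metis+
  then show ?thesis
    by (simp add: bord_topology_def)
qed

lemma topspace_bord_topology: "topspace (bord_topology b) = bordification"
proof -
  have "openin (bord_topology b) bordification"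
    by (auto simp: openin_bord_topology bordification_def vimage_def)
  then show ?thesis
    by (metis openin_bord_topology openin_subset openin_topspace subset_antisym)
qed

definition powr_neg :: "real \<Rightarrow> ereal \<Rightarrow> real" where
  "powr_neg a g = (if g = \<infinity> then 0 else a powr (- real_of_ereal g))"

definition visual_metric ::
    "'a::metric_space \<Rightarrow> real \<Rightarrow> ('a bord \<Rightarrow> 'a bord \<Rightarrow> real) \<Rightarrow> bool" where
  "visual_metric b a d \<longleftrightarrow>
     Metric_space bordification d \<and>
     Metric_space.mtopology bordification d = bord_topology b \<and>
     (\<exists>L>0. (\<forall>x\<in>bordification. \<forall>y\<in>bordification.
                d x y \<le> L * powr_neg a (ext_gromov_product b x y)) \<and>
            (\<forall>x\<in>ideal_boundary. \<forall>y\<in>ideal_boundary.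
                d x y \<ge> inverse L * powr_neg a (ext_gromov_product b x y)))"

definition isometry_group :: "('a::metric_space \<Rightarrow> 'a) monoid" where
  "isometry_group =
     \<lparr>carrier = {f. surj f \<and> (\<forall>x y. dist (f x) (f y) = dist x y)}, mult = (\<circ>), one = id\<rparr>"

lemma group_isometry_group: "group (isometry_group :: ('a::metric_space \<Rightarrow> 'a) monoid)"
proof (rule groupI)
  fix f :: "'a \<Rightarrow> 'a" assume f: "f \<in> carrier isometry_group"
  then have iso: "\<And>x y. dist (f x) (f y) = dist x y" and s: "surj f"
    by (auto simp: isometry_group_def)
  have "inj f"
    by (rule injI) (metis iso dist_eq_0_iff)
  with s have "bij f"
    by (simp add: bij_def)
  then have "inv_into UNIV f \<circ> f = id" "surj (inv_into UNIV f)" "\<And>x. f (inv_into UNIV f x) = x"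
    using \<open>inj f\<close> s by (simp_all add: inj_imp_surj_inv surj_f_inv_f)
  moreover from this(3) have "dist (inv_into UNIV f x) (inv_into UNIV f y) = dist x y" for x y
    by (metis iso)
  ultimately show "\<exists>g\<in>carrier isometry_group. g \<otimes>\<^bsub>isometry_group\<^esub> f = \<one>\<^bsub>isometry_group\<^esub>"
    by (intro bexI[of _ "inv_into UNIV f"]) (auto simp: isometry_group_def)
next
  fix f g :: "'a \<Rightarrow> 'a"
  assume "f \<in> carrier isometry_group" "g \<in> carrier isometry_group"
  then show "f \<otimes>\<^bsub>isometry_group\<^esub> g \<in> carrier isometry_group"
    using comp_surj[of g f] by (simp add: isometry_group_def comp_def)
qed (simp_all add: isometry_group_def comp_assoc)

definition properly_discontinuous :: "('a::metric_space \<Rightarrow> 'a) set \<Rightarrow> bool" where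
  "properly_discontinuous G \<longleftrightarrow> (\<forall>K. compact K \<longrightarrow> finite {g \<in> G. g ` K \<inter> K \<noteq> {}})"

text \<open>The accumulation points on the boundary are the same for every orbit; the orbit of the base
  point is used.\<close>

definition limit_set :: "'a::metric_space \<Rightarrow> ('a \<Rightarrow> 'a) set \<Rightarrow> 'a bord set" where
  "limit_set b G =
     ideal_boundary \<inter> (bord_topology b derived_set_of ((\<lambda>g. Inl (g b)) ` G))"

definition non_elementary :: "'a::metric_space \<Rightarrow> ('a \<Rightarrow> 'a) set \<Rightarrow> bool" where
  "non_elementary b G \<longleftrightarrow> infinite (limit_set b G) \<or> card (limit_set b G) > 2"

text \<open>The increments are indexed from \<open>0\<close>, so \<open>random_walk h n\<close> is the product of
  \<open>h 0, \<dots>, h (n - 1)\<close> in this order.\<close>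

primrec random_walk :: "(nat \<Rightarrow> 'a \<Rightarrow> 'a) \<Rightarrow> nat \<Rightarrow> 'a \<Rightarrow> 'a" where
  "random_walk h 0 = id"
| "random_walk h (Suc n) = random_walk h n \<circ> h n"

definition walk_space :: "('a \<Rightarrow> 'a) pmf \<Rightarrow> (nat \<Rightarrow> 'a \<Rightarrow> 'a) measure" where
  "walk_space \<mu> = (\<Pi>\<^sub>M i\<in>UNIV. measure_pmf \<mu>)"

definition boundary_borel :: "'a::metric_space \<Rightarrow> 'a bord measure" where
  "boundary_borel b =
     sigma ideal_boundary {U. openin (subtopology (bord_topology b) ideal_boundary) U}"

text \<open>Almost sure convergence of the walk to the boundary is part of the definition. The limit
  is determined only up to null sets, hence the existential quantifier; its law is unique.\<close>

definition is_harmonic_measure ::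
    "'a::metric_space \<Rightarrow> ('a \<Rightarrow> 'a) pmf \<Rightarrow> 'a bord measure \<Rightarrow> bool" where
  "is_harmonic_measure b \<mu> \<nu> \<longleftrightarrow>
     (\<exists>xlim \<in> measurable (walk_space \<mu>) (boundary_borel b).
        (AE h in walk_space \<mu>.
           limitin (bord_topology b) (\<lambda>n. Inl (random_walk h n b)) (xlim h) sequentially) \<and>
        \<nu> = distr (walk_space \<mu>) (boundary_borel b) xlim)"

definition symmetric_on :: "('a::metric_space \<Rightarrow> 'a) set \<Rightarrow> ('a \<Rightarrow> 'a) pmf \<Rightarrow> bool" where
  "symmetric_on G \<mu> \<longleftrightarrow> (\<forall>g\<in>G. pmf \<mu> (inv\<^bsub>isometry_group\<^esub> g) = pmf \<mu> g)"

definition finite_first_moment ::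
    "'a::metric_space \<Rightarrow> ('a \<Rightarrow> 'a) set \<Rightarrow> ('a \<Rightarrow> 'a) pmf \<Rightarrow> bool" where
  "finite_first_moment b G \<mu> \<longleftrightarrow> (\<lambda>g. pmf \<mu> g * dist b (g b)) summable_on G"

text \<open>The quotient is read as \<open>\<infinity>\<close> when the ball is null, instead of
  using the library value \<open>ln 0 = 0\<close>.\<close>

definition upper_pointwise_dim ::
    "('a bord \<Rightarrow> 'a bord \<Rightarrow> real) \<Rightarrow> 'a::metric_space bord measure \<Rightarrow> 'a bord \<Rightarrow> ereal" where
  "upper_pointwise_dim d \<nu> \<xi> = Limsup (at_right 0) (\<lambda>r.
     let m = measure \<nu> (Metric_space.mball ideal_boundary d \<xi> r)
     in if m = 0 then \<infinity> else ereal (ln m / ln r))"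

end

theory Submission
  imports Defs
begin

text \<open>The measure exists because speed and randomness can be decoupled. Suppose a step of the walk is,
apart from a small perturbation, uniformly distributed on four elements of length about \<open>L\<close> that
move the base point in four different directions. A typical trajectory of \<open>n\<close> steps then has probability
at least of the order of \<open>64\<^sup>-\<^sup>n\<close>, a rate that does not know \<open>L\<close>, whereas the walk escapes at
a speed \<open>c\<close> proportional to \<open>L\<close>. The position at time \<open>n\<close> determines the limit point up to an error
of the order of \<open>a\<^sup>-\<^sup>c\<^sup>n\<^sup>/\<^sup>2\<close> in the visual metric, so a ball of this radius around a typical limit
point has mass at least of the order of \<open>64\<^sup>-\<^sup>n\<close>. The local dimension is therefore at most
\<open>2 ln 64 / (c ln a)\<close>, which is small when \<open>L\<close> is large.

The geometric input is \<open>schottky_pair\<close>: elements \<open>s\<close>, \<open>s'\<close> of arbitrarily large and nearly equal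
length such that the four points \<open>s b\<close>, \<open>s\<^sup>-\<^sup>1 b\<close>, \<open>s' b\<close>, \<open>s'\<^sup>-\<^sup>1 b\<close> have pairwise bounded Gromov
products. They are powers of a loxodromic element \<open>a\<close> and their conjugates by some \<open>h\<close>. If no
\<open>h\<close> moved the axis of \<open>a\<close> away from itself, proper discontinuity would make every \<open>h\<close> commensurate
\<open>a\<close>, the whole orbit would stay near the axis, and the limit set would have at most two points. In
\<open>exists_step_law\<close> all elements of the group receive tiny weights on top of the Schottky elements,
so that the support is the whole group and the estimates survive.

The probabilistic input is one inequality: whatever the point \<open>y\<close>, at most one of the four
directions leads towards \<open>y\<close>, hence the expectation of \<open>exp (- t d(y, h b))\<close> is at most
\<open>19/20 exp (- t d(y, b))\<close>. As it is uniform in \<open>y\<close> it can be iterated (\<open>walk_laplace\<close>), and it shows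
that, seen from any point, the walk escapes linearly up to an additive error with exponential
tails. For the base point this gives convergence to the boundary. For the point
\<open>y = x\<^sub>n\<^sup>-\<^sup>1 b\<close> it says that a walk restarted at \<open>x\<^sub>n\<close> has probability at least \<open>1/2\<close> never to
return far towards \<open>b\<close>, and then it converges inside the shadow of \<open>x\<^sub>n\<close>
(\<open>shadow_gromov_product\<close>). With the Markov property (\<open>emeasure_cylinder_tail\<close>) this bounds the mass
of balls from below (\<open>AE_harmonic_ball\<close>).\<close>

section \<open>Gromov products and isometries\<close>

lemma gromov_product_commute: "gromov_product p x y = gromov_product p y x"
  by (simp add: gromov_product_def dist_commute)

lemma gromov_product_nonneg: "0 \<le> gromov_product p x y"
  using dist_triangle2[of x y p] by (simp add: gromov_product_def dist_commute)

lemma gromov_product_le_dist: "gromov_product p x y \<le> dist p x"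
  using dist_triangle[of p y x] by (simp add: gromov_product_def)

lemma gromov_product_ge: "dist p x - dist x y \<le> gromov_product p x y"
  using dist_triangle[of p x y] by (simp add: gromov_product_def dist_commute)

lemma gromov_product_lipschitz: "gromov_product p x y \<le> gromov_product p x z + dist y z"
proof -
  have "dist p y \<le> dist p z + dist y z" "dist x z \<le> dist x y + dist y z"
    by (metis dist_commute dist_triangle)+
  then have "dist p y - dist x y \<le> (dist p z - dist x z) + 2 * dist y z" by linarith
  then show ?thesis by (simp add: gromov_product_def field_simps)
qed

lemma gromov_product_basepoint: "gromov_product p x y \<le> gromov_product q x y + dist p q"
  using dist_triangle[of p x q] dist_triangle[of p y q]
  by (simp add: gromov_product_def dist_commute field_simps)

lemma gromov_product_swap: "gromov_product p x y = dist p x - gromov_product x p y"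
  by (simp add: gromov_product_def dist_commute field_simps)

lemma gromov_product_self [simp]: "gromov_product p x x = dist p x"
  by (simp add: gromov_product_def)

lemma gromov_product_base [simp]: "gromov_product p p y = 0" "gromov_product p y p = 0"
  by (simp_all add: gromov_product_def dist_commute)

lemma dist_gromov_product: "dist x y = dist p x + dist p y - 2 * gromov_product p x y"
  by (simp add: gromov_product_def field_simps)

interpretation isom: group isometry_group
  by (rule group_isometry_group)

lemma isometry_dist: "g \<in> carrier isometry_group \<Longrightarrow> dist (g x) (g y) = dist x y"
  by (simp add: isometry_group_def)

lemma isometry_gromov_product:
  "g \<in> carrier isometry_group \<Longrightarrow> gromov_product (g p) (g x) (g y) = gromov_product p x y"
  by (simp add: gromov_product_def isometry_dist)

lemma isometry_mult [simp]: "f \<otimes>\<^bsub>isometry_group\<^esub> g = f \<circ> g"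
  by (simp add: isometry_group_def)

lemma isometry_one [simp]: "\<one>\<^bsub>isometry_group\<^esub> = id"
  by (simp add: isometry_group_def)

lemma isometry_inv [simp]:
  assumes "g \<in> carrier isometry_group"
  shows "g ((inv\<^bsub>isometry_group\<^esub> g) x) = x" "(inv\<^bsub>isometry_group\<^esub> g) (g x) = x"
  using isom.r_inv[OF assms] isom.l_inv[OF assms] by (auto simp: fun_eq_iff)

abbreviation iso_inv :: "('a::metric_space \<Rightarrow> 'a) \<Rightarrow> 'a \<Rightarrow> 'a" where
  "iso_inv g \<equiv> inv\<^bsub>isometry_group\<^esub> g"

abbreviation iso_pow :: "('a::metric_space \<Rightarrow> 'a) \<Rightarrow> int \<Rightarrow> 'a \<Rightarrow> 'a" where
  "iso_pow g k \<equiv> g [^]\<^bsub>isometry_group\<^esub> k"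

lemma iso_pow_add:
  "g \<in> carrier isometry_group \<Longrightarrow> iso_pow g (i + j) x = iso_pow g i (iso_pow g j x)"
  using isom.int_pow_mult[of g i j] by (metis comp_apply isometry_mult)

lemma iso_pow_0 [simp]: "iso_pow g 0 x = x"
  by (simp add: int_pow_0)

lemma iso_pow_inv:
  "g \<in> carrier isometry_group \<Longrightarrow> iso_pow (iso_inv g) k = iso_pow g (- k)"
  by (simp add: isom.int_pow_inv isom.int_pow_neg)

lemma dist_iso_inv:
  assumes "g \<in> carrier isometry_group"
  shows "dist p (iso_inv g q) = dist (g p) q"
  by (metis assms isometry_dist isometry_inv(1))

locale hyperbolic_action =
  fixes b :: "'a::gromov_hyperbolic_space" and \<delta> :: real and G :: "('a \<Rightarrow> 'a) set"
  assumes delta_nonneg: "\<delta> \<ge> 0"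
    and hyp: "\<And>p x y z. min (gromov_product p x y) (gromov_product p y z) - \<delta> \<le> gromov_product p x (z::'a)"
    and subgroup: "subgroup G isometry_group"
    and proper_disc: "properly_discontinuous G"
begin

abbreviation len :: "('a \<Rightarrow> 'a) \<Rightarrow> real" where "len g \<equiv> dist b (g b)"
abbreviation gp :: "'a \<Rightarrow> 'a \<Rightarrow> real" where "gp \<equiv> gromov_product b"

lemma hyp_trans:
  assumes "gromov_product (p::'a) x y \<ge> A" "gromov_product p y z \<ge> A"
  shows "gromov_product p x z \<ge> A - \<delta>"
  using hyp[of p x y z] assms by (simp add: min_def split: if_splits)

lemma G_carrier: "g \<in> G \<Longrightarrow> g \<in> carrier isometry_group"
  using subgroup.mem_carrier[OF subgroup] .

lemma G_comp: "f \<in> G \<Longrightarrow> g \<in> G \<Longrightarrow> f \<circ> g \<in> G"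
  using subgroup.m_closed[OF subgroup, of f g] by simp

lemma G_inv: "g \<in> G \<Longrightarrow> iso_inv g \<in> G"
  using subgroup.m_inv_closed[OF subgroup] .

lemma G_id: "id \<in> G"
  using subgroup.one_closed[OF subgroup] by simp

lemma G_pow: "g \<in> G \<Longrightarrow> iso_pow g k \<in> G"
  using isom.subgroup_int_pow_closed[OF subgroup] .

lemma len_inv: "g \<in> G \<Longrightarrow> len (iso_inv g) = len g"
  using dist_iso_inv[OF G_carrier, of g b b] by (simp add: dist_commute)

lemma G_dist: "g \<in> G \<Longrightarrow> dist (g x) (g y) = dist x y"
  by (simp add: isometry_dist G_carrier)

lemma G_gromov_product: "g \<in> G \<Longrightarrow> gromov_product (g p) (g x) (g y) = gromov_product p x y"
  by (simp add: isometry_gromov_product G_carrier)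

lemma finite_short: "finite {g \<in> G. len g \<le> D}"
proof -
  have "finite {g \<in> G. g ` cball b D \<inter> cball b D \<noteq> {}}"
    using proper_disc proper unfolding properly_discontinuous_def by blast
  moreover have "{g \<in> G. len g \<le> D} \<subseteq> {g \<in> G. g ` cball b D \<inter> cball b D \<noteq> {}}"
  proof safe
    fix g assume g: "g \<in> G" "len g \<le> D" "g ` cball b D \<inter> cball b D = {}"
    have "b \<in> cball b D" "g b \<in> cball b D"
      using g(2) order_trans[OF zero_le_dist g(2)] by auto
    then show False using g(3) by blast
  qed
  ultimately show ?thesis by (rule rev_finite_subset)
qed

lemma countable_G: "countable G"
proof -
  have "G \<subseteq> (\<Union>n::nat. {g \<in> G. len g \<le> real n})"
    using real_arch_simple by blast
  moreover have "countable (\<Union>n::nat. {g \<in> G. len g \<le> real n})"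
    by (intro countable_UN) (auto intro: countable_finite finite_short)
  ultimately show ?thesis by (rule countable_subset)
qed

section \<open>Loxodromic elements\<close>

text \<open>The forward and the backward orbit of \<open>a\<close> leave \<open>b\<close> in different directions, and they leave every
ball. This finitary form avoids fixed points at infinity; \<open>C\<close> bounds how far \<open>b\<close> is from the axis.\<close>
definition loxodromic :: "('a \<Rightarrow> 'a) \<Rightarrow> real \<Rightarrow> bool" where
  "loxodromic a C \<longleftrightarrow> a \<in> G \<and>
     (\<forall>i\<ge>0. \<forall>j\<ge>0. gp (iso_pow a (- i) b) (iso_pow a j b) \<le> C) \<and>
     (\<forall>M. \<exists>N. \<forall>n\<ge>N. len (iso_pow a n) \<ge> M)"

lemma pow_gromov_product:
  assumes "a \<in> G"
  shows "gromov_product (iso_pow a k b) (iso_pow a i b) (iso_pow a j b)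
    = gp (iso_pow a (i - k) b) (iso_pow a (j - k) b)"
proof -
  have eq: "iso_pow a i b = iso_pow a k (iso_pow a (i - k) b)" for i
    by (subst iso_pow_add[OF G_carrier[OF assms], symmetric]) simp
  show ?thesis
    unfolding eq[of i] eq[of j] by (rule G_gromov_product[OF G_pow[OF assms]])
qed

lemma len_pow_neg: "a \<in> G \<Longrightarrow> len (iso_pow a (- k)) = len (iso_pow a k)"
  by (subst isom.int_pow_neg[OF G_carrier]) (assumption, rule len_inv[OF G_pow])

lemma loxodromic_inv:
  assumes "loxodromic a C"
  shows "loxodromic (iso_inv a) C"
proof -
  have a: "a \<in> G" using assms by (simp add: loxodromic_def)
  then have eq: "iso_pow (iso_inv a) k = iso_pow a (- k)" for k
    by (simp add: iso_pow_inv G_carrier)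
  show ?thesis
    using assms a len_pow_neg[OF a]
    unfolding loxodromic_def eq by (simp add: G_inv gromov_product_commute)
qed

text \<open>A broken geodesic whose pieces are long compared with the Gromov products at its corners does not
turn back: passing from one corner to the next loses \<open>\<delta>\<close> once, not cumulatively, because the
previous corner is already far away. Here the corners are the points \<open>a\<^sup>i b\<close>.\<close>
lemma loxodromic_pow_products:
  assumes "a \<in> G" and long: "len a > 2 * gp (a b) (iso_inv a b) + 4 * \<delta>"
  defines "\<alpha> \<equiv> gp (a b) (iso_inv a b)"
  shows "gp (iso_pow a (- int (Suc m)) b) (a b) \<le> \<alpha> + \<delta>"
proof (induction m)
  case 0
  have "iso_pow a (- 1) = iso_inv a"
    using isom.int_pow_neg[OF G_carrier, of a 1] assms(1) by (simp add: G_carrier isom.int_pow_1)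
  then show ?case
    using delta_nonneg by (simp add: \<alpha>_def gromov_product_commute)
next
  case (Suc m)
  let ?m = "int (Suc m)"
  have inv: "iso_pow a (- 1) = iso_inv a"
    using isom.int_pow_neg[OF G_carrier, of a 1] assms(1) by (simp add: G_carrier isom.int_pow_1)
  have "gp (iso_pow a (- 1) b) (iso_pow a (- ?m - 1) b)
      = len (iso_pow a (-1)) - gp (iso_pow a 1 b) (iso_pow a (- ?m) b)"
    using pow_gromov_product[OF assms(1), of "-1" 0 "- ?m - 1"]
    by (subst gromov_product_swap) simp
  also have "\<dots> \<ge> len a - (\<alpha> + \<delta>)"
    using Suc assms(1) by (simp add: len_pow_neg G_carrier gromov_product_commute)
  finally have 1: "gp (iso_inv a b) (iso_pow a (- ?m - 1) b) \<ge> len a - (\<alpha> + \<delta>)"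
    by (simp add: inv)
  have "min (gp (iso_inv a b) (iso_pow a (- ?m - 1) b)) (gp (iso_pow a (- ?m - 1) b) (a b)) - \<delta>
      \<le> gp (iso_inv a b) (a b)" by (rule hyp)
  then have "gp (iso_pow a (- ?m - 1) b) (a b) \<le> \<alpha> + \<delta>"
    using 1 long delta_nonneg unfolding \<alpha>_def
    by (simp add: gromov_product_commute min_def split: if_splits)
  moreover have "- ?m - 1 = - int (Suc (Suc m))" by simp
  ultimately show ?case by metis
qed

text \<open>The same estimate shows that each further power of \<open>a\<close> adds a fixed positive amount to the length,
so the powers tend to infinity.\<close>
lemma loxodromicI:
  assumes "a \<in> G" and long: "len a > 2 * gp (a b) (iso_inv a b) + 4 * \<delta>"
  shows "\<exists>C. loxodromic a C"
proof -
  define \<alpha> where "\<alpha> = gp (a b) (iso_inv a b)"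
  have \<alpha>0: "\<alpha> \<ge> 0" by (simp add: \<alpha>_def gromov_product_nonneg)
  have ac: "a \<in> carrier isometry_group" using assms(1) by (rule G_carrier)
  have A: "gp (iso_pow a (- i) b) (a b) \<le> \<alpha> + \<delta>" if "i \<ge> 0" for i
  proof (cases "i = 0")
    case False
    then have "- i = - int (Suc (nat (i - 1)))" using that by simp
    then show ?thesis using loxodromic_pow_products[OF assms, of "nat (i - 1)"]
      unfolding \<alpha>_def by metis
  qed (use \<alpha>0 delta_nonneg in simp)
  have iia: "iso_inv (iso_inv a) = a" using ac by (rule isom.inv_inv)
  have B: "gp (iso_pow a i b) (iso_inv a b) \<le> \<alpha> + \<delta>" if "i \<ge> 0" for i
  proof (cases "i = 0")
    case False
    have "len (iso_inv a) > 2 * gp (iso_inv a b) (iso_inv (iso_inv a) b) + 4 * \<delta>"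
      using long assms(1) iia by (simp add: len_inv gromov_product_commute)
    from loxodromic_pow_products[OF G_inv[OF assms(1)] this, of "nat (i - 1)"]
    show ?thesis
      using False that iia by (simp add: iso_pow_inv ac \<alpha>_def gromov_product_commute)
  qed (use \<alpha>0 delta_nonneg in simp)
  have inv: "iso_pow a (- 1) = iso_inv a"
    using isom.int_pow_neg[OF ac, of 1] ac by (simp add: isom.int_pow_1)
  have bound: "gp (iso_pow a (- i) b) (iso_pow a j b) \<le> \<alpha> + 2 * \<delta>" if "i \<ge> 0" "j \<ge> 0" for i j
  proof (cases "j = 0")
    case False
    have "gp (iso_pow a 1 b) (iso_pow a j b)
        = len (iso_pow a 1) - gp (iso_pow a (- 1) b) (iso_pow a (j - 1) b)"
      using pow_gromov_product[OF assms(1), of 1 0 j]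
      by (subst gromov_product_swap) simp
    then have 1: "gp (a b) (iso_pow a j b) \<ge> len a - (\<alpha> + \<delta>)"
      using B[of "j - 1"] False that ac by (simp add: inv gromov_product_commute)
    have "min (gp (iso_pow a (- i) b) (iso_pow a j b)) (gp (iso_pow a j b) (a b)) - \<delta>
        \<le> gp (iso_pow a (- i) b) (a b)" by (rule hyp)
    then show ?thesis
      using 1 A[OF that(1)] long delta_nonneg unfolding \<alpha>_def[symmetric]
      by (simp add: gromov_product_commute min_def split: if_splits)
  qed (use \<alpha>0 delta_nonneg in simp)
  define \<kappa> where "\<kappa> = len a - 2 * (\<alpha> + \<delta>)"
  have \<kappa>: "\<kappa> > 0" using long \<alpha>0 delta_nonneg unfolding \<kappa>_def \<alpha>_def by (simp add: algebra_simps)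
  have growth: "len (iso_pow a (int n)) \<ge> real n * \<kappa>" for n
  proof (induction n)
    case (Suc n)
    have "iso_pow a (int n) (iso_pow a (- int n) b) = b"
      using iso_pow_add[OF ac, of "int n" "- int n" b] by simp
    moreover have "iso_pow a (int n) (iso_pow a 1 b) = iso_pow a (int (Suc n)) b"
      using iso_pow_add[OF ac, of "int n" 1 b] by (simp add: add.commute)
    ultimately have "len (iso_pow a (int (Suc n))) = dist (iso_pow a (- int n) b) (a b)"
      using G_dist[OF G_pow[OF assms(1), of "int n"], of "iso_pow a (- int n) b" "a b"] ac by simp
    also have "\<dots> = len (iso_pow a (- int n)) + len a - 2 * gp (iso_pow a (- int n) b) (a b)"
      by (rule dist_gromov_product)
    also have "\<dots> \<ge> real n * \<kappa> + \<kappa>"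
      using Suc A[of "int n"] len_pow_neg[OF assms(1), of "int n"] unfolding \<kappa>_def by simp
    finally show ?case by (simp add: algebra_simps)
  qed simp
  have "\<exists>N. \<forall>n\<ge>N. len (iso_pow a n) \<ge> M" for M
  proof (intro exI[of _ "max 0 \<lceil>M / \<kappa>\<rceil>"] allI impI)
    fix n assume n: "n \<ge> max 0 \<lceil>M / \<kappa>\<rceil>"
    then have "M / \<kappa> \<le> real (nat n)" by (simp add: ceiling_le_iff)
    then have "M \<le> real (nat n) * \<kappa>" using \<kappa> by (simp add: field_simps)
    also have "\<dots> \<le> len (iso_pow a (int (nat n)))" by (rule growth)
    finally show "len (iso_pow a n) \<ge> M" using n by simp
  qed
  then show ?thesis
    using bound assms(1) unfolding loxodromic_def by blast
qed

text \<open>The trace on the orbit of three distinct limit points: orbit points arbitrarily far away in three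
directions that separate within a bounded distance of \<open>b\<close>.\<close>
definition three_directions :: bool where
  "three_directions \<longleftrightarrow> (\<exists>R. \<forall>M. \<exists>g1\<in>G. \<exists>g2\<in>G. \<exists>g3\<in>G. len g1 \<ge> M \<and> len g2 \<ge> M \<and> len g3 \<ge> M \<and>
     gp (g1 b) (g2 b) \<le> R \<and> gp (g1 b) (g3 b) \<le> R \<and> gp (g2 b) (g3 b) \<le> R)"

text \<open>An element that is not loxodromic although it is long moves \<open>b\<close>
in nearly the same direction as its inverse does; the product of two such elements with different
directions sends \<open>b\<close> in the first direction and its inverse sends \<open>b\<close> in the second one.\<close>
lemma exists_loxodromic:
  assumes three_directions
  shows "\<exists>a C. loxodromic a C"
proof -
  obtain R where R: "\<And>M. \<exists>g1\<in>G. \<exists>g2\<in>G. len g1 \<ge> M \<and> len g2 \<ge> M \<and> gp (g1 b) (g2 b) \<le> R"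
    using assms unfolding three_directions_def by metis
  define M where "M = 2 * R + 100 * \<delta> + 1"
  obtain g1 g2 where g: "g1 \<in> G" "g2 \<in> G" "len g1 \<ge> M" "len g2 \<ge> M" and r: "gp (g1 b) (g2 b) \<le> R"
    using R[of M] by blast
  have R0: "R \<ge> 0" using r gromov_product_nonneg order_trans by blast
  have carr: "g1 \<in> carrier isometry_group" "g2 \<in> carrier isometry_group"
    using g G_carrier by auto
  show ?thesis
  proof (cases "gp (g1 b) (iso_inv g1 b) \<le> R + 2 * \<delta> \<or> gp (g2 b) (iso_inv g2 b) \<le> R + 2 * \<delta>")
    case True
    then have "len g1 > 2 * gp (g1 b) (iso_inv g1 b) + 4 * \<delta> \<or> len g2 > 2 * gp (g2 b) (iso_inv g2 b) + 4 * \<delta>"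
      using g(3,4) delta_nonneg unfolding M_def by linarith
    then show ?thesis
      using loxodromicI[OF g(1)] loxodromicI[OF g(2)] by blast
  next
    case False
    \<comment> \<open>Each \<open>g\<^sub>i b\<close> is now in the direction of \<open>g\<^sub>i\<^sup>-\<^sup>1 b\<close>, so \<open>g b\<close> stays close to the
      direction of \<open>g1 b\<close> and the image of \<open>b\<close> under the inverse close to that of \<open>g2 b\<close>.\<close>
    define g where "g = g1 \<circ> g2"
    have gG: "g \<in> G" using g G_comp g_def by blast
    have ig: "iso_inv g = iso_inv g2 \<circ> iso_inv g1"
      using isom.inv_mult_group[OF carr] by (simp add: g_def)
    have 1: "gp (iso_inv g1 b) (g2 b) \<le> R + \<delta>"
      using False r hyp[of b "g1 b" "iso_inv g1 b" "g2 b"] delta_nonneg by (simp add: min_def split: if_splits)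
    have 2: "gp (g1 b) (iso_inv g2 b) \<le> R + \<delta>"
      using False r hyp[of b "g1 b" "iso_inv g2 b" "g2 b"] delta_nonneg
      by (simp add: min_def gromov_product_commute split: if_splits)
    have l: "len g = len g1 + len g2 - 2 * gp (iso_inv g1 b) (g2 b)"
    proof -
      have "len g = dist (iso_inv g1 b) (g2 b)"
        using dist_iso_inv[OF carr(1), of "g2 b" b] by (simp add: g_def dist_commute)
      then show ?thesis using len_inv[OF \<open>g1 \<in> G\<close>] dist_gromov_product[of _ _ b] by metis
    qed
    have 3: "gp (g1 b) (g b) \<ge> len g1 - (R + \<delta>)"
    proof -
      have "gromov_product (g1 b) b (g b) = gp (iso_inv g1 b) (g2 b)"
        using G_gromov_product[OF \<open>g1 \<in> G\<close>, of b "iso_inv g1 b" "g2 b"] carr by (simp add: g_def)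
      then show ?thesis using 1 by (subst gromov_product_swap) simp
    qed
    have 4: "gp (iso_inv g2 b) (iso_inv g b) \<ge> len g2 - (R + \<delta>)"
    proof -
      have "gromov_product (iso_inv g2 b) b (iso_inv g b) = gp (g2 b) (iso_inv g1 b)"
        using G_gromov_product[OF G_inv[OF \<open>g2 \<in> G\<close>], of b "g2 b" "iso_inv g1 b"] carr by (simp add: ig)
      then show ?thesis using 1 len_inv[OF \<open>g2 \<in> G\<close>]
        by (subst gromov_product_swap) (simp add: gromov_product_commute)
    qed
    have 5: "gp (g b) (iso_inv g2 b) \<le> R + 2 * \<delta>"
      using hyp[of b "g1 b" "g b" "iso_inv g2 b"] 2 3 g(3) R0 delta_nonneg
      unfolding M_def by (simp add: min_def split: if_splits)
    have 6: "gp (g b) (iso_inv g b) \<le> R + 3 * \<delta>"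
      using hyp[of b "g b" "iso_inv g b" "iso_inv g2 b"] 4 5 g(4) R0 delta_nonneg
      unfolding M_def by (simp add: min_def gromov_product_commute split: if_splits)
    have "len g \<ge> 2 * M - 2 * (R + \<delta>)" using l 1 g(3,4) by (simp add: algebra_simps)
    then have "len g > 2 * gp (g b) (iso_inv g b) + 4 * \<delta>"
      using 6 R0 delta_nonneg unfolding M_def by (simp add: algebra_simps)
    then show ?thesis using loxodromicI[OF gG] by blast
  qed
qed

section \<open>A Schottky pair\<close>

text \<open>If the axes of \<open>a\<close> and of a conjugate of \<open>a'\<close> agree arbitrarily far out, then any point on the first
one lies near a geodesic from \<open>b\<close> to a far point of the second one, and comparing distances from
\<open>b\<close> finds its companion there. The bound \<open>D\<close> is independent of the point, which is what the
pigeonhole argument below needs.\<close>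
lemma loxodromic_fellow_travel:
  assumes a: "loxodromic a C" and a': "loxodromic a' C'" and h: "h \<in> G"
    and unb: "\<And>K. \<exists>i\<ge>0. \<exists>j\<ge>0. gp (iso_pow a i b) (h (iso_pow a' j b)) > K"
  shows "\<exists>D. \<forall>n\<ge>0. \<exists>m. dist (iso_pow a n b) (h (iso_pow a' m b)) \<le> D"
proof -
  have aG: "a \<in> G" "a' \<in> G" using a a' by (auto simp: loxodromic_def)
  have C: "gp (iso_pow a (- i) b) (iso_pow a j b) \<le> C" "gp (iso_pow a' (- i) b) (iso_pow a' j b) \<le> C'"
    if "i \<ge> 0" "j \<ge> 0" for i j
    using a a' that by (auto simp: loxodromic_def)
  have C0: "C \<ge> 0" "C' \<ge> 0" using C[of 0 0] by simp_all
  define D where "D = len a' + 2 * C + 2 * C' + 5 * len h + 4 * \<delta>"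
  have "\<exists>m. dist (iso_pow a n b) (h (iso_pow a' m b)) \<le> D" if n: "n \<ge> 0" for n
  proof -
    let ?A = "\<lambda>i. iso_pow a i b" and ?B = "\<lambda>j. h (iso_pow a' j b)"
    define L where "L = len (iso_pow a n)"
    have L0: "L \<ge> 0" by (simp add: L_def)
    \<comment> \<open>The maximum over the first powers forces the far index \<open>N\<close> below to exceed \<open>n\<close>.\<close>
    define K where "K = L + Max ((\<lambda>i. len (iso_pow a i)) ` {0..n}) + len h + len a' + C + \<delta>"
    obtain N M where NM: "N \<ge> 0" "M \<ge> 0" and far: "gp (?A N) (?B M) > K" using unb by blast
    have MaxL: "len (iso_pow a i) \<le> Max ((\<lambda>i. len (iso_pow a i)) ` {0..n})" if "i \<in> {0..n}" for i
      using that by (intro Max_ge) auto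
    have Nn: "N > n"
    proof (rule ccontr)
      assume "\<not> N > n"
      then have "len (iso_pow a N) \<le> Max ((\<lambda>i. len (iso_pow a i)) ` {0..n})" using NM by (intro MaxL) auto
      then show False
        using far gromov_product_le_dist[of b "?A N" "?B M"] L0 C0 delta_nonneg
          zero_le_dist[of b "h b"] zero_le_dist[of b "a' b"] unfolding K_def by linarith
    qed
    have "gromov_product (?A n) b (?A N) \<le> C"
      using pow_gromov_product[OF aG(1), of n 0 N] C(1)[of n "N - n"] n Nn by simp
    then have 1: "gp (?A n) (?A N) \<ge> L - C"
      by (subst gromov_product_swap) (simp add: L_def)
    have Max0: "Max ((\<lambda>i. len (iso_pow a i)) ` {0..n}) \<ge> 0"
      using MaxL[of 0] n by simp
    have "K \<ge> L - C"
      using L0 C0 delta_nonneg Max0 zero_le_dist[of b "h b"] zero_le_dist[of b "a' b"]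
      unfolding K_def by linarith
    then have 2: "gp (?A n) (?B M) \<ge> L - C - \<delta>"
      using hyp_trans[of "L - C" b "?A n" "?A N" "?B M"] 1 far by linarith
    have BM: "dist b (?B M) > L"
      using far gromov_product_le_dist[of b "?B M" "?A N"] C0 delta_nonneg Max0
        zero_le_dist[of b "h b"] zero_le_dist[of b "a' b"]
      unfolding K_def gromov_product_commute[of b "?B M"] by linarith
    \<comment> \<open>The first point of the second orbit that is at least as far from \<open>b\<close> as \<open>a\<^sup>n b\<close>; it overshoots
      by at most one step, or by the length of \<open>h\<close> if it is the initial point.\<close>
    define m where "m = (LEAST k. dist b (?B (int k)) \<ge> L)"
    have ex: "dist b (?B (int (nat M))) \<ge> L" using BM NM by simp
    then have m: "dist b (?B (int m)) \<ge> L" "m \<le> nat M"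
      unfolding m_def by (rule LeastI, rule Least_le)
    have m_up: "dist b (?B (int m)) \<le> L + len a' + len h"
    proof (cases m)
      case 0
      then show ?thesis using L0 by simp
    next
      case (Suc k)
      then have "k < m" by simp
      then have "\<not> L \<le> dist b (?B (int k))" unfolding m_def by (rule not_less_Least)
      then have "dist b (?B (int k)) < L" by simp
      moreover have "dist (?B (int k)) (?B (int m)) = len a'"
      proof -
        have "iso_pow a' (int m) b = iso_pow a' (int k) (a' b)"
          using iso_pow_add[OF G_carrier[OF aG(2)], of "int k" 1 b] aG(2) Suc
          by (simp add: add.commute G_carrier)
        then show ?thesis using G_dist[OF h] G_dist[OF G_pow[OF aG(2)]] by simp
      qed
      ultimately show ?thesis
        using dist_triangle[of b "?B (int m)" "?B (int k)"] zero_le_dist[of b "h b"] by linarith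
    qed
    have "gromov_product (?B (int m)) (h b) (?B M) \<le> C'"
    proof -
      have "gromov_product (?B (int m)) (h b) (?B M)
        = gromov_product (iso_pow a' (int m) b) (iso_pow a' 0 b) (iso_pow a' M b)"
        using G_gromov_product[OF h] by simp
      then show ?thesis
        using pow_gromov_product[OF aG(2), of "int m" 0 M] C(2)[of "int m" "M - int m"] m(2) NM by simp
    qed
    then have "gromov_product (h b) (?B (int m)) (?B M) \<ge> dist (h b) (?B (int m)) - C'"
      by (subst gromov_product_swap) simp
    then have 3: "gp (?B (int m)) (?B M) \<ge> dist b (?B (int m)) - C' - 2 * len h"
      using gromov_product_basepoint[of "h b" "?B (int m)" "?B M" b]
        dist_triangle[of b "?B (int m)" "h b"] by (simp add: dist_commute)
    have 4: "gp (?A n) (?B (int m)) \<ge> L - C - C' - 2 * len h - 2 * \<delta>"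
    proof -
      let ?x = "L - C - C' - 2 * len h - \<delta>"
      have "?x \<le> gp (?A n) (?B M)" "?x \<le> gp (?B M) (?B (int m))"
        using 2 3 m(1) C0 delta_nonneg zero_le_dist[of b "h b"]
        unfolding gromov_product_commute[of b "?B M"] by linarith+
      from hyp_trans[OF this] show ?thesis by linarith
    qed
    have "dist (?A n) (?B (int m)) \<le> D"
      using dist_gromov_product[of "?A n" "?B (int m)" b] 4 m_up zero_le_dist[of b "h b"] C0 delta_nonneg
      unfolding D_def L_def by (simp add: algebra_simps)
    then show ?thesis by blast
  qed
  then show ?thesis by blast
qed

text \<open>Fellow travelling produces infinitely many pairs of exponents for which \<open>a\<^sup>-\<^sup>n h a'\<^sup>m\<close> is short. By
proper discontinuity there are only finitely many short elements, so two pairs give the same one.\<close>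
lemma loxodromic_commensurable:
  assumes a: "a \<in> G" and a': "a' \<in> G" and h: "h \<in> G"
    and near: "\<And>n. n \<ge> 0 \<Longrightarrow> \<exists>m. dist (iso_pow a n b) (h (iso_pow a' m b)) \<le> D"
  shows "\<exists>i\<ge>1. \<exists>j. \<forall>x. iso_pow a i (h x) = h (iso_pow a' j x)"
proof -
  obtain m where m: "\<And>n::nat. dist (iso_pow a (int n) b) (h (iso_pow a' (m n) b)) \<le> D"
  proof -
    have "\<forall>n::nat. \<exists>m. dist (iso_pow a (int n) b) (h (iso_pow a' m b)) \<le> D" using near by simp
    then show ?thesis using that by metis
  qed
  define f where "f n = iso_pow a (- int n) \<circ> (h \<circ> iso_pow a' (m n))" for n
  have ac: "a \<in> carrier isometry_group" "a' \<in> carrier isometry_group" using a a' G_carrier by auto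
  have fG: "f n \<in> G" for n using a a' h by (simp add: f_def G_comp G_pow)
  have cancel: "iso_pow a (int n) (f n x) = h (iso_pow a' (m n) x)" for n x
    using iso_pow_add[OF ac(1), of "int n" "- int n"] by (simp add: f_def)
  have "len (f n) \<le> D" for n
  proof -
    have "len (f n) = dist (iso_pow a (int n) b) (iso_pow a (int n) (f n b))"
      using G_dist[OF G_pow[OF a]] by simp
    then show ?thesis using m[of n] by (simp add: cancel)
  qed
  then have "range f \<subseteq> {g \<in> G. len g \<le> D}" using fG by auto
  then have "finite (range f)" using finite_short finite_subset by blast
  then obtain n n' where "n < n'" and eq: "f n = f n'"
    using infinite_UNIV_nat finite_imageD[of f UNIV] by (metis injI linorder_neqE_nat)
  have "iso_pow a (int (n' - n)) (h x) = h (iso_pow a' (m n' - m n) x)" for x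
  proof -
    let ?z = "iso_pow a' (- m n) x"
    have "iso_pow a (int n') (f n ?z) = iso_pow a (int (n' - n)) (iso_pow a (int n) (f n ?z))"
      using iso_pow_add[OF ac(1), of "int (n' - n)" "int n"] \<open>n < n'\<close> by (simp add: of_nat_diff)
    also have "\<dots> = iso_pow a (int (n' - n)) (h x)"
      using iso_pow_add[OF ac(2), of "m n" "- m n" x] by (simp add: cancel)
    finally have "iso_pow a (int (n' - n)) (h x) = h (iso_pow a' (m n') ?z)"
      using eq by (simp add: cancel)
    also have "\<dots> = h (iso_pow a' (m n' - m n) x)"
      using iso_pow_add[OF ac(2), of "m n'" "- m n" x] by simp
    finally show ?thesis .
  qed
  then show ?thesis using \<open>n < n'\<close>
    by (intro exI[of _ "int (n' - n)"]) auto
qed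

text \<open>A commensurating element \<open>h\<close> maps the axis of \<open>a\<close> to a bi-infinite path at finite distance from the
axis. That distance may depend on \<open>h\<close>, but far out it does not affect Gromov products at \<open>h b\<close>,
which gives a bound uniform in \<open>h\<close>: the point \<open>h b\<close> is uniformly close to the axis.\<close>
lemma near_axis:
  assumes a: "loxodromic a C" and h: "h \<in> G"
    and comm: "i \<ge> 1" "\<And>x. iso_pow a i (h x) = h (iso_pow a j x)"
  shows "\<exists>n\<ge>N. gromov_product (h b) (iso_pow a n b) (iso_pow a (- n) b) \<le> C + 2 * \<delta>"
proof -
  have aG: "a \<in> G" and ac: "a \<in> carrier isometry_group" using a G_carrier by (auto simp: loxodromic_def)
  have C: "gp (iso_pow a (- i) b) (iso_pow a j b) \<le> C" if "i \<ge> 0" "j \<ge> 0" for i j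
    using a that by (auto simp: loxodromic_def)
  have pos: "iso_pow a (int k * i) (h x) = h (iso_pow a (int k * j) x)" for k x
  proof (induction k arbitrary: x)
    case (Suc k)
    have "iso_pow a (int (Suc k) * i) (h x) = iso_pow a (int k * i) (iso_pow a i (h x))"
      using iso_pow_add[OF ac, of "int k * i" i "h x"] by (simp add: algebra_simps)
    also have "\<dots> = h (iso_pow a (int k * j) (iso_pow a j x))" by (simp add: comm(2) Suc)
    also have "\<dots> = h (iso_pow a (int (Suc k) * j) x)"
      using iso_pow_add[OF ac, of "int k * j" j x] by (simp add: algebra_simps)
    finally show ?case .
  qed simp
  have neg: "iso_pow a (- (int k * i)) (h x) = h (iso_pow a (- (int k * j)) x)" for k x
  proof -
    have "h x = iso_pow a (int k * i) (h (iso_pow a (- (int k * j)) x))"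
      using iso_pow_add[OF ac, of "int k * j" "- (int k * j)" x] by (simp add: pos)
    then have "iso_pow a (- (int k * i)) (h x)
        = iso_pow a (- (int k * i) + int k * i) (h (iso_pow a (- (int k * j)) x))"
      using iso_pow_add[OF ac, of "- (int k * i)" "int k * i"] by simp
    then show ?thesis by simp
  qed
  obtain N' where N': "\<And>n. n \<ge> N' \<Longrightarrow> len (iso_pow a n) \<ge> C + 2 * \<delta> + 1 + 2 * len h"
    using a unfolding loxodromic_def by blast
  define k where "k = nat (max 0 (max N N'))"
  define n where "n = int k * i"
  have "int k \<le> n" using comm(1) by (simp add: n_def mult_le_cancel_left1)
  then have n: "n \<ge> N" "n \<ge> N'" by (auto simp: k_def)
  \<comment> \<open>The points \<open>a\<^sup>s h b\<close> and \<open>a\<^sup>s b\<close> are at distance \<open>len h\<close> from each other and far from \<open>h b\<close>, so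
      one may replace the other at the cost of \<open>\<delta>\<close>.\<close>
  have long: "gromov_product (h b) (iso_pow a s (h b)) (iso_pow a s b) \<ge> C + 2 * \<delta> + 1"
    if "s = n \<or> s = - n" for s
  proof -
    have "len (iso_pow a s) \<ge> C + 2 * \<delta> + 1 + 2 * len h"
      using that N'[OF n(2)] len_pow_neg[OF aG, of n] by auto
    moreover have "dist (iso_pow a s b) (iso_pow a s (h b)) = len h"
      by (rule G_dist[OF G_pow[OF aG]])
    ultimately show ?thesis
      using gromov_product_ge[of "h b" "iso_pow a s b" "iso_pow a s (h b)"]
        dist_triangle[of b "iso_pow a s b" "h b"]
      by (simp add: gromov_product_commute)
  qed
  have "gromov_product (h b) (iso_pow a n (h b)) (iso_pow a (- n) (h b)) = gp (iso_pow a (int k * j) b) (iso_pow a (- (int k * j)) b)"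
    unfolding n_def pos neg by (rule G_gromov_product[OF h])
  also have "\<dots> \<le> C"
  proof (cases "j \<ge> 0")
    case True
    then show ?thesis using C[of "int k * j" "int k * j"] by (simp add: gromov_product_commute)
  next
    case False
    then show ?thesis using C[of "- (int k * j)" "- (int k * j)"]
      by (simp add: gromov_product_commute mult_nonneg_nonpos)
  qed
  finally have 1: "gromov_product (h b) (iso_pow a n (h b)) (iso_pow a (- n) (h b)) \<le> C" .
  have 2: "gromov_product (h b) (iso_pow a n b) (iso_pow a (- n) (h b)) \<le> C + \<delta>"
    using hyp[of "h b" "iso_pow a n (h b)" "iso_pow a n b" "iso_pow a (- n) (h b)"] 1 long[of n] delta_nonneg
    by (auto simp: min_def split: if_splits)
  have "gromov_product (h b) (iso_pow a n b) (iso_pow a (- n) b) \<le> C + 2 * \<delta>"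
    using hyp[of "h b" "iso_pow a n b" "iso_pow a (- n) b" "iso_pow a (- n) (h b)"] 2 long[of "- n"] delta_nonneg
    by (auto simp: min_def gromov_product_commute split: if_splits)
  then show ?thesis using n(1) by blast
qed

lemma loxodromic_convergent:
  assumes a: "loxodromic a C"
  shows "\<exists>N. \<forall>i\<ge>N. \<forall>j\<ge>N. gp (iso_pow a i b) (iso_pow a j b) \<ge> K"
proof -
  have aG: "a \<in> G" using a by (auto simp: loxodromic_def)
  obtain N where N: "\<And>n. n \<ge> N \<Longrightarrow> len (iso_pow a n) \<ge> K + C" using a unfolding loxodromic_def by blast
  have "gp (iso_pow a i b) (iso_pow a j b) \<ge> K" if "max 0 N \<le> i" "i \<le> j" for i j
  proof -
    have "gromov_product (iso_pow a i b) b (iso_pow a j b) \<le> C"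
      using pow_gromov_product[OF aG, of i 0 j] a that unfolding loxodromic_def by simp
    then show ?thesis using N[of i] that by (subst gromov_product_swap) simp
  qed
  then show ?thesis by (metis gromov_product_commute linorder_le_cases)
qed

text \<open>A far point close to the axis lies in the direction of one of its two ends. Three separated
directions cannot share two ends.\<close>
lemma not_all_near_axis:
  assumes a: "loxodromic a C" and three_directions
  shows "\<exists>h\<in>G. \<exists>N. \<forall>n\<ge>N. gromov_product (h b) (iso_pow a n b) (iso_pow a (- n) b) > C'"
proof (rule ccontr)
  assume "\<not> ?thesis"
  then have near: "\<exists>n\<ge>N. gromov_product (h b) (iso_pow a n b) (iso_pow a (- n) b) \<le> C'" if "h \<in> G" for h N
    using that by (meson not_le)
  obtain R where R: "\<And>M. \<exists>g1\<in>G. \<exists>g2\<in>G. \<exists>g3\<in>G. len g1 \<ge> M \<and> len g2 \<ge> M \<and> len g3 \<ge> M \<and>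
     gp (g1 b) (g2 b) \<le> R \<and> gp (g1 b) (g3 b) \<le> R \<and> gp (g2 b) (g3 b) \<le> R"
    using assms unfolding three_directions_def by blast
  define Q where "Q = R + 2 * \<delta> + 1"
  obtain g1 g2 g3 where g: "g1 \<in> G" "g2 \<in> G" "g3 \<in> G"
    and l: "len g1 \<ge> 2 * Q + C'" "len g2 \<ge> 2 * Q + C'" "len g3 \<ge> 2 * Q + C'"
    and r: "gp (g1 b) (g2 b) \<le> R" "gp (g1 b) (g3 b) \<le> R" "gp (g2 b) (g3 b) \<le> R"
    using R[of "2 * Q + C'"] by blast
  have ac: "a \<in> carrier isometry_group" using a G_carrier by (auto simp: loxodromic_def)
  obtain N1 where N1: "\<And>i j. i \<ge> N1 \<Longrightarrow> j \<ge> N1 \<Longrightarrow> gp (iso_pow a i b) (iso_pow a j b) \<ge> Q"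
    using loxodromic_convergent[OF a] by blast
  obtain N2 where N2: "\<And>i j. i \<ge> N2 \<Longrightarrow> j \<ge> N2 \<Longrightarrow> gp (iso_pow a (- i) b) (iso_pow a (- j) b) \<ge> Q"
    using loxodromic_convergent[OF loxodromic_inv[OF a]] by (metis iso_pow_inv[OF ac])
  let ?P = "\<lambda>\<sigma> g. \<exists>n\<ge>max N1 N2. gp (g b) (iso_pow a (\<sigma> * n) b) \<ge> Q"
  have dir: "?P 1 g \<or> ?P (- 1) g" if gG: "g \<in> G" and gl: "len g \<ge> 2 * Q + C'" for g
  proof -
    obtain n where n: "n \<ge> max N1 N2" "gromov_product (g b) (iso_pow a n b) (iso_pow a (- n) b) \<le> C'"
      using near[OF gG] by blast
    have "dist (iso_pow a n b) (iso_pow a (- n) b) \<le> len (iso_pow a n) + len (iso_pow a (- n))"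
      by (metis dist_commute dist_triangle)
    then have "len g - gp (g b) (iso_pow a n b) - gp (g b) (iso_pow a (- n) b) \<le> C'"
      using n(2) by (simp add: gromov_product_def dist_commute field_simps)
    then have "gp (g b) (iso_pow a n b) \<ge> Q \<or> gp (g b) (iso_pow a (- n) b) \<ge> Q"
      using gl by linarith
    then show ?thesis using n(1) by (metis mult_1 mult_minus1)
  qed
  have clash: False if P: "?P \<sigma> g" "?P \<sigma> g'" and s: "\<sigma> = 1 \<or> \<sigma> = - 1" and le: "gp (g b) (g' b) \<le> R" for \<sigma> g g'
  proof -
    obtain n n' where n: "n \<ge> max N1 N2" "gp (g b) (iso_pow a (\<sigma> * n) b) \<ge> Q"
      "n' \<ge> max N1 N2" "gp (g' b) (iso_pow a (\<sigma> * n') b) \<ge> Q" using P by blast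
    have "gp (iso_pow a (\<sigma> * n) b) (iso_pow a (\<sigma> * n') b) \<ge> Q" using s N1 N2 n by auto
    then have "gp (g b) (iso_pow a (\<sigma> * n') b) \<ge> Q - \<delta>"
      using hyp[of b "g b" "iso_pow a (\<sigma> * n) b" "iso_pow a (\<sigma> * n') b"] n(2)
      by (auto simp: min_def split: if_splits)
    then have "gp (g b) (g' b) \<ge> Q - 2 * \<delta>"
      using hyp[of b "g b" "iso_pow a (\<sigma> * n') b" "g' b"] n(4) delta_nonneg
      by (auto simp: min_def gromov_product_commute split: if_splits)
    then show False using le by (simp add: Q_def)
  qed
  show False
    using dir[OF g(1) l(1)] dir[OF g(2) l(2)] dir[OF g(3) l(3)] clash[of g1 _ g2] clash[of g1 _ g3] clash[of g2 _ g3] r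
    by blast
qed

text \<open>Choose \<open>h\<close> with \<open>h b\<close> far from the axis. Were one of the four pairs of half-axes of \<open>a\<close> and its
translate by \<open>h\<close> unbounded together, \<open>h\<close> would commensurate \<open>a\<close>, and \<open>h b\<close> would be near the axis.\<close>
lemma exists_independent_conjugate:
  assumes a: "loxodromic a C" and three_directions
  shows "\<exists>h\<in>G. \<exists>K. \<forall>i j. gp (iso_pow a i b) (h (iso_pow a j b)) \<le> K"
proof -
  obtain h N where h: "h \<in> G" and far: "\<And>n. n \<ge> N \<Longrightarrow> gromov_product (h b) (iso_pow a n b) (iso_pow a (- n) b) > C + 2 * \<delta>"
    using not_all_near_axis[OF assms, of "C + 2 * \<delta>"] by blast
  have aG: "a \<in> G" and ac: "a \<in> carrier isometry_group" using a G_carrier by (auto simp: loxodromic_def)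
  have no: False if "i \<ge> 1" "\<And>x. iso_pow a i (h x) = h (iso_pow a j x)" for i j
    using near_axis[OF a h that, of N] far by fastforce
  have a2: "iso_pow (iso_inv a) k = iso_pow a (- k)" for k by (rule iso_pow_inv[OF ac])
  have bdd: "\<exists>K. \<forall>i\<ge>0. \<forall>j\<ge>0. gp (iso_pow a1 i b) (h (iso_pow a2 j b)) \<le> K"
    if a12: "a1 = a \<or> a1 = iso_inv a" "a2 = a \<or> a2 = iso_inv a" for a1 a2
  proof (rule ccontr)
    assume "\<not> ?thesis"
    then have unb: "\<exists>i\<ge>0. \<exists>j\<ge>0. gp (iso_pow a1 i b) (h (iso_pow a2 j b)) > K" for K
      by (meson not_le)
    have lox: "loxodromic a1 C" "loxodromic a2 C" using a12 a loxodromic_inv by auto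
    then have G12: "a1 \<in> G" "a2 \<in> G" by (auto simp: loxodromic_def)
    obtain i j where ij: "i \<ge> 1" "\<And>x. iso_pow a1 i (h x) = h (iso_pow a2 j x)"
      using loxodromic_fellow_travel[OF lox h unb] loxodromic_commensurable[OF G12 h] by metis
    obtain j' where j': "\<And>x. iso_pow a1 i (h x) = h (iso_pow a j' x)"
      using ij(2) a12(2) a2 by metis
    show False
    proof (cases "a1 = a")
      case True
      then show False using no[OF ij(1)] j' by blast
    next
      case False
      then have a1: "a1 = iso_inv a" using a12 by blast
      have "iso_pow a i (h x) = h (iso_pow a (- j') x)" for x
      proof -
        have "h x = iso_pow a (- i) (h (iso_pow a (- j') x))"
          using j'[of "iso_pow a (- j') x"] iso_pow_add[OF ac, of j' "- j'" x] by (simp add: a1 a2)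
        then have "iso_pow a i (h x) = iso_pow a (i + - i) (h (iso_pow a (- j') x))"
          using iso_pow_add[OF ac, of i "- i"] by metis
        then show ?thesis by simp
      qed
      then show False using no[OF ij(1)] by blast
    qed
  qed
  obtain K1 where K1: "\<And>i j. i \<ge> 0 \<Longrightarrow> j \<ge> 0 \<Longrightarrow> gp (iso_pow a i b) (h (iso_pow a j b)) \<le> K1"
    using bdd[of "a" "a"] unfolding a2 by metis
  obtain K2 where K2: "\<And>i j. i \<ge> 0 \<Longrightarrow> j \<ge> 0 \<Longrightarrow> gp (iso_pow a i b) (h (iso_pow a (- j) b)) \<le> K2"
    using bdd[of "a" "iso_inv a"] unfolding a2 by metis
  obtain K3 where K3: "\<And>i j. i \<ge> 0 \<Longrightarrow> j \<ge> 0 \<Longrightarrow> gp (iso_pow a (- i) b) (h (iso_pow a j b)) \<le> K3"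
    using bdd[of "iso_inv a" "a"] unfolding a2 by metis
  obtain K4 where K4: "\<And>i j. i \<ge> 0 \<Longrightarrow> j \<ge> 0 \<Longrightarrow> gp (iso_pow a (- i) b) (h (iso_pow a (- j) b)) \<le> K4"
    using bdd[of "iso_inv a" "iso_inv a"] unfolding a2 by metis
  have "gp (iso_pow a i b) (h (iso_pow a j b)) \<le> max (max K1 K2) (max K3 K4)" for i j
    using K1[of i j] K2[of i "- j"] K3[of "- i" j] K4[of "- i" "- j"]
    by (cases "i \<ge> 0"; cases "j \<ge> 0") auto
  then show ?thesis using h by blast
qed

text \<open>The elements are \<open>a\<^sup>n\<close> and \<open>h a\<^sup>n h\<^sup>-\<^sup>1\<close>. Conjugation changes lengths and Gromov products by a multiple
of the length of \<open>h\<close> only, so \<open>C\<close> and \<open>D\<close> do not depend on \<open>n\<close> while the lengths tend to infinity.\<close>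
theorem schottky_pair:
  assumes three_directions
  shows "\<exists>C D. \<forall>L. \<exists>s\<in>G. \<exists>s'\<in>G. len s \<ge> L \<and> len s' \<ge> L \<and> \<bar>len s' - len s\<bar> \<le> D \<and>
    gp (s b) (iso_inv s b) \<le> C \<and> gp (s' b) (iso_inv s' b) \<le> C \<and>
    gp (s b) (s' b) \<le> C \<and> gp (s b) (iso_inv s' b) \<le> C \<and>
    gp (iso_inv s b) (s' b) \<le> C \<and> gp (iso_inv s b) (iso_inv s' b) \<le> C"
proof -
  obtain a C0 where a: "loxodromic a C0" using exists_loxodromic[OF assms] by blast
  obtain h K where h: "h \<in> G" and K: "\<And>i j. gp (iso_pow a i b) (h (iso_pow a j b)) \<le> K"
    using exists_independent_conjugate[OF a assms] by blast
  have aG: "a \<in> G" and ac: "a \<in> carrier isometry_group" and hc: "h \<in> carrier isometry_group"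
    using a h G_carrier by (auto simp: loxodromic_def)
  define q where "q n = h \<circ> (iso_pow a n \<circ> iso_inv h)" for n
  have qG: "q n \<in> G" for n using h aG by (simp add: q_def G_comp G_pow G_inv)
  have iq: "iso_inv (q n) = q (- n)" for n
  proof -
    have "q (- n) \<circ> q n = id"
      using iso_pow_add[OF ac, of "- n" n] hc by (auto simp: q_def fun_eq_iff)
    then show ?thesis
      using isom.inv_equality[of "q (- n)" "q n"] qG G_carrier by simp
  qed
  have ip: "iso_inv (iso_pow a n) = iso_pow a (- n)" for n
    using isom.int_pow_neg[OF ac] by simp
  have q_near: "dist (q n b) (h (iso_pow a n b)) = len h" for n
    using G_dist[OF h] G_dist[OF G_pow[OF aG]] len_inv[OF h] by (simp add: q_def dist_commute)
  define C where "C = max K C0 + 3 * len h"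
  have cross: "gp (iso_pow a i b) (q j b) \<le> C" for i j
    using gromov_product_lipschitz[of b "iso_pow a i b" "q j b" "h (iso_pow a j b)"] K[of i j] q_near[of j]
      zero_le_dist[of b "h b"]
    unfolding C_def by linarith
  have self: "gp (iso_pow a n b) (iso_pow a (- n) b) \<le> C0" if "n \<ge> 0" for n
    using a that unfolding loxodromic_def by (simp add: gromov_product_commute)
  have selfq: "gp (q n b) (q (- n) b) \<le> C" if "n \<ge> 0" for n
  proof -
    have "gp (q n b) (q (- n) b) \<le> gp (q n b) (h (iso_pow a (- n) b)) + len h"
      using gromov_product_lipschitz[of b "q n b" "q (- n) b" "h (iso_pow a (- n) b)"] q_near[of "- n"] by simp
    also have "\<dots> \<le> gp (h (iso_pow a n b)) (h (iso_pow a (- n) b)) + 2 * len h"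
      using gromov_product_lipschitz[of b "h (iso_pow a (- n) b)" "q n b" "h (iso_pow a n b)"] q_near[of n]
      by (simp add: gromov_product_commute)
    also have "\<dots> \<le> gromov_product (h b) (h (iso_pow a n b)) (h (iso_pow a (- n) b)) + 3 * len h"
      using gromov_product_basepoint[of b "h (iso_pow a n b)" "h (iso_pow a (- n) b)" "h b"]
      by linarith
    also have "\<dots> \<le> C"
      using self[OF that] unfolding C_def G_gromov_product[OF h] by linarith
    finally show ?thesis .
  qed
  have lenq: "\<bar>len (q n) - len (iso_pow a n)\<bar> \<le> 2 * len h" for n
  proof -
    have "dist (h b) (h (iso_pow a n b)) = len (iso_pow a n)" by (rule G_dist[OF h])
    then show ?thesis
      using q_near[of n] dist_triangle[of b "q n b" "h b"] dist_triangle[of "h b" "q n b" "h (iso_pow a n b)"]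
        dist_triangle[of "h b" "h (iso_pow a n b)" b] dist_triangle[of b "h (iso_pow a n b)" "q n b"]
      by (simp add: dist_commute abs_le_iff)
  qed
  show ?thesis
  proof (rule exI[of _ C], rule exI[of _ "2 * len h"], rule allI)
    fix L
    obtain N where N: "\<And>n. n \<ge> N \<Longrightarrow> len (iso_pow a n) \<ge> L + 2 * len h"
      using a unfolding loxodromic_def by blast
    define n where "n = max 0 N"
    have n: "n \<ge> 0" "len (iso_pow a n) \<ge> L + 2 * len h" using N by (auto simp: n_def)
    have "C0 \<le> C" unfolding C_def using zero_le_dist[of b "h b"] by linarith
    then have "gp (iso_pow a n b) (iso_pow a (- n) b) \<le> C" using self[OF n(1)] by linarith
    moreover have "len (iso_pow a n) \<ge> L" "len (q n) \<ge> L"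
      using n lenq[of n] zero_le_dist[of b "h b"] by linarith+
    ultimately show "\<exists>s\<in>G. \<exists>s'\<in>G. len s \<ge> L \<and> len s' \<ge> L \<and> \<bar>len s' - len s\<bar> \<le> 2 * len h \<and>
      gp (s b) (iso_inv s b) \<le> C \<and> gp (s' b) (iso_inv s' b) \<le> C \<and>
      gp (s b) (s' b) \<le> C \<and> gp (s b) (iso_inv s' b) \<le> C \<and>
      gp (iso_inv s b) (s' b) \<le> C \<and> gp (iso_inv s b) (iso_inv s' b) \<le> C"
      using lenq[of n] selfq[OF n(1)] cross
      by (intro bexI[OF _ G_pow[OF aG, of n]] bexI[OF _ qG[of n]] conjI) (simp_all only: ip iq)
  qed
qed

end

section \<open>Convergence to the boundary\<close>

lemma powr_neg_le:
  assumes "a > 1" "ereal R \<le> e"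
  shows "powr_neg a e \<le> a powr (- R)"
  using assms by (cases e) (auto simp: powr_neg_def)

lemma tendsto_gromov_product:
  assumes "u \<longlonglongrightarrow> x" "v \<longlonglongrightarrow> y"
  shows "(\<lambda>n. gromov_product b (u n) (v n)) \<longlonglongrightarrow> gromov_product b x y"
  unfolding gromov_product_def using assms by (intro tendsto_intros) auto

lemma ext_gromov_product_Inl: "ereal (gromov_product b x y) \<le> ext_gromov_product b (Inl x) (Inl y)"
  unfolding ext_gromov_product_def
proof (rule INF_greatest, clarify)
  fix u v assume "seq_tends_to b u (Inl x)" "seq_tends_to b v (Inl y)"
  then have "(\<lambda>n. ereal (gromov_product b (u n) (v n))) \<longlonglongrightarrow> ereal (gromov_product b x y)"
    by (auto simp: seq_tends_to_def intro: tendsto_gromov_product)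
  from lim_imp_Liminf[OF trivial_limit_sequentially this]
  show "ereal (gromov_product b x y) \<le> liminf (\<lambda>n. ereal (gromov_product b (u n) (v n)))"
    by simp
qed

lemma seq_tends_to_Inr:
  "seq_tends_to b u (Inr c) \<longleftrightarrow>
    (\<forall>\<sigma>\<in>c. \<forall>K. \<exists>N T. \<forall>n\<ge>N. \<forall>t\<ge>T. gromov_product b (u n) (\<sigma> t) \<ge> K)" (is "?L \<longleftrightarrow> ?R")
proof -
  have "filterlim (\<lambda>(n, t). f n t) at_top (sequentially \<times>\<^sub>F at_top) \<longleftrightarrow>
      (\<forall>K. \<exists>N T. \<forall>n\<ge>N. \<forall>t\<ge>T. f n t \<ge> K)" (is "_ \<longleftrightarrow> (\<forall>K. ?Q K)") for f :: "nat \<Rightarrow> real \<Rightarrow> real"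
  proof -
    have "eventually (\<lambda>x. K \<le> (case x of (n, t) \<Rightarrow> f n t)) (sequentially \<times>\<^sub>F at_top) \<longleftrightarrow> ?Q K"
      (is "?P \<longleftrightarrow> _") for K
    proof
      assume ?P
      then obtain Pf Pg N T where "\<forall>n\<ge>N. Pf n" "\<forall>n\<ge>T. Pg n"
        "\<And>x y. Pf x \<Longrightarrow> Pg y \<Longrightarrow> K \<le> f x y"
        unfolding eventually_prod_filter eventually_sequentially eventually_at_top_linorder by auto
      then show "?Q K" by (intro exI[of _ N] exI[of _ T]) auto
    next
      assume "?Q K"
      then obtain N T where "\<forall>n\<ge>N. \<forall>t\<ge>T. K \<le> f n t" by blast
      then show ?P
        unfolding eventually_prod_filter eventually_sequentially eventually_at_top_linorder
        by (intro exI[of _ "\<lambda>n. n \<ge> N"] exI[of _ "\<lambda>t. t \<ge> T"]) auto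
    qed
    then show ?thesis by (simp add: filterlim_at_top)
  qed
  then show ?thesis by (simp add: seq_tends_to_def)
qed

lemma ideal_boundaryE:
  assumes "\<xi> \<in> ideal_boundary"
  obtains c \<sigma> where "\<xi> = Inr c" "\<sigma> \<in> c" "\<sigma> \<in> geodesic_rays"
proof -
  obtain \<sigma> where \<sigma>: "\<xi> = Inr (ray_rel `` {\<sigma>})" "\<sigma> \<in> geodesic_rays"
    using assms by (auto simp: ideal_boundary_def quotient_def)
  moreover have "\<sigma> \<in> ray_rel `` {\<sigma>}"
    using \<sigma>(2) by (auto simp: ray_rel_def bdd_above_def image_def intro!: exI[of _ 0])
  ultimately show ?thesis using that by blast
qed

text \<open>Closed balls are compact, so by Tychonoff's theorem the maps that are within \<open>\<bar>t\<bar>\<close> of \<open>b\<close> at each time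
\<open>t\<close> form a compact set for pointwise convergence. A cluster point, approximated at two times simultaneously, is all that is
needed to pass isometry relations to the limit.\<close>
lemma pointwise_cluster_point:
  fixes c :: "nat \<Rightarrow> real \<Rightarrow> 'a::gromov_hyperbolic_space"
  assumes "\<And>n t. dist b (c n t) \<le> \<bar>t\<bar>"
  shows "\<exists>\<sigma>. \<forall>s t e N. e > 0 \<longrightarrow> (\<exists>n\<ge>N. dist (c n s) (\<sigma> s) < e \<and> dist (c n t) (\<sigma> t) < e)"
proof -
  define K where "K = (\<Pi>\<^sub>E t\<in>UNIV. cball b \<bar>t\<bar> :: 'a set)"
  have "compactin (product_topology (\<lambda>_. euclidean) UNIV) K"
    unfolding K_def compactin_PiE using proper by auto
  then have "compact K" by (simp add: euclidean_product_topology)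
  moreover have "filtermap c sequentially \<noteq> bot" by (simp add: filtermap_bot_iff)
  moreover have "eventually (\<lambda>f. f \<in> K) (filtermap c sequentially)"
    using assms by (auto simp: eventually_filtermap K_def intro!: always_eventually)
  ultimately obtain \<sigma> where \<sigma>: "inf (nhds \<sigma>) (filtermap c sequentially) \<noteq> bot"
    unfolding compact_filter le_principal by blast
  have "\<exists>n\<ge>N. dist (c n s) (\<sigma> s) < e \<and> dist (c n t) (\<sigma> t) < e" if "e > 0" for s t e N
  proof (rule ccontr)
    assume no: "\<not> ?thesis"
    define U where "U = {f. f s \<in> ball (\<sigma> s) e \<and> f t \<in> ball (\<sigma> t) e}"
    have op: "open ((\<lambda>f. f r) -` ball (\<sigma> r) e)" for r
      by (rule open_vimage) (auto intro: continuous_on_product_coordinates)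
    have "open ((\<lambda>f. f s) -` ball (\<sigma> s) e \<inter> (\<lambda>f. f t) -` ball (\<sigma> t) e)"
      by (intro open_Int op)
    also have "(\<lambda>f. f s) -` ball (\<sigma> s) e \<inter> (\<lambda>f. f t) -` ball (\<sigma> t) e = U"
      by (auto simp: U_def)
    finally have "open U" .
    then have "eventually (\<lambda>f. f \<in> U) (nhds \<sigma>)"
      using that by (intro eventually_nhds_in_open) (auto simp: U_def)
    moreover have "eventually (\<lambda>f. f \<notin> U) (filtermap c sequentially)"
      unfolding eventually_filtermap eventually_sequentially
      using no by (intro exI[of _ N]) (auto simp: U_def dist_commute)
    ultimately have "eventually (\<lambda>_. False) (inf (nhds \<sigma>) (filtermap c sequentially))"
      unfolding eventually_inf by blast
    then show False using \<sigma> by (simp add: trivial_limit_def)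
  qed
  then show ?thesis by blast
qed

context hyperbolic_action
begin

text \<open>The ray is a cluster point of geodesics from \<open>b\<close> to the \<open>x\<^sub>n\<close>: a point of such a geodesic at distance
\<open>t\<close> from \<open>b\<close> has Gromov product exactly \<open>t\<close> with its end point.\<close>
lemma gromov_sequence_limit_ray:
  fixes x :: "nat \<Rightarrow> 'a"
  assumes cauchy: "\<And>K. \<exists>N. \<forall>n\<ge>N. \<forall>m\<ge>N. gp (x n) (x m) \<ge> K"
  shows "\<exists>\<sigma>\<in>geodesic_rays. \<forall>K. \<exists>N T. \<forall>n\<ge>N. \<forall>t\<ge>T. gp (x n) (\<sigma> t) \<ge> K"
proof -
  define D where "D n = dist b (x n)" for n
  have "\<forall>n. \<exists>\<gamma>. \<gamma> 0 = b \<and> \<gamma> (D n) = x n \<and>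
    (\<forall>s\<in>{0..D n}. \<forall>t\<in>{0..D n}. dist (\<gamma> s) (\<gamma> t) = \<bar>s - t\<bar>)"
    unfolding D_def by (intro allI geodesic)
  then obtain \<gamma> where \<gamma>: "\<And>n. \<gamma> n 0 = b" "\<And>n. \<gamma> n (D n) = x n"
    "\<And>n s t. s \<in> {0..D n} \<Longrightarrow> t \<in> {0..D n} \<Longrightarrow> dist (\<gamma> n s) (\<gamma> n t) = \<bar>s - t\<bar>"
    by metis
  \<comment> \<open>The geodesics are stopped at their end points, to be defined at all times.\<close>
  define c where "c n t = \<gamma> n (max 0 (min t (D n)))" for n t
  have D0: "D n \<ge> 0" for n by (simp add: D_def)
  have "dist b (c n t) \<le> \<bar>t\<bar>" for n t
    using \<gamma>(3)[of 0 n "max 0 (min t (D n))"] D0[of n] by (simp add: c_def \<gamma>(1))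
  then obtain \<sigma> where \<sigma>: "\<And>s t e N. e > 0 \<Longrightarrow> \<exists>n\<ge>N. dist (c n s) (\<sigma> s) < e \<and> dist (c n t) (\<sigma> t) < e"
    using pointwise_cluster_point[of b c] by blast
  have D_inf: "\<exists>N. \<forall>n\<ge>N. D n \<ge> K" for K
    using cauchy[of K] unfolding D_def by (metis gromov_product_self)
  have "dist (\<sigma> s) (\<sigma> t) = \<bar>s - t\<bar>" if st: "s \<ge> 0" "t \<ge> 0" for s t
  proof -
    have "\<bar>dist (\<sigma> s) (\<sigma> t) - \<bar>s - t\<bar>\<bar> \<le> e" if "e > 0" for e
    proof -
      obtain N where N: "\<And>n. n \<ge> N \<Longrightarrow> D n \<ge> max s t" using D_inf[of "max s t"] by blast
      obtain n where n: "n \<ge> N" "dist (c n s) (\<sigma> s) < e/2" "dist (c n t) (\<sigma> t) < e/2"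
        using \<sigma>[of "e/2" N s t] \<open>e > 0\<close> by auto
      have "dist (c n s) (c n t) = \<bar>s - t\<bar>"
        using \<gamma>(3)[of s n t] N[OF n(1)] st by (simp add: c_def)
      moreover have "dist (\<sigma> s) (c n s) < e/2" "dist (\<sigma> t) (c n t) < e/2"
        using n(2,3) by (simp_all add: dist_commute)
      ultimately show ?thesis
        using n(2,3) dist_triangle[of "\<sigma> s" "\<sigma> t" "c n s"] dist_triangle[of "c n s" "\<sigma> t" "c n t"]
          dist_triangle[of "c n s" "c n t" "\<sigma> s"] dist_triangle[of "\<sigma> s" "c n t" "\<sigma> t"]
        by linarith
    qed
    then have "\<bar>dist (\<sigma> s) (\<sigma> t) - \<bar>s - t\<bar>\<bar> \<le> 0" by (rule field_le_epsilon) simp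
    then show ?thesis by simp
  qed
  then have ray: "\<sigma> \<in> geodesic_rays" by (simp add: geodesic_rays_def)
  have "\<exists>N T. \<forall>n\<ge>N. \<forall>t\<ge>T. gp (x n) (\<sigma> t) \<ge> K" for K
  proof -
    obtain N where N: "\<And>n m. n \<ge> N \<Longrightarrow> m \<ge> N \<Longrightarrow> gp (x n) (x m) \<ge> K + \<delta>"
      using cauchy by blast
    have "gp (x n) (\<sigma> t) \<ge> K" if n: "n \<ge> N" and t: "t \<ge> max 0 (K + \<delta> + 1)" for n t
    proof -
      obtain N' where N': "\<And>n. n \<ge> N' \<Longrightarrow> D n \<ge> t" using D_inf by blast
      obtain m where m: "m \<ge> max N N'" "dist (c m t) (\<sigma> t) < 1"
        using \<sigma>[of 1 "max N N'" t t] by auto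
      have Dm: "D m \<ge> t" using N' m by simp
      have "dist b (c m t) = t" "dist (x m) (c m t) = D m - t"
        using \<gamma>(3)[of 0 m t] \<gamma>(3)[of "D m" m t] \<gamma>(1,2)[of m] t Dm by (simp_all add: c_def)
      then have "gp (x m) (c m t) = t" by (simp add: gromov_product_def D_def)
      then have "gp (x m) (\<sigma> t) \<ge> K + \<delta>"
        using gromov_product_lipschitz[of b "x m" "c m t" "\<sigma> t"] m(2) t by simp
      then show ?thesis using hyp_trans[of "K + \<delta>" b "x n" "x m" "\<sigma> t"] N[OF n, of m] m(1) by simp
    qed
    then show ?thesis by blast
  qed
  then show ?thesis using ray by blast
qed

lemma ext_gromov_product_Inl_Inr:
  assumes \<sigma>: "\<sigma> \<in> c" and far: "\<And>t. t \<ge> T \<Longrightarrow> gp (\<sigma> t) x \<ge> K"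
  shows "ext_gromov_product b (Inr c) (Inl x) \<ge> ereal (K - \<delta> - 1)"
  unfolding ext_gromov_product_def
proof (rule INF_greatest, clarify)
  fix u v assume u: "seq_tends_to b u (Inr c)" and v: "seq_tends_to b v (Inl x)"
  obtain N1 T1 where N1: "\<And>n t. n \<ge> N1 \<Longrightarrow> t \<ge> T1 \<Longrightarrow> gp (u n) (\<sigma> t) \<ge> K"
    using u \<sigma> unfolding seq_tends_to_Inr by blast
  have "eventually (\<lambda>n. dist (v n) x < 1) sequentially"
    using v by (auto simp: seq_tends_to_def intro: tendstoD)
  then obtain N2 where N2: "\<And>n. n \<ge> N2 \<Longrightarrow> dist (v n) x < 1" unfolding eventually_sequentially by blast
  have "gp (u n) (v n) \<ge> K - \<delta> - 1" if "n \<ge> max N1 N2" for n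
  proof -
    have "gp (u n) x \<ge> K - \<delta>"
      using hyp_trans[of K b "u n" "\<sigma> (max T T1)" x] N1[of n "max T T1"] far[of "max T T1"] that by simp
    then show ?thesis
      using gromov_product_lipschitz[of b "u n" x "v n"] N2[of n] that by (simp add: dist_commute)
  qed
  then have "eventually (\<lambda>n. ereal (K - \<delta> - 1) \<le> ereal (gp (u n) (v n))) sequentially"
    unfolding eventually_sequentially ereal_less_eq by blast
  then show "ereal (K - \<delta> - 1) \<le> liminf (\<lambda>n. ereal (gp (u n) (v n)))"
    by (rule Liminf_bounded)
qed

lemma gromov_sequence_convergent:
  assumes cauchy: "\<And>K. \<exists>N. \<forall>n\<ge>N. \<forall>m\<ge>N. gp (x n) (x m) \<ge> K"
  shows "\<exists>\<xi>\<in>ideal_boundary. seq_tends_to b x \<xi> \<and> limitin (bord_topology b) (\<lambda>n. Inl (x n)) \<xi> sequentially"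
proof -
  obtain \<sigma> where ray: "\<sigma> \<in> geodesic_rays"
    and far: "\<And>K. \<exists>N T. \<forall>n\<ge>N. \<forall>t\<ge>T. gp (x n) (\<sigma> t) \<ge> K"
    using gromov_sequence_limit_ray[OF cauchy] by blast
  define c where "c = ray_rel `` {\<sigma>}"
  have \<sigma>c: "\<sigma> \<in> c"
    using ray by (auto simp: c_def ray_rel_def bdd_above_def image_def intro!: exI[of _ 0])
  have bd: "Inr c \<in> ideal_boundary"
    using ray by (auto simp: ideal_boundary_def c_def intro: quotientI)
  have st: "seq_tends_to b x (Inr c)"
    unfolding seq_tends_to_Inr
  proof (intro ballI allI)
    fix \<tau> K assume "\<tau> \<in> c"
    then obtain B where B: "\<And>t. t \<ge> 0 \<Longrightarrow> dist (\<sigma> t) (\<tau> t) \<le> B"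
      unfolding c_def ray_rel_def bdd_above_def by auto
    obtain N T where NT: "\<And>n t. n \<ge> N \<Longrightarrow> t \<ge> T \<Longrightarrow> gp (x n) (\<sigma> t) \<ge> K + B" using far by blast
    have "gp (x n) (\<tau> t) \<ge> K" if "n \<ge> N" "t \<ge> max 0 T" for n t
      using NT[of n t] B[of t] gromov_product_lipschitz[of b "x n" "\<sigma> t" "\<tau> t"] that by simp
    then show "\<exists>N T. \<forall>n\<ge>N. \<forall>t\<ge>T. gp (x n) (\<tau> t) \<ge> K" by blast
  qed
  have "limitin (bord_topology b) (\<lambda>n. Inl (x n)) (Inr c) sequentially"
    unfolding limitin_def topspace_bord_topology
  proof (intro conjI allI impI)
    show "Inr c \<in> bordification" using bd by (simp add: bordification_def)
    fix U assume U: "openin (bord_topology b) U \<and> Inr c \<in> U"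
    then obtain R where R: "\<And>y. y \<in> bordification \<Longrightarrow> ext_gromov_product b (Inr c) y > ereal R \<Longrightarrow> y \<in> U"
      unfolding openin_bord_topology using bd by blast
    obtain N T where NT: "\<And>n t. n \<ge> N \<Longrightarrow> t \<ge> T \<Longrightarrow> gp (x n) (\<sigma> t) \<ge> R + \<delta> + 2" using far by blast
    have "Inl (x n) \<in> U" if "n \<ge> N" for n
    proof (rule R)
      have "ext_gromov_product b (Inr c) (Inl (x n)) \<ge> ereal ((R + \<delta> + 2) - \<delta> - 1)"
        using NT[OF that] by (intro ext_gromov_product_Inl_Inr[OF \<sigma>c, of T]) (simp add: gromov_product_commute)
      then show "ext_gromov_product b (Inr c) (Inl (x n)) > ereal R"
        by (rule order_less_le_trans[rotated]) simp
    qed (simp add: bordification_def)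
    then show "eventually (\<lambda>n. Inl (x n) \<in> U) sequentially" unfolding eventually_sequentially by blast
  qed
  then show ?thesis using bd st by blast
qed

text \<open>Two sequences with the same limit have Gromov products tending to infinity, so exchanging the
sequences in the infimum that defines the extended product costs \<open>\<delta>\<close> on each side.\<close>
lemma ext_gromov_product_boundary:
  assumes "\<xi> \<in> ideal_boundary" "\<eta> \<in> ideal_boundary" "seq_tends_to b x \<xi>" "seq_tends_to b y \<eta>"
    and ge: "\<And>n. n \<ge> N \<Longrightarrow> gp (x n) (y n) \<ge> A"
  shows "ext_gromov_product b \<xi> \<eta> \<ge> ereal (A - 2 * \<delta>)"
proof -
  have same: "\<exists>N. \<forall>n\<ge>N. gp (u n) (x n) \<ge> A"
    if \<xi>: "\<xi> \<in> ideal_boundary" and u: "seq_tends_to b u \<xi>" "seq_tends_to b x \<xi>" for \<xi> u x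
  proof -
    obtain c \<sigma> where c: "\<xi> = Inr c" "\<sigma> \<in> c" using ideal_boundaryE[OF \<xi>] by metis
    obtain N1 T1 where 1: "\<And>n t. n \<ge> N1 \<Longrightarrow> t \<ge> T1 \<Longrightarrow> gp (u n) (\<sigma> t) \<ge> A + \<delta>"
      using u(1) c unfolding c(1) seq_tends_to_Inr by blast
    obtain N2 T2 where 2: "\<And>n t. n \<ge> N2 \<Longrightarrow> t \<ge> T2 \<Longrightarrow> gp (x n) (\<sigma> t) \<ge> A + \<delta>"
      using u(2) c unfolding c(1) seq_tends_to_Inr by blast
    have "gp (u n) (x n) \<ge> A" if "n \<ge> max N1 N2" for n
      using hyp_trans[of "A + \<delta>" b "u n" "\<sigma> (max T1 T2)" "x n"] 1[of n "max T1 T2"] 2[of n "max T1 T2"] that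
      by (simp add: gromov_product_commute)
    then show ?thesis by blast
  qed
  show ?thesis
    unfolding ext_gromov_product_def
  proof (rule INF_greatest, clarify)
    fix u v assume u: "seq_tends_to b u \<xi>" and v: "seq_tends_to b v \<eta>"
    obtain N1 where N1: "\<And>n. n \<ge> N1 \<Longrightarrow> gp (u n) (x n) \<ge> A" using same[OF assms(1) u assms(3)] by blast
    obtain N2 where N2: "\<And>n. n \<ge> N2 \<Longrightarrow> gp (v n) (y n) \<ge> A" using same[OF assms(2) v assms(4)] by blast
    have "gp (u n) (v n) \<ge> A - 2 * \<delta>" if "n \<ge> max N (max N1 N2)" for n
    proof -
      have "gp (u n) (y n) \<ge> A - \<delta>"
        using hyp_trans[of A b "u n" "x n" "y n"] N1 ge that by simp
      then have "gp (u n) (v n) \<ge> A - \<delta> - \<delta>"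
        using hyp_trans[of "A - \<delta>" b "u n" "y n" "v n"] N2[of n] delta_nonneg that by (simp add: gromov_product_commute)
      then show ?thesis by simp
    qed
    then have "eventually (\<lambda>n. ereal (A - 2 * \<delta>) \<le> ereal (gp (u n) (v n))) sequentially"
      unfolding eventually_sequentially ereal_less_eq by blast
    then show "ereal (A - 2 * \<delta>) \<le> liminf (\<lambda>n. ereal (gp (u n) (v n)))"
      by (rule Liminf_bounded)
  qed
qed

text \<open>Take small balls of the visual metric around three limit points. Orbit points in different balls
have a visual distance bounded from below, and since the visual metric is bounded above by
\<open>a\<^sup>-\<^sup>(\<^sup>x\<^sup>|\<^sup>y\<^sup>)\<close>, their Gromov product is bounded above.\<close>
lemma three_directions_if_non_elementary:
  assumes a: "a > 1" and vis: "visual_metric b a d" and ne: "non_elementary b G"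
  shows three_directions
proof -
  have ms: "Metric_space bordification d" and top: "Metric_space.mtopology bordification d = bord_topology b"
    using vis by (auto simp: visual_metric_def)
  interpret Metric_space bordification d by (rule ms)
  obtain \<Lambda> where \<Lambda>: "\<Lambda> > 0" "\<And>x y. x \<in> bordification \<Longrightarrow> y \<in> bordification \<Longrightarrow> d x y \<le> \<Lambda> * powr_neg a (ext_gromov_product b x y)"
    using vis unfolding visual_metric_def by blast
  have "\<exists>T\<subseteq>limit_set b G. card T = 3"
  proof (cases "finite (limit_set b G)")
    case True
    then have "3 \<le> card (limit_set b G)" using ne by (simp add: non_elementary_def)
    then show ?thesis by (metis obtain_subset_with_card_n)
  next
    case False
    then show ?thesis by (metis infinite_arbitrarily_large)
  qed
  then obtain z1 z2 z3 where z: "z1 \<in> limit_set b G" "z2 \<in> limit_set b G" "z3 \<in> limit_set b G"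
    and ne: "z1 \<noteq> z2" "z1 \<noteq> z3" "z2 \<noteq> z3"
    by (auto simp: card_3_iff)
  have bord: "z \<in> bordification" if "z \<in> limit_set b G" for z
    using that by (auto simp: limit_set_def bordification_def)
  define r where "r = min (d z1 z2) (min (d z1 z3) (d z2 z3)) / 3"
  have r: "r > 0" using ne z bord by (simp add: r_def mdist_pos_less)
  have r3: "3 * r \<le> d z1 z2" "3 * r \<le> d z1 z3" "3 * r \<le> d z2 z3" by (auto simp: r_def)
  have near: "\<exists>g\<in>G. len g \<ge> M \<and> d z (Inl (g b)) < r" if z: "z \<in> limit_set b G" for z M
  proof -
    let ?S = "(\<lambda>g. Inl (g b)) ` G"
    have "z \<in> mtopology derived_set_of ?S" using z by (simp add: limit_set_def top)
    then have "infinite (?S \<inter> mball z r)" using r unfolding derived_set_of_infinite_mball by blast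
    moreover have "finite ((\<lambda>g. Inl (g b)) ` {g \<in> G. len g \<le> M})" by (rule finite_imageI[OF finite_short])
    ultimately have "\<not> ?S \<inter> mball z r \<subseteq> (\<lambda>g. Inl (g b)) ` {g \<in> G. len g \<le> M}"
      using finite_subset by blast
    then obtain g where "g \<in> G" "Inl (g b) \<in> mball z r" "\<not> len g \<le> M" by blast
    then show ?thesis by (intro bexI[of _ g]) (auto simp: in_mball)
  qed
  define R where "R = - log a (r / \<Lambda>)"
  have apart: "gp x y \<le> R" if "d z (Inl x) < r" "d z' (Inl y) < r" "3 * r \<le> d z z'" "z \<in> limit_set b G" "z' \<in> limit_set b G" for x y z z'
  proof -
    have mem: "Inl x \<in> bordification" "Inl y \<in> bordification" by (auto simp: bordification_def)
    have "d z z' \<le> d z (Inl x) + d (Inl x) (Inl y) + d (Inl y) z'"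
      using triangle[of z "Inl x" "Inl y"] triangle[of z "Inl y" z'] mem bord that by fastforce
    then have "r \<le> d (Inl x) (Inl y)" using that(1-3) by (simp add: commute)
    also have "\<dots> \<le> \<Lambda> * powr_neg a (ext_gromov_product b (Inl x) (Inl y))" using \<Lambda>(2) mem by blast
    also have "\<dots> \<le> \<Lambda> * a powr (- gp x y)"
      using powr_neg_le[OF a ext_gromov_product_Inl] \<Lambda>(1) by (intro mult_left_mono) auto
    finally have "r / \<Lambda> \<le> a powr (- gp x y)" using \<Lambda>(1) by (simp add: field_simps)
    then have "log a (r / \<Lambda>) \<le> log a (a powr (- gp x y))" using r \<Lambda>(1) a by (subst log_le_cancel_iff) auto
    then show ?thesis using a by (simp add: R_def log_powr_cancel)
  qed
  show ?thesis
    unfolding three_directions_def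
  proof (intro exI[of _ R] allI)
    fix M
    obtain g1 g2 g3 where g: "g1 \<in> G" "g2 \<in> G" "g3 \<in> G" "len g1 \<ge> M" "len g2 \<ge> M" "len g3 \<ge> M"
      "d z1 (Inl (g1 b)) < r" "d z2 (Inl (g2 b)) < r" "d z3 (Inl (g3 b)) < r"
      using near[OF z(1), of M] near[OF z(2), of M] near[OF z(3), of M] by blast
    then have "gp (g1 b) (g2 b) \<le> R" "gp (g1 b) (g3 b) \<le> R" "gp (g2 b) (g3 b) \<le> R"
      using apart r3 z by blast+
    with g show "\<exists>g1\<in>G. \<exists>g2\<in>G. \<exists>g3\<in>G. len g1 \<ge> M \<and> len g2 \<ge> M \<and> len g3 \<ge> M \<and>
     gp (g1 b) (g2 b) \<le> R \<and> gp (g1 b) (g3 b) \<le> R \<and> gp (g2 b) (g3 b) \<le> R" by blast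
  qed
qed

end

section \<open>The step law\<close>

lemma nn_integral_nat_pmf_le:
  fixes p :: "nat pmf" and F :: "nat \<Rightarrow> ennreal"
  assumes "F 0 \<le> ennreal A" "0 \<le> A" "0 \<le> B"
    and tail: "\<And>k. F (Suc k) * ennreal (pmf p (Suc k)) \<le> ennreal (B * (1 / 2) ^ Suc k)"
  shows "(\<integral>\<^sup>+ k. F k \<partial>measure_pmf p) \<le> ennreal (A + B)"
proof -
  have "(\<integral>\<^sup>+ k. F k \<partial>measure_pmf p) = (\<Sum>k. ennreal (pmf p k) * F k)"
    by (simp add: nn_integral_measure_pmf nn_integral_count_space_nat)
  also have "\<dots> = (\<Sum>k. ennreal (pmf p (Suc k)) * F (Suc k)) + ennreal (pmf p 0) * F 0"
    using suminf_offset[of "\<lambda>k. ennreal (pmf p k) * F k" 1] by (simp add: add.commute)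
  also have "\<dots> \<le> (\<Sum>k. ennreal (B * (1 / 2) ^ Suc k)) + 1 * ennreal A"
    using assms tail
    by (intro add_mono suminf_le mult_mono) (auto simp: mult.commute ennreal_le_1 pmf_le_1)
  also have "(\<Sum>k. ennreal (B * (1 / 2) ^ Suc k)) = ennreal B"
  proof -
    have "(\<lambda>k. B * (1 / 2) ^ Suc k) sums (B * 1)"
      by (intro sums_mult power_half_series)
    then show ?thesis
      using \<open>0 \<le> B\<close> by (subst suminf_ennreal2) (auto simp: sums_iff)
  qed
  finally show ?thesis using assms by (simp add: ennreal_plus add.commute)
qed

lemma exists_pmf_nat:
  fixes v :: "nat \<Rightarrow> real"
  assumes "\<And>k. 0 < v k" "\<And>k. v k \<le> \<epsilon> * (1 / 2) ^ Suc k" "\<epsilon> < 1"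
  shows "\<exists>p :: nat pmf. pmf p 0 \<ge> 1 - \<epsilon> \<and> (\<forall>k. pmf p (Suc k) = v k)"
proof -
  have half: "(\<lambda>k. \<epsilon> * (1 / 2) ^ Suc k) sums (\<epsilon> * 1)"
    by (intro sums_mult power_half_series)
  have v: "summable v"
    using assms half by (intro summable_comparison_test[of v "\<lambda>k. \<epsilon> * (1 / 2) ^ Suc k"])
      (auto simp: sums_iff abs_of_pos simp del: power_Suc)
  have le: "suminf v \<le> \<epsilon>"
    using suminf_le[OF assms(2) v] half by (auto simp: sums_iff)
  define w where "w k = (case k of 0 \<Rightarrow> 1 - suminf v | Suc j \<Rightarrow> v j)" for k
  have w0: "w k \<ge> 0" for k
    using le assms less_imp_le[OF assms(1)] by (auto simp: w_def split: nat.split)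
  have "(\<lambda>k. w (Suc k)) sums suminf v" using v by (simp add: w_def summable_sums)
  then have "w sums (suminf v + w 0)" by (rule sums_Suc)
  then have "w sums 1" by (simp add: w_def)
  then have "(\<integral>\<^sup>+ x. ennreal (w x) \<partial>count_space UNIV) = 1"
    using w0 by (simp add: nn_integral_count_space_nat suminf_ennreal2 sums_iff)
  then have "pmf (embed_pmf w) k = w k" for k using w0 by (intro pmf_embed_pmf) auto
  then show ?thesis using le by (intro exI[of _ "embed_pmf w"]) (auto simp: w_def)
qed

lemma sum_four_le:
  fixes x1 x2 x3 x4 p q :: real
  assumes "p \<le> q" "x1 \<le> q" "x2 \<le> q" "x3 \<le> q" "x4 \<le> q"
    and "x1 \<le> p \<or> x2 \<le> p" "x1 \<le> p \<or> x3 \<le> p" "x1 \<le> p \<or> x4 \<le> p" "x2 \<le> p \<or> x3 \<le> p"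
    "x2 \<le> p \<or> x4 \<le> p" "x3 \<le> p \<or> x4 \<le> p"
  shows "x1 + x2 + x3 + x4 \<le> 3 * p + q"
  using assms by linarith

context hyperbolic_action
begin

text \<open>By hyperbolicity \<open>y\<close> can have a Gromov product above \<open>C + \<delta>\<close> with at most one of the four points.
For that one the distance to \<open>y\<close> decreases by at most \<open>L\<close>, a factor \<open>e\<^sup>1\<^sup>/\<^sup>2 \<le> 7/4\<close>; for the other three
it increases by at least \<open>9/10 L\<close>, a factor of at most \<open>65/100\<close>.\<close>
lemma schottky_average:
  assumes t: "t = 1 / (2 * L)" and L: "L > 0" "L \<ge> 10 * (D + 2 * C + 2 * \<delta>)"
    and len: "\<And>i. i \<in> {1,2,3,4::nat} \<Longrightarrow> L - D \<le> dist b (P i) \<and> dist b (P i) \<le> L"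
    and gp: "gp (P 1) (P 2) \<le> C" "gp (P 1) (P 3) \<le> C" "gp (P 1) (P 4) \<le> C"
      "gp (P 2) (P 3) \<le> C" "gp (P 2) (P 4) \<le> C" "gp (P 3) (P 4) \<le> C"
  shows "(exp (- t * dist y (P 1)) + exp (- t * dist y (P 2)) + exp (- t * dist y (P 3)) + exp (- t * dist y (P 4))) / 4
    \<le> 93 / 100 * exp (- t * dist y b)"
proof -
  define E where "E = exp (- t * dist y b)"
  have E: "E > 0" by (simp add: E_def)
  have t0: "t > 0" using t L by simp
  have tL: "t * L = 1 / 2" using t L by simp
  have d: "dist y (P i) = dist y b + (dist b (P i) - 2 * gp y (P i))" for i
    using dist_gromov_product[of y "P i" b] by (simp add: dist_commute)
  have up: "exp (- t * dist y (P i)) \<le> 7 / 4 * E" if "i \<in> {1,2,3,4}" for i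
  proof -
    have "dist y (P i) \<ge> dist y b - L"
      using len[OF that] dist_triangle[of y b "P i"] by (simp add: dist_commute)
    then have "t * dist y (P i) \<ge> t * (dist y b - L)" using t0 by (intro mult_left_mono) auto
    then have "- t * dist y (P i) \<le> - t * dist y b + 1/2" by (simp add: right_diff_distrib tL)
    then have "exp (- t * dist y (P i)) \<le> E * exp (1/2)" by (simp add: E_def flip: exp_add)
    also have "\<dots> \<le> E * (7 / 4)"
      using exp_bound[of "1/2"] E by (intro mult_left_mono) (auto simp: power2_eq_square)
    finally show ?thesis by simp
  qed
  have good: "exp (- t * dist y (P i)) \<le> 65 / 100 * E" if "i \<in> {1,2,3,4}" "gp y (P i) \<le> C + \<delta>" for i
  proof -
    have "dist y (P i) \<ge> dist y b + 9 / 10 * L"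
      using len[OF that(1)] that(2) L d[of i] by (simp add: algebra_simps)
    then have "t * dist y (P i) \<ge> t * (dist y b + 9 / 10 * L)" using t0 by (intro mult_left_mono) auto
    then have "- t * dist y (P i) \<le> - t * dist y b - 9 / 20" using tL by (simp add: distrib_left)
    then have "exp (- t * dist y (P i)) \<le> E * exp (- (9/20))" by (simp add: E_def flip: exp_add)
    also have "\<dots> \<le> E * (65 / 100)"
    proof (rule mult_left_mono)
      have "exp (9/20::real) \<ge> 100 / 65"
        using exp_lower_Taylor_quadratic[of "9/20::real"] by (simp add: power2_eq_square)
      then show "exp (- (9/20::real)) \<le> 65 / 100" by (simp add: exp_minus field_simps)
    qed (use E in auto)
    finally show ?thesis by simp
  qed
  have or: "exp (- t * dist y (P i)) \<le> 65 / 100 * E \<or> exp (- t * dist y (P j)) \<le> 65 / 100 * E"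
    if "i \<in> {1,2,3,4}" "j \<in> {1,2,3,4}" "gp (P i) (P j) \<le> C" for i j
  proof -
    have "gp y (P i) \<le> C + \<delta> \<or> gp y (P j) \<le> C + \<delta>"
      using hyp[of b "P i" y "P j"] that(3) by (auto simp: min_def gromov_product_commute split: if_splits)
    then show ?thesis using good that by blast
  qed
  have "exp (- t * dist y (P 1)) + exp (- t * dist y (P 2)) + exp (- t * dist y (P 3)) + exp (- t * dist y (P 4))
      \<le> 3 * (65 / 100 * E) + 7 / 4 * E"
    using E up or gp by (intro sum_four_le) auto
  moreover have "S / 4 \<le> 93 / 100 * E" if "S \<le> 3 * (65 / 100 * E) + 7 / 4 * E" for S
    using that E by (simp add: field_simps)
  ultimately show ?thesis unfolding E_def by blast
qed

text \<open>The three integral bounds are a uniform contraction, an exponential moment, and a bound of order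
\<open>1/2\<close> on the inverse weights, which plays the role of a bound on the entropy. The constants \<open>19/20\<close>,
\<open>2\<close> and \<open>4\<close> do not depend on \<open>c0\<close>, so the speed can be increased without increasing the randomness.\<close>
theorem exists_step_law:
  assumes three_directions
  shows "\<exists>\<mu> t c. set_pmf \<mu> = G \<and> (\<forall>g\<in>G. pmf \<mu> (iso_inv g) = pmf \<mu> g) \<and>
    0 < t \<and> c0 \<le> c \<and> t * c = 1 / 50 \<and>
    (\<forall>y. (\<integral>\<^sup>+ h. ennreal (exp (- t * dist y (h b))) \<partial>measure_pmf \<mu>) \<le> ennreal (19 / 20 * exp (- t * dist y b))) \<and>
    (\<integral>\<^sup>+ h. ennreal (exp (t * len h)) \<partial>measure_pmf \<mu>) \<le> 2 \<and>
    (\<integral>\<^sup>+ h. ennreal (1 / sqrt (pmf \<mu> h)) \<partial>measure_pmf \<mu>) \<le> 4"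
proof -
  obtain C D where CD: "\<And>L. \<exists>s\<in>G. \<exists>s'\<in>G. len s \<ge> L \<and> len s' \<ge> L \<and> \<bar>len s' - len s\<bar> \<le> D \<and>
    gp (s b) (iso_inv s b) \<le> C \<and> gp (s' b) (iso_inv s' b) \<le> C \<and>
    gp (s b) (s' b) \<le> C \<and> gp (s b) (iso_inv s' b) \<le> C \<and>
    gp (iso_inv s b) (s' b) \<le> C \<and> gp (iso_inv s b) (iso_inv s' b) \<le> C"
    using schottky_pair[OF assms] by blast
  define L0 where "L0 = max 1 (max (10 * (D + 2 * C + 2 * \<delta>)) (25 * c0))"
  obtain s s' where s: "s \<in> G" "s' \<in> G" "len s \<ge> L0" "len s' \<ge> L0" "\<bar>len s' - len s\<bar> \<le> D"
    and gps: "gp (s b) (iso_inv s b) \<le> C" "gp (s' b) (iso_inv s' b) \<le> C"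
    "gp (s b) (s' b) \<le> C" "gp (s b) (iso_inv s' b) \<le> C"
    "gp (iso_inv s b) (s' b) \<le> C" "gp (iso_inv s b) (iso_inv s' b) \<le> C"
    using CD[of L0] by blast
  define L where "L = max (len s) (len s')"
  have L: "L \<ge> 1" "L \<ge> 10 * (D + 2 * C + 2 * \<delta>)" "L \<ge> 25 * c0" using s unfolding L_def L0_def by auto
  define t where "t = 1 / (2 * L)"
  have t: "t > 0" "t \<le> 1" using L by (auto simp: t_def)
  have tL: "t * L = 1 / 2" using L by (simp add: t_def)
  define e where "e = from_nat_into G"
  have G0: "G \<noteq> {}" using G_id by blast
  have eG: "e k \<in> G" for k by (simp add: e_def from_nat_into[OF G0])
  have range_e: "range e = G" by (simp add: e_def range_from_nat_into[OF G0 countable_G])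
  \<comment> \<open>The factor \<open>e\<^sup>-\<^sup>|\<^sup>g\<^sup>|\<close> absorbs exponential moments of order at most one, and the square roots
    of \<open>4\<^sup>-\<^sup>k\<close> are still summable.\<close>
  define v where "v k = 1 / 100 * (1 / 4) ^ Suc k * exp (- len (e k))" for k
  have v0: "v k > 0" for k by (simp add: v_def)
  have v_le: "v k \<le> 1 / 100 * (1 / 2) ^ Suc k" for k
  proof -
    have "v k \<le> 1 / 100 * (1 / 4) ^ Suc k * 1"
      unfolding v_def by (intro mult_left_mono) auto
    also have "\<dots> \<le> 1 / 100 * (1 / 2) ^ Suc k"
      unfolding mult_1_right by (intro mult_left_mono power_mono) auto
    finally show ?thesis .
  qed
  obtain \<kappa> :: "nat pmf" where k0: "pmf \<kappa> 0 \<ge> 99 / 100" and kS: "\<And>k. pmf \<kappa> (Suc k) = v k"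
    using exists_pmf_nat[of v "1 / 100", OF v0 v_le] by auto
  have kpos: "pmf \<kappa> k > 0" for k using k0 kS v0 by (cases k) auto
  define Q where "Q = pair_pmf \<kappa> (pmf_of_set (UNIV :: (bool \<times> bool) set))"
  define sgn where "sgn y g = (if y then g else iso_inv g)" for y and g :: "'a \<Rightarrow> 'a"
  \<comment> \<open>Index \<open>0\<close> stands for the Schottky pair and \<open>Suc j\<close> for the \<open>j\<close>-th element of the group; a fair
    coin chooses between an element and its inverse, which makes the law symmetric.\<close>
  define \<Phi> where "\<Phi> = (\<lambda>(k, x, y). sgn y (case k of 0 \<Rightarrow> if x then s else s' | Suc j \<Rightarrow> e j))"
  define \<mu> where "\<mu> = map_pmf \<Phi> Q"
  have sgnG: "g \<in> G \<Longrightarrow> sgn y g \<in> G" for y g by (simp add: sgn_def G_inv)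
  have sgn_len: "g \<in> G \<Longrightarrow> len (sgn y g) = len g" for y g by (simp add: sgn_def len_inv)
  have \<Phi>G: "\<Phi> i \<in> G" for i
    using s eG by (auto simp: \<Phi>_def intro!: sgnG split: prod.split nat.split)
  have set_Q: "set_pmf Q = UNIV"
    using kpos by (auto simp: Q_def set_pmf_iff less_le)
  have set_\<mu>: "set_pmf \<mu> = G"
  proof
    show "set_pmf \<mu> \<subseteq> G" using \<Phi>G by (auto simp: \<mu>_def)
    show "G \<subseteq> set_pmf \<mu>"
    proof
      fix g assume "g \<in> G"
      then obtain k where "g = e k" using range_e by blast
      then have "g = \<Phi> (Suc k, True, True)" by (simp add: \<Phi>_def sgn_def)
      then show "g \<in> set_pmf \<mu>" by (auto simp: \<mu>_def set_Q)
    qed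
  qed
  have sym: "pmf \<mu> (iso_inv g) = pmf \<mu> g" if "g \<in> G" for g
  proof -
    define \<tau> :: "nat \<times> bool \<times> bool \<Rightarrow> nat \<times> bool \<times> bool" where "\<tau> = apsnd (apsnd Not)"
    have "map_pmf (apsnd Not :: bool \<times> bool \<Rightarrow> bool \<times> bool) (pmf_of_set UNIV) = pmf_of_set UNIV"
      by (intro map_pmf_of_set_bij_betw) (auto simp: bij_betw_def inj_on_def surj_def)
    then have "map_pmf \<tau> Q = Q"
      unfolding \<tau>_def Q_def by (simp flip: pair_map_pmf2)
    moreover have "iso_inv (\<Phi> i) = \<Phi> (\<tau> i)" for i
    proof -
      have "iso_inv (sgn y g) = sgn (\<not> y) g" if "g \<in> G" for y g
        using isom.inv_inv[OF G_carrier[OF that]] by (simp add: sgn_def)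
      then show ?thesis
        using s eG by (cases i) (auto simp: \<Phi>_def \<tau>_def split: nat.split)
    qed
    ultimately have "map_pmf iso_inv \<mu> = \<mu>"
      unfolding \<mu>_def pmf.map_comp comp_def by (metis (mono_tags, lifting) comp_def map_pmf_compose map_pmf_cong pmf.map_comp)
    moreover have "inj_on iso_inv (set_pmf \<mu>)"
      unfolding set_\<mu> using isom.inv_inv G_carrier by (metis inj_onI)
    ultimately show ?thesis using pmf_map_inj[of iso_inv \<mu> g] that set_\<mu> by simp
  qed
  have E: "(\<integral>\<^sup>+ h. f h \<partial>measure_pmf \<mu>) = (\<integral>\<^sup>+ k.
      (f (\<Phi> (k, True, True)) + f (\<Phi> (k, True, False)) + f (\<Phi> (k, False, True)) + f (\<Phi> (k, False, False))) / 4 \<partial>measure_pmf \<kappa>)"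
    for f :: "('a \<Rightarrow> 'a) \<Rightarrow> ennreal"
  proof -
    have U: "(UNIV :: (bool \<times> bool) set) = {(True, True), (True, False), (False, True), (False, False)}"
      by auto
    show ?thesis
      unfolding \<mu>_def Q_def
      by (simp add: nn_integral_pair_pmf' nn_integral_pmf_of_set U add.assoc)
  qed
  have avg_le: "(ennreal x1 + ennreal x2 + ennreal x3 + ennreal x4) / 4 \<le> ennreal A"
    if "(x1 + x2 + x3 + x4) / 4 \<le> A" "x1 \<ge> 0" "x2 \<ge> 0" "x3 \<ge> 0" "x4 \<ge> 0" for x1 x2 x3 x4 A :: real
  proof -
    have "(ennreal x1 + ennreal x2 + ennreal x3 + ennreal x4) / 4 = ennreal (x1 + x2 + x3 + x4) / ennreal 4"
      using that by (simp add: ennreal_plus)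
    also have "\<dots> = ennreal ((x1 + x2 + x3 + x4) / 4)"
      using that by (intro divide_ennreal) auto
    finally show ?thesis using that(1) by (simp add: ennreal_leI)
  qed
  have \<Phi>0: "\<Phi> (0, True, True) = s" "\<Phi> (0, True, False) = iso_inv s" "\<Phi> (0, False, True) = s'" "\<Phi> (0, False, False) = iso_inv s'"
    by (simp_all add: \<Phi>_def sgn_def)
  have \<Phi>S: "len (\<Phi> (Suc k, x, y)) = len (e k)" for k x y
    using eG by (simp add: \<Phi>_def sgn_len)
  have expS: "exp (len (e k)) * v k \<le> 1 / 100 * (1 / 2) ^ Suc k" for k
  proof -
    have "exp (len (e k)) * v k = 1 / 100 * (1 / 4) ^ Suc k" by (simp add: v_def exp_minus)
    also have "\<dots> \<le> 1 / 100 * (1 / 2) ^ Suc k" by (intro mult_left_mono power_mono) auto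
    finally show ?thesis .
  qed
  have main: "(\<integral>\<^sup>+ h. ennreal (exp (- t * dist y (h b))) \<partial>measure_pmf \<mu>) \<le> ennreal (19 / 20 * exp (- t * dist y b))" for y
  proof -
    define E0 where "E0 = exp (- t * dist y b)"
    have E0: "E0 > 0" by (simp add: E0_def)
    let ?F = "\<lambda>k. (ennreal (exp (- t * dist y (\<Phi> (k, True, True) b))) + ennreal (exp (- t * dist y (\<Phi> (k, True, False) b)))
      + ennreal (exp (- t * dist y (\<Phi> (k, False, True) b))) + ennreal (exp (- t * dist y (\<Phi> (k, False, False) b)))) / 4"
    have "(\<integral>\<^sup>+ k. ?F k \<partial>measure_pmf \<kappa>) \<le> ennreal (93 / 100 * E0 + 1 / 100 * E0)"
    proof (rule nn_integral_nat_pmf_le)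
      define P where "P i = (if i = 1 then s b else if i = 2 then iso_inv s b else if i = 3 then s' b else iso_inv s' b)" for i :: nat
      have P: "L - D \<le> dist b (P i) \<and> dist b (P i) \<le> L" for i
        using s by (auto simp: P_def L_def len_inv)
      have "(exp (- t * dist y (P 1)) + exp (- t * dist y (P 2)) + exp (- t * dist y (P 3)) + exp (- t * dist y (P 4))) / 4 \<le> 93 / 100 * E0"
        unfolding E0_def
      proof (rule schottky_average[OF t_def _ L(2)])
        show "gp (P 1) (P 2) \<le> C" "gp (P 1) (P 3) \<le> C" "gp (P 1) (P 4) \<le> C"
          "gp (P 2) (P 3) \<le> C" "gp (P 2) (P 4) \<le> C" "gp (P 3) (P 4) \<le> C"
          using gps by (simp_all add: P_def)
      qed (use L P in auto)
      then show "?F 0 \<le> ennreal (93 / 100 * E0)"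
        unfolding \<Phi>0 by (intro avg_le) (auto simp: P_def)
      fix k
      have bound: "exp (- t * dist y (\<Phi> (Suc k, x, z) b)) \<le> E0 * exp (len (e k))" for x z
      proof -
        have "dist y (\<Phi> (Suc k, x, z) b) \<ge> dist y b - len (e k)"
          using \<Phi>S[of k x z] dist_triangle[of y b "\<Phi> (Suc k, x, z) b"] by (simp add: dist_commute)
        then have "t * dist y (\<Phi> (Suc k, x, z) b) \<ge> t * (dist y b - len (e k))" using t by (intro mult_left_mono) auto
        moreover have "t * len (e k) \<le> 1 * len (e k)" using t by (intro mult_right_mono) auto
        ultimately have "- t * dist y (\<Phi> (Suc k, x, z) b) \<le> - t * dist y b + len (e k)"
          by (simp add: right_diff_distrib)
        then show ?thesis by (simp add: E0_def flip: exp_add)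
      qed
      have "?F (Suc k) \<le> ennreal (E0 * exp (len (e k)))"
        using bound[of True True] bound[of True False] bound[of False True] bound[of False False]
        by (intro avg_le) auto
      then have "?F (Suc k) * ennreal (pmf \<kappa> (Suc k)) \<le> ennreal (E0 * exp (len (e k))) * ennreal (v k)"
        unfolding kS by (intro mult_mono) auto
      also have "\<dots> = ennreal (E0 * (exp (len (e k)) * v k))"
        using E0 v0[of k] by (simp add: ennreal_mult mult.assoc)
      also have "\<dots> \<le> ennreal (1 / 100 * E0 * (1 / 2) ^ Suc k)"
        using mult_left_mono[OF expS[of k], of E0] E0 by (intro ennreal_leI) (simp add: mult.commute mult.left_commute)
      finally show "?F (Suc k) * ennreal (pmf \<kappa> (Suc k)) \<le> ennreal (1 / 100 * E0 * (1 / 2) ^ Suc k)" .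
    qed (use E0 in auto)
    also have "\<dots> \<le> ennreal (19 / 20 * E0)" using E0 by (intro ennreal_leI) simp
    finally show ?thesis unfolding E E0_def .
  qed
  have moment: "(\<integral>\<^sup>+ h. ennreal (exp (t * len h)) \<partial>measure_pmf \<mu>) \<le> 2"
  proof -
    let ?F = "\<lambda>k. (ennreal (exp (t * len (\<Phi> (k, True, True)))) + ennreal (exp (t * len (\<Phi> (k, True, False))))
      + ennreal (exp (t * len (\<Phi> (k, False, True)))) + ennreal (exp (t * len (\<Phi> (k, False, False))))) / 4"
    have "(\<integral>\<^sup>+ k. ?F k \<partial>measure_pmf \<kappa>) \<le> ennreal (7 / 4 + 1 / 100)"
    proof (rule nn_integral_nat_pmf_le)
      have le: "exp (t * len g) \<le> 7 / 4" if "len g \<le> L" for g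
      proof -
        have "t * len g \<le> 1 / 2" using mult_left_mono[OF that, of t] t tL by simp
        then have "exp (t * len g) \<le> exp (1/2)" by simp
        also have "\<dots> \<le> 7 / 4" using exp_bound[of "1/2"] by (simp add: power2_eq_square)
        finally show ?thesis .
      qed
      have "exp (t * len s) \<le> 7 / 4" "exp (t * len s') \<le> 7 / 4" by (rule le, simp add: L_def)+
      then show "?F 0 \<le> ennreal (7 / 4)"
        unfolding \<Phi>0 using s by (intro avg_le) (auto simp: len_inv)
      fix k
      have "exp (t * len (e k)) \<le> exp (len (e k))"
        using t by (simp add: mult_left_le_one_le)
      then have "?F (Suc k) \<le> ennreal (exp (len (e k)))"
        unfolding \<Phi>S by (intro avg_le) auto
      then have "?F (Suc k) * ennreal (pmf \<kappa> (Suc k)) \<le> ennreal (exp (len (e k))) * ennreal (v k)"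
        unfolding kS by (intro mult_mono) auto
      also have "\<dots> = ennreal (exp (len (e k)) * v k)"
        using v0[of k] by (simp add: ennreal_mult)
      also have "\<dots> \<le> ennreal (1 / 100 * (1 / 2) ^ Suc k)"
        by (intro ennreal_leI expS)
      finally show "?F (Suc k) * ennreal (pmf \<kappa> (Suc k)) \<le> ennreal (1 / 100 * (1 / 2) ^ Suc k)" .
    qed auto
    also have "\<dots> \<le> ennreal 2" by (intro ennreal_leI) simp
    finally show ?thesis unfolding E by simp
  qed
  have entropy: "(\<integral>\<^sup>+ h. ennreal (1 / sqrt (pmf \<mu> h)) \<partial>measure_pmf \<mu>) \<le> 4"
  proof -
    let ?F = "\<lambda>k. (ennreal (1 / sqrt (pmf \<mu> (\<Phi> (k, True, True)))) + ennreal (1 / sqrt (pmf \<mu> (\<Phi> (k, True, False))))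
      + ennreal (1 / sqrt (pmf \<mu> (\<Phi> (k, False, True)))) + ennreal (1 / sqrt (pmf \<mu> (\<Phi> (k, False, False))))) / 4"
    \<comment> \<open>Several indices may name the same element, which only increases its weight.\<close>
    have ge: "1 / sqrt (pmf \<mu> (\<Phi> (k, x, y))) \<le> 2 / sqrt (pmf \<kappa> k)" for k x y
    proof -
      have "pmf \<kappa> k / 4 = pmf Q (k, x, y)" by (simp add: Q_def pmf_pair)
      also have "\<dots> = measure (measure_pmf Q) {(k, x, y)}" by (simp add: pmf.rep_eq)
      also have "\<dots> \<le> measure (measure_pmf Q) (\<Phi> -` {\<Phi> (k, x, y)})"
        by (intro measure_pmf.finite_measure_mono) auto
      also have "\<dots> = pmf \<mu> (\<Phi> (k, x, y))" by (simp add: \<mu>_def pmf_map)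
      finally have "sqrt (pmf \<kappa> k / 4) \<le> sqrt (pmf \<mu> (\<Phi> (k, x, y)))" by simp
      then have le: "sqrt (pmf \<kappa> k) / 2 \<le> sqrt (pmf \<mu> (\<Phi> (k, x, y)))" by (simp add: real_sqrt_divide)
      have "1 / sqrt (pmf \<mu> (\<Phi> (k, x, y))) \<le> 1 / (sqrt (pmf \<kappa> k) / 2)"
        using le kpos[of k] by (intro frac_le) auto
      then show ?thesis by simp
    qed
    have F: "?F k \<le> ennreal (2 / sqrt (pmf \<kappa> k))" for k
      using ge[of k True True] ge[of k True False] ge[of k False True] ge[of k False False]
      by (intro avg_le) auto
    have "(\<integral>\<^sup>+ k. ?F k \<partial>measure_pmf \<kappa>) \<le> ennreal (3 + 1)"
    proof (rule nn_integral_nat_pmf_le)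
      have "sqrt (pmf \<kappa> 0) \<ge> sqrt ((2/3)^2)" using k0 by (intro real_sqrt_le_mono) (simp add: power2_eq_square)
      then have "sqrt (pmf \<kappa> 0) \<ge> 2 / 3" by simp
      then have "2 / sqrt (pmf \<kappa> 0) \<le> 3" using kpos[of 0] by (simp add: field_simps)
      then show "?F 0 \<le> ennreal 3" using F[of 0] ennreal_leI order_trans by blast
      fix k
      have "?F (Suc k) * ennreal (pmf \<kappa> (Suc k)) \<le> ennreal (2 / sqrt (v k)) * ennreal (v k)"
        using F[of "Suc k"] unfolding kS by (intro mult_mono) auto
      also have "\<dots> = ennreal (2 / sqrt (v k) * v k)"
        using v0[of k] by (intro ennreal_mult[symmetric]) auto
      also have "2 / sqrt (v k) * v k = 2 * (v k / sqrt (v k))" by simp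
      also have "v k / sqrt (v k) = sqrt (v k)" using v0[of k] by (intro real_div_sqrt) simp
      also have "ennreal (2 * sqrt (v k)) \<le> ennreal (1 * (1 / 2) ^ Suc k)"
      proof (rule ennreal_leI)
        have "v k \<le> 1 / 100 * (1 / 4) ^ Suc k * 1"
          unfolding v_def by (intro mult_left_mono) auto
        also have "(1 / 4 :: real) ^ Suc k = ((1 / 2) ^ Suc k)\<^sup>2"
          by (subst power_mult[symmetric], subst mult.commute, subst power_mult) (simp add: power2_eq_square)
        also have "1 / 100 * ((1 / 2) ^ Suc k)\<^sup>2 * 1 \<le> 1 / 4 * ((1 / 2 :: real) ^ Suc k)\<^sup>2"
          unfolding mult_1_right by (intro mult_right_mono) auto
        also have "\<dots> = (1 / 2 * (1 / 2) ^ Suc k)\<^sup>2"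
          unfolding power_mult_distrib by (simp add: power2_eq_square)
        finally have "sqrt (v k) \<le> 1 / 2 * (1 / 2) ^ Suc k"
          by (intro real_le_lsqrt) auto
        then show "2 * sqrt (v k) \<le> 1 * (1 / 2) ^ Suc k" by simp
      qed
      finally show "?F (Suc k) * ennreal (pmf \<kappa> (Suc k)) \<le> ennreal (1 * (1 / 2) ^ Suc k)" .
    qed auto
    then show ?thesis unfolding E by simp
  qed
  have "t * (L / 25) = t * L / 25" by simp
  then have "t * (L / 25) = 1 / 50" unfolding tL by simp
  moreover have "c0 \<le> L / 25" using L by simp
  ultimately show ?thesis using set_\<mu> sym t(1) main moment entropy by blast
qed

end

section \<open>Exponential estimates for the random walk\<close>

lemma ennreal_finiteE:
  fixes x :: ennreal
  assumes "x \<noteq> \<infinity>"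
  obtains B where "x = ennreal B" "B \<ge> 0"
  using assms by (cases x) auto

lemma sequence_space_pmf: "sequence_space (measure_pmf \<mu>)"
  by unfold_locales

lemma prob_space_walk_space: "prob_space (walk_space \<mu>)"
  unfolding walk_space_def by (intro prob_space_PiM prob_space_measure_pmf)

lemma space_walk_space [simp]: "space (walk_space \<mu>) = UNIV"
  by (simp add: walk_space_def space_PiM)

lemma measurable_walk_increment: "(\<lambda>h. h i) \<in> walk_space \<mu> \<rightarrow>\<^sub>M measure_pmf \<mu>"
  unfolding walk_space_def by (intro measurable_component_singleton) simp

lemma measurable_increment_function:
  assumes "\<And>g. f g \<in> space N"
  shows "(\<lambda>h. f (h i)) \<in> walk_space \<mu> \<rightarrow>\<^sub>M N"
  by (rule measurable_compose[OF measurable_walk_increment]) (use assms in auto)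

lemma nn_integral_increment:
  "(\<integral>\<^sup>+ h. f (h i) \<partial>walk_space \<mu>) = (\<integral>\<^sup>+ g. f g \<partial>measure_pmf \<mu>)"
proof -
  interpret sequence_space "measure_pmf \<mu>" by (rule sequence_space_pmf)
  have "measure_pmf \<mu> = distr (walk_space \<mu>) (measure_pmf \<mu>) (\<lambda>h. h i)"
    unfolding walk_space_def by (rule PiM_component[symmetric]) simp
  then have "(\<integral>\<^sup>+ g. f g \<partial>measure_pmf \<mu>) = (\<integral>\<^sup>+ g. f g \<partial>distr (walk_space \<mu>) (measure_pmf \<mu>) (\<lambda>h. h i))"
    by simp
  also have "\<dots> = (\<integral>\<^sup>+ h. f (h i) \<partial>walk_space \<mu>)"
    by (intro nn_integral_distr measurable_walk_increment) simp
  finally show ?thesis by simp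
qed

lemma measurable_case_nat_walk:
  "(\<lambda>(s, \<omega>). case_nat s \<omega>) \<in> measure_pmf \<mu> \<Otimes>\<^sub>M walk_space \<mu> \<rightarrow>\<^sub>M walk_space \<mu>"
  unfolding walk_space_def by measurable

text \<open>Conditioning on the first increment rather than on the last one fits estimates that are uniform in
the point from which the walk is seen.\<close>
lemma nn_integral_first_step:
  assumes "F \<in> borel_measurable (walk_space \<mu>)"
  shows "(\<integral>\<^sup>+ h. F h \<partial>walk_space \<mu>) = (\<integral>\<^sup>+ s. \<integral>\<^sup>+ \<omega>. F (case_nat s \<omega>) \<partial>walk_space \<mu> \<partial>measure_pmf \<mu>)"
proof -
  interpret W: prob_space "walk_space \<mu>" by (rule prob_space_walk_space)
  interpret sequence_space "measure_pmf \<mu>" by (rule sequence_space_pmf)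
  let ?c = "\<lambda>(s, \<omega>). case_nat s \<omega>"
  have "(\<integral>\<^sup>+ h. F h \<partial>walk_space \<mu>) = (\<integral>\<^sup>+ h. F h \<partial>distr (measure_pmf \<mu> \<Otimes>\<^sub>M walk_space \<mu>) (walk_space \<mu>) ?c)"
    using PiM_iter unfolding walk_space_def by simp
  also have "\<dots> = (\<integral>\<^sup>+ x. F (?c x) \<partial>(measure_pmf \<mu> \<Otimes>\<^sub>M walk_space \<mu>))"
    by (rule nn_integral_distr[OF measurable_case_nat_walk]) (simp add: assms)
  also have "\<dots> = (\<integral>\<^sup>+ s. \<integral>\<^sup>+ \<omega>. F (?c (s, \<omega>)) \<partial>walk_space \<mu> \<partial>measure_pmf \<mu>)"
    by (intro W.nn_integral_fst[symmetric] measurable_compose[OF measurable_case_nat_walk assms])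
  finally show ?thesis by simp
qed

lemma random_walk_add: "random_walk h (n + k) = random_walk h n \<circ> random_walk (\<lambda>i. h (n + i)) k"
  by (induction k) (simp_all add: comp_assoc)

lemma random_walk_cong: "(\<And>i. i < n \<Longrightarrow> h i = h' i) \<Longrightarrow> random_walk h n = random_walk h' n"
  by (induction n) auto

text \<open>The Markov property at a fixed time: a prescribed initial segment and an event that concerns the
increments after it are independent.\<close>
lemma emeasure_cylinder_tail:
  assumes T: "T \<in> sets (walk_space \<mu>)"
  shows "emeasure (walk_space \<mu>) {h'. (\<forall>i<n. h' i = h i) \<and> (\<lambda>i. h' (n + i)) \<in> T}
    = ennreal (\<Prod>i<n. pmf \<mu> (h i)) * emeasure (walk_space \<mu>) T"
    and "{h'. (\<forall>i<n. h' i = h i) \<and> (\<lambda>i. h' (n + i)) \<in> T} \<in> sets (walk_space \<mu>)"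
proof -
  interpret W: prob_space "walk_space \<mu>" by (rule prob_space_walk_space)
  interpret sequence_space "measure_pmf \<mu>" by (rule sequence_space_pmf)
  let ?C = "{h'. \<forall>i<n. h' i = h i}" and ?A = "{h'. (\<forall>i<n. h' i = h i) \<and> (\<lambda>i. h' (n + i)) \<in> T}"
  have shift: "(\<lambda>h' i. h' (n + i)) \<in> walk_space \<mu> \<rightarrow>\<^sub>M walk_space \<mu>"
    unfolding walk_space_def by (intro measurable_PiM_single') (auto simp: space_PiM)
  have C_emb: "?C = prod_emb UNIV (\<lambda>_. measure_pmf \<mu>) {..<n} (\<Pi>\<^sub>E i\<in>{..<n}. {h i})"
    unfolding set_eq_iff prod_emb_iff restrict_PiE_iff Pi_iff by auto
  have C: "?C \<in> sets (walk_space \<mu>)"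
    unfolding C_emb walk_space_def by (intro sets_PiM_I) auto
  have mC: "emeasure (walk_space \<mu>) ?C = ennreal (\<Prod>i<n. pmf \<mu> (h i))"
    unfolding C_emb walk_space_def
    by (subst emeasure_PiM_emb) (auto simp: emeasure_pmf_single prod_ennreal)
  have "?A = ?C \<inter> ((\<lambda>h' i. h' (n + i)) -` T \<inter> space (walk_space \<mu>))" by auto
  then show A: "?A \<in> sets (walk_space \<mu>)"
    using C measurable_sets[OF shift T] by auto
  have "emeasure (walk_space \<mu>) ?A
      = emeasure (distr (walk_space \<mu> \<Otimes>\<^sub>M walk_space \<mu>) (walk_space \<mu>) (\<lambda>(\<omega>, \<omega>'). comb_seq n \<omega> \<omega>')) ?A"
    using PiM_comb_seq[of n] unfolding walk_space_def by simp
  also have "\<dots> = emeasure (walk_space \<mu> \<Otimes>\<^sub>M walk_space \<mu>)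
      ((\<lambda>(\<omega>, \<omega>'). comb_seq n \<omega> \<omega>') -` ?A \<inter> space (walk_space \<mu> \<Otimes>\<^sub>M walk_space \<mu>))"
    using A by (intro emeasure_distr) (auto simp: walk_space_def measurable_comb_seq)
  also have "(\<lambda>(\<omega>, \<omega>'). comb_seq n \<omega> \<omega>') -` ?A \<inter> space (walk_space \<mu> \<Otimes>\<^sub>M walk_space \<mu>) = ?C \<times> T"
    by (auto simp: comb_seq_def space_pair_measure)
  also have "emeasure (walk_space \<mu> \<Otimes>\<^sub>M walk_space \<mu>) (?C \<times> T) = emeasure (walk_space \<mu>) ?C * emeasure (walk_space \<mu>) T"
    by (rule W.emeasure_pair_measure_Times[OF C T])
  finally show "emeasure (walk_space \<mu>) ?A = ennreal (\<Prod>i<n. pmf \<mu> (h i)) * emeasure (walk_space \<mu>) T"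
    by (simp add: mC)
qed

text \<open>The condition \<open>2 \<delta> \<le> c\<close> lets Gromov products of consecutive positions, which grow at rate \<open>c / 2\<close>,
outweigh the loss of \<open>\<delta>\<close> at each step when they are chained along a trajectory.\<close>
locale drifting_walk = hyperbolic_action b \<delta> G for b :: "'a::gromov_hyperbolic_space" and \<delta> G +
  fixes \<mu> :: "('a \<Rightarrow> 'a) pmf" and t c :: real
  assumes set_mu: "set_pmf \<mu> = G"
    and t_pos: "0 < t" and delta_c: "2 * \<delta> \<le> c" and tc: "t * c = 1 / 50"
    and drift: "\<And>y. (\<integral>\<^sup>+ h. ennreal (exp (- t * dist y (h b))) \<partial>measure_pmf \<mu>) \<le> ennreal (19 / 20 * exp (- t * dist y b))"
    and moment: "(\<integral>\<^sup>+ h. ennreal (exp (t * dist b (h b))) \<partial>measure_pmf \<mu>) \<le> 2"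
    and entropy: "(\<integral>\<^sup>+ h. ennreal (1 / sqrt (pmf \<mu> h)) \<partial>measure_pmf \<mu>) \<le> 4"
begin

abbreviation W where "W \<equiv> walk_space \<mu>"

text \<open>Composition is not measurable for the product of discrete \<open>\<sigma>\<close>-algebras on the uncountable type of
self-maps. Replacing the increments outside the countable group by the identity, a change on a null
set, makes every position of the walk take countably many values.\<close>
definition clip :: "('a \<Rightarrow> 'a) \<Rightarrow> 'a \<Rightarrow> 'a" where "clip g = (if g \<in> G then g else id)"

definition X :: "(nat \<Rightarrow> 'a \<Rightarrow> 'a) \<Rightarrow> nat \<Rightarrow> 'a \<Rightarrow> 'a" where
  "X h n = random_walk (\<lambda>i. clip (h i)) n"

lemma clip_G: "clip g \<in> G"
  by (simp add: clip_def G_id)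

lemma X_0 [simp]: "X h 0 = id" and X_Suc: "X h (Suc n) = X h n \<circ> clip (h n)"
  by (simp_all add: X_def)

lemma X_G: "X h n \<in> G"
  by (induction n) (simp_all only: X_0 X_Suc G_id G_comp clip_G)

lemma X_add: "X h (n + k) x = X h n (X (\<lambda>i. h (n + i)) k x)"
  by (simp add: X_def random_walk_add)

lemma X_cong: "(\<And>i. i < n \<Longrightarrow> h i = h' i) \<Longrightarrow> X h n = X h' n"
  unfolding X_def by (rule random_walk_cong) simp

lemma X_case_nat: "X (case_nat s \<omega>) (Suc k) x = clip s (X \<omega> k x)"
  using X_add[of "case_nat s \<omega>" 1 k x] by (simp add: X_Suc)

lemma X_eq_random_walk: "(\<And>i. h i \<in> G) \<Longrightarrow> X h n = random_walk h n"
  by (simp add: X_def clip_def)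

lemma AE_increments_in_G: "AE h in W. \<forall>i. h i \<in> G"
proof -
  have "AE h in W. h i \<in> G" for i
    unfolding walk_space_def using set_mu
    by (intro AE_PiM_component prob_space_measure_pmf) (auto simp: AE_measure_pmf_iff)
  then show ?thesis by (simp add: AE_all_countable)
qed

lemma measurable_clip: "(\<lambda>h. clip (h i)) \<in> W \<rightarrow>\<^sub>M count_space G"
  by (rule measurable_increment_function) (simp add: clip_G)

lemma measurable_X: "(\<lambda>h. X h n) \<in> W \<rightarrow>\<^sub>M count_space G"
proof (induction n)
  case (Suc n)
  have "(\<lambda>h. g \<circ> clip (h n)) \<in> W \<rightarrow>\<^sub>M count_space G" if "g \<in> G" for g
    by (rule measurable_compose[OF measurable_clip])
      (unfold measurable_count_space_eq1, intro Pi_I, simp only: space_count_space G_comp that)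
  from measurable_compose_countable'[OF this Suc countable_G]
  show ?case unfolding X_Suc .
qed (simp only: X_0, rule measurable_const, simp only: space_count_space G_id)

lemma measurable_X_function:
  assumes "\<And>g. g \<in> G \<Longrightarrow> f g \<in> space N"
  shows "(\<lambda>h. f (X h n)) \<in> W \<rightarrow>\<^sub>M N"
  by (rule measurable_compose[OF measurable_X]) (use assms in auto)

text \<open>The first increment \<open>s\<close> is an isometry, so the walk seen from \<open>y\<close> after this step is a fresh walk
seen from \<open>s\<^sup>-\<^sup>1 y\<close>. Uniformity of the contraction in the observing point makes the induction work.\<close>
lemma walk_laplace:
  "(\<integral>\<^sup>+ h. ennreal (exp (- t * dist y (X h k b))) \<partial>W) \<le> ennreal ((19 / 20) ^ k * exp (- t * dist y b))"
proof (induction k arbitrary: y)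
  case 0
  interpret prob_space W by (rule prob_space_walk_space)
  show ?case using emeasure_space_1 by simp
next
  case (Suc k)
  have "(\<lambda>h. ennreal (exp (- t * dist y (X h (Suc k) b)))) \<in> borel_measurable W"
    by (rule measurable_X_function) simp
  then have "(\<integral>\<^sup>+ h. ennreal (exp (- t * dist y (X h (Suc k) b))) \<partial>W)
      = (\<integral>\<^sup>+ s. \<integral>\<^sup>+ \<omega>. ennreal (exp (- t * dist y (clip s (X \<omega> k b)))) \<partial>W \<partial>measure_pmf \<mu>)"
    by (subst nn_integral_first_step) (simp_all add: X_case_nat)
  also have "\<dots> = (\<integral>\<^sup>+ s. \<integral>\<^sup>+ \<omega>. ennreal (exp (- t * dist (iso_inv (clip s) y) (X \<omega> k b))) \<partial>W \<partial>measure_pmf \<mu>)"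
  proof -
    have "dist y (clip s z) = dist (iso_inv (clip s) y) z" for s z
      using dist_iso_inv[OF G_carrier[OF clip_G], of z s y] by (simp add: dist_commute)
    then show ?thesis by simp
  qed
  also have "\<dots> \<le> (\<integral>\<^sup>+ s. ennreal ((19 / 20) ^ k * exp (- t * dist (iso_inv (clip s) y) b)) \<partial>measure_pmf \<mu>)"
    by (intro nn_integral_mono Suc)
  also have "\<dots> = (\<integral>\<^sup>+ s. ennreal ((19 / 20) ^ k) * ennreal (exp (- t * dist y (s b))) \<partial>measure_pmf \<mu>)"
  proof (rule nn_integral_cong_AE, unfold AE_measure_pmf_iff, intro ballI)
    fix s assume "s \<in> set_pmf \<mu>"
    then have s: "s \<in> G" using set_mu by simp
    then have "dist (iso_inv (clip s) y) b = dist y (s b)"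
      using dist_iso_inv[OF G_carrier[OF s], of b y] by (simp add: clip_def dist_commute)
    then show "ennreal ((19 / 20) ^ k * exp (- t * dist (iso_inv (clip s) y) b))
      = ennreal ((19 / 20) ^ k) * ennreal (exp (- t * dist y (s b)))"
      by (simp add: ennreal_mult)
  qed
  also have "\<dots> = ennreal ((19 / 20) ^ k) * (\<integral>\<^sup>+ s. ennreal (exp (- t * dist y (s b))) \<partial>measure_pmf \<mu>)"
    by (rule nn_integral_cmult) simp
  also have "\<dots> \<le> ennreal ((19 / 20) ^ k) * ennreal (19 / 20 * exp (- t * dist y b))"
    by (intro mult_left_mono drift) simp
  also have "\<dots> = ennreal ((19 / 20) ^ Suc k * exp (- t * dist y b))"
    by (simp add: ennreal_mult[symmetric] mult_ac)
  finally show ?case .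
qed

lemma increment_moment: "(\<integral>\<^sup>+ h. ennreal (exp (t * len (clip (h k)))) \<partial>W) \<le> 2"
proof -
  have "(\<integral>\<^sup>+ h. ennreal (exp (t * len (clip (h k)))) \<partial>W) = (\<integral>\<^sup>+ g. ennreal (exp (t * len (clip g))) \<partial>measure_pmf \<mu>)"
    by (rule nn_integral_increment)
  also have "\<dots> = (\<integral>\<^sup>+ g. ennreal (exp (t * len g)) \<partial>measure_pmf \<mu>)"
    by (rule nn_integral_cong_AE) (simp add: AE_measure_pmf_iff set_mu clip_def)
  finally show ?thesis using moment by simp
qed

text \<open>Seen from \<open>y\<close> the trajectory escapes at speed \<open>c\<close>, and its jumps grow at most at half that speed; \<open>s\<close>
is the slack allowed in both conditions. Consecutive positions then have linearly growing Gromov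
products.\<close>
definition good :: "'a \<Rightarrow> real \<Rightarrow> (nat \<Rightarrow> 'a \<Rightarrow> 'a) set" where
  "good y s = {h. \<forall>k. dist y b + c * k - s \<le> dist y (X h k b) \<and> len (clip (h k)) \<le> s + c * k / 2}"

lemma good_mono: "s \<le> s' \<Longrightarrow> good y s \<subseteq> good y s'"
proof (rule subsetI)
  fix h assume "s \<le> s'" and h: "h \<in> good y s"
  have "dist y b + c * k - s' \<le> dist y (X h k b) \<and> len (clip (h k)) \<le> s' + c * k / 2" for k :: nat
  proof -
    have "dist y b + c * k - s \<le> dist y (X h k b) \<and> len (clip (h k)) \<le> s + c * k / 2"
      using h by (simp add: good_def)
    then show ?thesis using \<open>s \<le> s'\<close> by linarith
  qed
  then show "h \<in> good y s'" by (simp add: good_def)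
qed

lemma good_nonneg: "h \<in> good y s \<Longrightarrow> s \<ge> 0"
  unfolding good_def by (auto dest: spec[of _ 0])

lemma sets_good: "good y s \<in> sets W"
proof -
  have "(\<lambda>h. dist y b + c * k - s \<le> dist y (X h k b)) \<in> W \<rightarrow>\<^sub>M count_space UNIV" for k :: nat
    by (rule measurable_X_function) simp
  moreover have "(\<lambda>h. len (clip (h k)) \<le> s + c * k / 2) \<in> W \<rightarrow>\<^sub>M count_space UNIV" for k :: nat
    by (rule measurable_increment_function) simp
  ultimately have "Measurable.pred W (\<lambda>h. \<forall>k. dist y b + c * k - s \<le> dist y (X h k b) \<and> len (clip (h k)) \<le> s + c * k / 2)"
    by (intro pred_intros_countable pred_intros_logic)
  from predE[OF this] show ?thesis by (simp add: good_def)
qed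

text \<open>A trajectory violates a condition of \<open>good\<close> by a large amount at some time only if one term of this
series is large.\<close>
definition defect :: "'a \<Rightarrow> (nat \<Rightarrow> 'a \<Rightarrow> 'a) \<Rightarrow> ennreal" where
  "defect y h = (\<Sum>k. ennreal (exp (t * (c * k + dist y b - dist y (X h k b)))) + ennreal (exp (t * (len (clip (h k)) - c * k / 2))))"

text \<open>The sum of the two geometric series that bound the expectation of the defect: the ratios are
\<open>19/20 e\<^sup>t\<^sup>c\<close> and \<open>e\<^sup>-\<^sup>t\<^sup>c\<^sup>/\<^sup>2\<close> with \<open>t c = 1/50\<close>.\<close>
definition defect_bound :: real where
  "defect_bound = 1 / (1 - 19 / 20 * exp (1 / 50)) + 2 / (1 - exp (- (1 / 100)))"

lemma ratio_less_1: "19 / 20 * exp (1 / 50) < (1::real)"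
  using exp_bound[of "1 / 50"] by (simp add: power2_eq_square)

lemma defect_bound_pos: "defect_bound > 0"
  unfolding defect_bound_def using ratio_less_1 by (intro add_pos_pos divide_pos_pos) auto

lemma measurable_defect: "defect y \<in> borel_measurable W"
proof -
  have "(\<lambda>h. ennreal (exp (t * (c * k + dist y b - dist y (X h k b))))) \<in> borel_measurable W" for k :: nat
    by (rule measurable_X_function) simp
  moreover have "(\<lambda>h. ennreal (exp (t * (len (clip (h k)) - c * k / 2)))) \<in> borel_measurable W" for k :: nat
    by (rule measurable_increment_function) simp
  ultimately show ?thesis
    unfolding defect_def by (intro borel_measurable_suminf_order borel_measurable_add)
qed

lemma exp_tc: "exp (t * (c * real k)) = exp (1 / 50) ^ k"
proof -
  have "t * (c * real k) = real k * (1 / 50)" using tc by (simp add: mult.assoc[symmetric])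
  then show ?thesis by (simp only: exp_of_nat_mult)
qed

lemma exp_tc2: "exp (t * (x - c * real k / 2)) = exp (- (1 / 100)) ^ k * exp (t * x)"
proof -
  have "t * (x - c * real k / 2) = t * x - (t * c) * real k / 2" by (simp add: algebra_simps)
  also have "\<dots> = real k * (- (1 / 100)) + t * x" unfolding tc by simp
  finally show ?thesis by (simp only: exp_add exp_of_nat_mult)
qed

lemma nn_integral_defect: "(\<integral>\<^sup>+ h. defect y h \<partial>W) \<le> ennreal defect_bound"
proof -
  let ?\<alpha> = "19 / 20 * exp (1 / 50) :: real" and ?\<beta> = "exp (- (1 / 100)) :: real"
  have m1: "(\<lambda>h. ennreal (exp (t * (c * k + dist y b - dist y (X h k b))))) \<in> borel_measurable W" for k :: nat
    by (rule measurable_X_function) simp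
  have m2: "(\<lambda>h. ennreal (exp (t * (len (clip (h k)) - c * k / 2)))) \<in> borel_measurable W" for k :: nat
    by (rule measurable_increment_function) simp
  have m3: "(\<lambda>h. ennreal (exp (- t * dist y (X h k b)))) \<in> borel_measurable W" for k :: nat
    by (rule measurable_X_function) simp
  have m4: "(\<lambda>h. ennreal (exp (t * len (clip (h k))))) \<in> borel_measurable W" for k :: nat
    by (rule measurable_increment_function) simp
  have 1: "(\<integral>\<^sup>+ h. ennreal (exp (t * (c * k + dist y b - dist y (X h k b)))) \<partial>W) \<le> ennreal (?\<alpha> ^ k)" for k :: nat
  proof -
    let ?C = "exp (1 / 50) ^ k * exp (t * dist y b)"
    have "exp (t * (c * k + dist y b - dist y (X h k b))) = ?C * exp (- t * dist y (X h k b))" for h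
      by (simp add: exp_tc[symmetric] algebra_simps flip: exp_add)
    then have "(\<integral>\<^sup>+ h. ennreal (exp (t * (c * k + dist y b - dist y (X h k b)))) \<partial>W)
        = (\<integral>\<^sup>+ h. ennreal ?C * ennreal (exp (- t * dist y (X h k b))) \<partial>W)"
      by (simp add: ennreal_mult)
    also have "\<dots> = ennreal ?C * (\<integral>\<^sup>+ h. ennreal (exp (- t * dist y (X h k b))) \<partial>W)"
      by (rule nn_integral_cmult[OF m3])
    also have "\<dots> \<le> ennreal ?C * ennreal ((19 / 20) ^ k * exp (- t * dist y b))"
      by (intro mult_left_mono walk_laplace) simp
    also have "\<dots> = ennreal (?C * ((19 / 20) ^ k * exp (- t * dist y b)))"
      by (simp add: ennreal_mult)
    also have "?C * ((19 / 20) ^ k * exp (- t * dist y b))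
        = (19 / 20) ^ k * exp (1 / 50) ^ k * (exp (t * dist y b) * exp (- t * dist y b))"
      by (simp only: mult_ac)
    also have "\<dots> = ?\<alpha> ^ k"
      unfolding power_mult_distrib by (simp flip: exp_add)
    finally show ?thesis .
  qed
  have 2: "(\<integral>\<^sup>+ h. ennreal (exp (t * (len (clip (h k)) - c * k / 2))) \<partial>W) \<le> ennreal (2 * ?\<beta> ^ k)" for k :: nat
  proof -
    have "(\<integral>\<^sup>+ h. ennreal (exp (t * (len (clip (h k)) - c * k / 2))) \<partial>W)
        = (\<integral>\<^sup>+ h. ennreal (?\<beta> ^ k) * ennreal (exp (t * len (clip (h k)))) \<partial>W)"
      by (simp only: exp_tc2) (simp add: ennreal_mult)
    also have "\<dots> = ennreal (?\<beta> ^ k) * (\<integral>\<^sup>+ h. ennreal (exp (t * len (clip (h k)))) \<partial>W)"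
      by (rule nn_integral_cmult[OF m4])
    also have "\<dots> \<le> ennreal (?\<beta> ^ k) * ennreal 2"
      using increment_moment by (intro mult_left_mono) auto
    also have "\<dots> = ennreal (?\<beta> ^ k * 2)" by (rule ennreal_mult[symmetric]) auto
    also have "?\<beta> ^ k * 2 = 2 * ?\<beta> ^ k" by simp
    finally show ?thesis .
  qed
  have \<alpha>: "(\<lambda>k. ?\<alpha> ^ k) sums (1 / (1 - ?\<alpha>))" using ratio_less_1 by (intro geometric_sums) simp
  have \<beta>: "(\<lambda>k. 2 * ?\<beta> ^ k) sums (2 * (1 / (1 - ?\<beta>)))" by (intro sums_mult geometric_sums) simp
  have "(\<integral>\<^sup>+ h. defect y h \<partial>W) = (\<Sum>k. \<integral>\<^sup>+ h. ennreal (exp (t * (c * k + dist y b - dist y (X h k b)))) + ennreal (exp (t * (len (clip (h k)) - c * k / 2))) \<partial>W)"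
    unfolding defect_def by (intro nn_integral_suminf borel_measurable_add m1 m2)
  also have "\<dots> \<le> (\<Sum>k. ennreal (?\<alpha> ^ k + 2 * ?\<beta> ^ k))"
  proof (intro suminf_le)
    fix k
    show "(\<integral>\<^sup>+ h. ennreal (exp (t * (c * k + dist y b - dist y (X h k b)))) + ennreal (exp (t * (len (clip (h k)) - c * k / 2))) \<partial>W)
      \<le> ennreal (?\<alpha> ^ k + 2 * ?\<beta> ^ k)"
      using add_mono[OF 1[of k] 2[of k]] by (subst nn_integral_add[OF m1 m2]) (simp add: ennreal_plus)
  qed auto
  also have "\<dots> = ennreal (1 / (1 - ?\<alpha>) + 2 * (1 / (1 - ?\<beta>)))"
    using sums_add[OF \<alpha> \<beta>] by (subst suminf_ennreal2) (auto simp: sums_iff)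
  finally show ?thesis by (simp add: defect_bound_def)
qed

lemma good_if_defect_le:
  assumes "defect y h \<le> ennreal B" "B > 0"
  shows "h \<in> good y (ln B / t)"
proof -
  have "dist y b + c * k - ln B / t \<le> dist y (X h k b) \<and> len (clip (h k)) \<le> ln B / t + c * k / 2" for k :: nat
  proof -
    let ?x = "c * k + dist y b - dist y (X h k b)" and ?z = "len (clip (h k)) - c * k / 2"
    have "ennreal (exp (t * ?x)) + ennreal (exp (t * ?z)) \<le> defect y h"
      unfolding defect_def
      using sum_le_suminf[of "\<lambda>k. ennreal (exp (t * (c * k + dist y b - dist y (X h k b)))) + ennreal (exp (t * (len (clip (h k)) - c * k / 2)))" "{k}"]
      by simp
    then have "ennreal (exp (t * ?x) + exp (t * ?z)) \<le> ennreal B"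
      using assms(1) by (subst ennreal_plus) auto
    then have "exp (t * ?x) + exp (t * ?z) \<le> B"
      using assms(2) by (subst (asm) ennreal_le_iff) auto
    then have "exp (t * ?x) \<le> B" "exp (t * ?z) \<le> B"
      using exp_gt_zero[of "t * ?x"] exp_gt_zero[of "t * ?z"] by linarith+
    then have "t * ?x \<le> ln B" "t * ?z \<le> ln B"
      using assms(2) by (metis ln_exp ln_le_cancel_iff exp_gt_zero)+
    then have "?x \<le> ln B / t" "?z \<le> ln B / t"
      using t_pos by (simp_all add: pos_le_divide_eq mult.commute)
    then show ?thesis by linarith
  qed
  then show ?thesis by (simp add: good_def)
qed

text \<open>By Markov's inequality the defect exceeds twice the bound on its expectation with probability at
most one half, so a trajectory is good with this slack with probability at least one half.\<close>
definition slack :: real where "slack = ln (2 * defect_bound) / t"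

lemma prob_good: "emeasure W (good y slack) \<ge> 1 / 2"
proof -
  interpret prob_space W by (rule prob_space_walk_space)
  have "emeasure W ({h\<in>UNIV. 1 \<le> ennreal (1 / (2 * defect_bound)) * defect y h}) \<le> ennreal (1 / (2 * defect_bound)) * (\<integral>\<^sup>+ h. defect y h * indicator UNIV h \<partial>W)"
    using measurable_defect[of y] sets.top[of W] by (intro nn_integral_Markov_inequality) simp_all
  also have "\<dots> \<le> ennreal (1 / (2 * defect_bound)) * ennreal defect_bound"
    using nn_integral_defect by (intro mult_left_mono) auto
  also have "\<dots> = ennreal (1 / 2)" using defect_bound_pos by (simp add: ennreal_mult[symmetric])
  finally have bad: "emeasure W {h. 1 \<le> ennreal (1 / (2 * defect_bound)) * defect y h} \<le> ennreal (1 / 2)" by simp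
  have sub: "space W - good y slack \<subseteq> {h. 1 \<le> ennreal (1 / (2 * defect_bound)) * defect y h}"
  proof safe
    fix h assume h: "h \<notin> good y slack"
    have "\<not> defect y h \<le> ennreal (2 * defect_bound)" using good_if_defect_le[of y h "2 * defect_bound"] h defect_bound_pos unfolding slack_def by auto
    then have "ennreal (1 / (2 * defect_bound)) * ennreal (2 * defect_bound) \<le> ennreal (1 / (2 * defect_bound)) * defect y h" by (intro mult_left_mono) auto
    moreover have "ennreal (1 / (2 * defect_bound)) * ennreal (2 * defect_bound) = 1"
      using defect_bound_pos by (simp add: ennreal_mult[symmetric] )
    ultimately show "1 \<le> ennreal (1 / (2 * defect_bound)) * defect y h" by simp
  qed
  have "{h \<in> space W. 1 \<le> ennreal (1 / (2 * defect_bound)) * defect y h} \<in> sets W"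
    using measurable_defect[of y] by measurable
  then have "emeasure W (space W - good y slack) \<le> ennreal (1 / 2)"
    using emeasure_mono[OF sub] bad by (auto intro: order_trans)
  then have "measure W (space W - good y slack) \<le> 1 / 2"
    unfolding emeasure_eq_measure by (subst (asm) ennreal_le_iff) auto
  then have "1 - measure W (good y slack) \<le> 1 / 2"
    unfolding prob_compl[OF sets_good] .
  then have "1 / 2 \<le> measure W (good y slack)" by simp
  then have "ennreal (1 / 2) \<le> emeasure W (good y slack)" by (simp add: emeasure_eq_measure ennreal_leI del: ennreal_half)
  moreover have "ennreal (1 / 2) = 1 / 2" by (simp add: divide_ennreal_def)
  ultimately show ?thesis by simp
qed

lemma AE_good: "AE h in W. \<exists>n::nat. h \<in> good b n"
proof -
  have "(\<integral>\<^sup>+ h. defect b h \<partial>W) \<noteq> \<infinity>" using nn_integral_defect[of b] by (auto simp: top_unique)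
  then have "AE h in W. defect b h \<noteq> \<infinity>" by (rule nn_integral_PInf_AE[OF measurable_defect])
  then show ?thesis
  proof eventually_elim
    case (elim h)
    obtain B where B: "defect b h = ennreal B" "B \<ge> 0" using ennreal_finiteE[OF elim] .
    then have "h \<in> good b (ln (B + 1) / t)" by (intro good_if_defect_le) (auto intro: ennreal_leI)
    moreover obtain n :: nat where "ln (B + 1) / t \<le> n" using real_arch_simple by blast
    ultimately show ?case using good_mono by blast
  qed
qed

lemma path_weight_moment:
  "(\<integral>\<^sup>+ h. (\<Prod>i<n. ennreal (1 / sqrt (pmf \<mu> (h i)))) \<partial>W) \<le> 4 ^ n"
proof (induction n)
  case 0
  interpret prob_space W by (rule prob_space_walk_space)
  show ?case using emeasure_space_1 by simp
next
  case (Suc n)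
  let ?f = "\<lambda>g. ennreal (1 / sqrt (pmf \<mu> g))"
  have m: "(\<lambda>h. \<Prod>i<n. ?f (h i)) \<in> borel_measurable W" for n
    by (intro borel_measurable_prod_ennreal measurable_increment_function) simp
  have "(\<integral>\<^sup>+ h. (\<Prod>i<Suc n. ?f (h i)) \<partial>W) = (\<integral>\<^sup>+ s. \<integral>\<^sup>+ \<omega>. ?f s * (\<Prod>i<n. ?f (\<omega> i)) \<partial>W \<partial>measure_pmf \<mu>)"
    by (subst nn_integral_first_step[OF m]) (simp add: prod.lessThan_Suc_shift del: prod.lessThan_Suc)
  also have "\<dots> = (\<integral>\<^sup>+ s. ?f s * (\<integral>\<^sup>+ \<omega>. (\<Prod>i<n. ?f (\<omega> i)) \<partial>W) \<partial>measure_pmf \<mu>)"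
    by (intro nn_integral_cong nn_integral_cmult m)
  also have "\<dots> = (\<integral>\<^sup>+ s. ?f s \<partial>measure_pmf \<mu>) * (\<integral>\<^sup>+ \<omega>. (\<Prod>i<n. ?f (\<omega> i)) \<partial>W)"
    by (intro nn_integral_multc) simp
  also have "\<dots> \<le> 4 * 4 ^ n" using entropy Suc by (intro mult_mono) auto
  finally show ?case by simp
qed

text \<open>With the weights \<open>8\<^sup>-\<^sup>n\<close> the expectations of the products of \<open>\<mu>(h\<^sub>i)\<^sup>-\<^sup>1\<^sup>/\<^sup>2\<close>, at most \<open>4\<^sup>n\<close>, become summable.
The sum is almost surely finite and bounds each term; squaring turns \<open>8\<close> into \<open>64\<close>.\<close>
lemma AE_path_weight: "AE h in W. \<exists>q>0. \<forall>n. q * (1 / 64) ^ n \<le> (\<Prod>i<n. pmf \<mu> (h i))"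
proof -
  let ?f = "\<lambda>g. ennreal (1 / sqrt (pmf \<mu> g))"
  let ?Y = "\<lambda>h. \<Sum>n. ennreal ((1 / 8) ^ n) * (\<Prod>i<n. ?f (h i))"
  have m0: "(\<lambda>h. \<Prod>i<n. ?f (h i)) \<in> borel_measurable W" for n
    by (intro borel_measurable_prod_ennreal measurable_increment_function) simp
  then have m: "(\<lambda>h. ennreal ((1 / 8) ^ n) * (\<Prod>i<n. ?f (h i))) \<in> borel_measurable W" for n
    by measurable
  have "(\<integral>\<^sup>+ h. ?Y h \<partial>W) = (\<Sum>n. \<integral>\<^sup>+ h. ennreal ((1 / 8) ^ n) * (\<Prod>i<n. ?f (h i)) \<partial>W)"
    by (intro nn_integral_suminf m)
  also have "\<dots> \<le> (\<Sum>n. ennreal ((1 / 2) ^ n))"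
  proof (intro suminf_le)
    fix n
    have "(\<integral>\<^sup>+ h. ennreal ((1 / 8) ^ n) * (\<Prod>i<n. ?f (h i)) \<partial>W) = ennreal ((1 / 8) ^ n) * (\<integral>\<^sup>+ h. (\<Prod>i<n. ?f (h i)) \<partial>W)"
      by (intro nn_integral_cmult m0)
    also have "\<dots> \<le> ennreal ((1 / 8) ^ n) * 4 ^ n" by (intro mult_left_mono path_weight_moment) simp
    also have "(4 :: ennreal) ^ n = ennreal (4 ^ n)"
      by (metis ennreal_numeral ennreal_power zero_le_numeral)
    also have "ennreal ((1 / 8) ^ n) * ennreal (4 ^ n) = ennreal ((1 / 8) ^ n * 4 ^ n)"
      by (simp add: ennreal_mult)
    also have "(1 / 8 :: real) ^ n * 4 ^ n = (1 / 8 * 4) ^ n" by (rule power_mult_distrib[symmetric])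
    finally show "(\<integral>\<^sup>+ h. ennreal ((1 / 8) ^ n) * (\<Prod>i<n. ?f (h i)) \<partial>W) \<le> ennreal ((1 / 2) ^ n)" by simp
  qed auto
  also have "\<dots> = ennreal (\<Sum>n. (1 / 2) ^ n)" by (intro suminf_ennreal2) auto
  finally have "(\<integral>\<^sup>+ h. ?Y h \<partial>W) \<noteq> \<infinity>" by (auto simp: top_unique)
  then have "AE h in W. ?Y h \<noteq> \<infinity>"
    by (intro nn_integral_PInf_AE borel_measurable_suminf_order m)
  then show ?thesis using AE_increments_in_G
  proof eventually_elim
    case (elim h)
    obtain B where B: "?Y h = ennreal B" "B \<ge> 0" using ennreal_finiteE[OF elim(1)] .
    have "1 / (B + 1)\<^sup>2 * (1 / 64) ^ n \<le> (\<Prod>i<n. pmf \<mu> (h i))" for n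
    proof -
      let ?p = "\<Prod>i<n. pmf \<mu> (h i)"
      have pos: "pmf \<mu> (h i) > 0" for i using elim(2) set_mu by (simp add: pmf_positive)
      have p: "?p > 0" using pos by (simp add: prod_pos)
      have "ennreal ((1 / 8) ^ n) * (\<Prod>i<n. ?f (h i)) \<le> ?Y h"
        using sum_le_suminf[of "\<lambda>n. ennreal ((1 / 8) ^ n) * (\<Prod>i<n. ?f (h i))" "{n}"] by simp
      also have "(\<Prod>i<n. ?f (h i)) = ennreal (\<Prod>i<n. 1 / sqrt (pmf \<mu> (h i)))" by (rule prod_ennreal) simp
      also have "(\<Prod>i<n. 1 / sqrt (pmf \<mu> (h i))) = 1 / sqrt ?p"
        by (induction n) (simp_all add: real_sqrt_mult)
      finally have "ennreal ((1 / 8) ^ n * (1 / sqrt ?p)) \<le> ennreal B"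
        unfolding B(1) by (subst ennreal_mult) (use p in auto)
      then have "(1 / 8) ^ n * (1 / sqrt ?p) \<le> B"
        using B(2) by (subst (asm) ennreal_le_iff) auto
      then have "(1 / 8) ^ n * (1 / sqrt ?p) \<le> B + 1" by linarith
      then have "(1 / 8) ^ n \<le> (B + 1) * sqrt ?p" using p by (simp add: field_simps)
      then have "((1 / 8) ^ n)\<^sup>2 \<le> ((B + 1) * sqrt ?p)\<^sup>2" by (intro power_mono) auto
      also have "\<dots> = (B + 1)\<^sup>2 * ?p" using p by (simp add: power_mult_distrib)
      also have "((1 / 8 :: real) ^ n)\<^sup>2 = (1 / 64) ^ n"
        by (subst power_mult[symmetric], subst mult.commute, subst power_mult) (simp add: power2_eq_square)
      finally show ?thesis using B by (simp add: field_simps)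
    qed
    then show ?case using B by (intro exI[of _ "1 / (B + 1)\<^sup>2"]) auto
  qed
qed

end

section \<open>The harmonic measure and its dimension\<close>

lemma ideal_boundary_subset: "ideal_boundary \<subseteq> bordification"
  by (auto simp: bordification_def)

lemma boundary_borel_generators:
  "{U. openin (subtopology (bord_topology b) ideal_boundary) U} \<subseteq> Pow ideal_boundary"
  by (auto simp: openin_subtopology)

lemma space_boundary_borel [simp]: "space (boundary_borel b) = ideal_boundary"
  unfolding boundary_borel_def by (rule space_measure_of[OF boundary_borel_generators])

lemma openin_sets_boundary_borel:
  "openin (subtopology (bord_topology b) ideal_boundary) U \<Longrightarrow> U \<in> sets (boundary_borel b)"
  unfolding boundary_borel_def by (simp add: sets_measure_of[OF boundary_borel_generators])

lemma visual_metric_submetric: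
  assumes "visual_metric b a d"
  shows "Submetric bordification d ideal_boundary"
    and "Metric_space.mtopology ideal_boundary d = subtopology (bord_topology b) ideal_boundary"
proof -
  have ms: "Metric_space bordification d" and top: "Metric_space.mtopology bordification d = bord_topology b"
    using assms by (auto simp: visual_metric_def)
  show sub: "Submetric bordification d ideal_boundary"
    by (intro Submetric.intro ms Submetric_axioms.intro ideal_boundary_subset)
  show "Metric_space.mtopology ideal_boundary d = subtopology (bord_topology b) ideal_boundary"
    using Submetric.mtopology_submetric[OF sub] top by simp
qed

lemma sets_boundary_ball:
  assumes "visual_metric b a d"
  shows "Metric_space.mball ideal_boundary d \<xi> r \<in> sets (boundary_borel b)"
proof -
  interpret Submetric bordification d ideal_boundary by (rule visual_metric_submetric[OF assms])
  show ?thesis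
    using sub.openin_mball visual_metric_submetric(2)[OF assms]
    by (intro openin_sets_boundary_borel) simp
qed

text \<open>The measure of open balls is lower semicontinuous in the centre. This replaces the dimension
inequality, whose measurability in the centre is not obvious, by a measurable condition.\<close>
lemma sets_ball_measure_greater:
  assumes vis: "visual_metric b a d" and fin: "finite_measure \<nu>" and sets: "sets \<nu> = sets (boundary_borel b)"
  shows "{\<xi> \<in> ideal_boundary. measure \<nu> (Metric_space.mball ideal_boundary d \<xi> r) > \<kappa>} \<in> sets (boundary_borel b)"
proof -
  interpret Submetric bordification d ideal_boundary by (rule visual_metric_submetric[OF vis])
  interpret \<nu>: finite_measure \<nu> by (rule fin)
  let ?S = "{\<xi> \<in> ideal_boundary. measure \<nu> (sub.mball \<xi> r) > \<kappa>}"
  have ball: "sub.mball \<xi> r \<in> sets \<nu>" for \<xi> r using sets_boundary_ball[OF vis] sets by simp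
  have "\<exists>e>0. sub.mball \<xi> e \<subseteq> ?S" if "\<xi> \<in> ?S" for \<xi>
  proof -
    let ?B = "\<lambda>n::nat. sub.mball \<xi> (r - 1 / (real n + 1))"
    have "incseq ?B"
    proof (rule incseq_SucI)
      fix n
      have "1 / (real (Suc n) + 1) \<le> 1 / (real n + 1)" by (intro divide_left_mono) auto
      then show "?B n \<subseteq> ?B (Suc n)" by (intro sub.mball_subset_concentric) simp
    qed
    moreover have "range ?B \<subseteq> sets \<nu>" using ball by auto
    ultimately have "(\<lambda>n. measure \<nu> (?B n)) \<longlonglongrightarrow> measure \<nu> (\<Union>n. ?B n)"
      by (intro \<nu>.finite_Lim_measure_incseq)
    also have "(\<Union>n. ?B n) = sub.mball \<xi> r"
    proof
      show "(\<Union>n. ?B n) \<subseteq> sub.mball \<xi> r" by (intro UN_least sub.mball_subset_concentric) simp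
      show "sub.mball \<xi> r \<subseteq> (\<Union>n. ?B n)"
      proof
        fix x assume x: "x \<in> sub.mball \<xi> r"
        then have "r - d \<xi> x > 0" by simp
        then obtain n where "1 / real (Suc n) < r - d \<xi> x" using nat_approx_posE by blast
        then have "d \<xi> x < r - 1 / (real n + 1)" by (simp add: add.commute)
        with x show "x \<in> (\<Union>n. ?B n)" by auto
      qed
    qed
    finally have "eventually (\<lambda>n. measure \<nu> (?B n) > \<kappa>) sequentially"
      using that by (intro order_tendstoD) auto
    then obtain n where n: "measure \<nu> (?B n) > \<kappa>" by (auto simp: eventually_sequentially)
    have "sub.mball \<xi> (1 / (real n + 1)) \<subseteq> ?S"
    proof
      fix \<eta> assume \<eta>: "\<eta> \<in> sub.mball \<xi> (1 / (real n + 1))"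
      then have "d \<xi> \<eta> + (r - 1 / (real n + 1)) \<le> r" "\<eta> \<in> ideal_boundary" by simp_all
      then have "?B n \<subseteq> sub.mball \<eta> r" by (rule sub.mball_subset)
      then have "measure \<nu> (?B n) \<le> measure \<nu> (sub.mball \<eta> r)" using ball by (intro \<nu>.finite_measure_mono)
      then show "\<eta> \<in> ?S" using n \<eta> by simp
    qed
    then show ?thesis by (intro exI[of _ "1 / (real n + 1)"]) simp
  qed
  then have "openin sub.mtopology ?S" unfolding sub.openin_mtopology by auto
  then show ?thesis
    using visual_metric_submetric(2)[OF vis] by (intro openin_sets_boundary_borel) simp
qed

text \<open>Radii between \<open>e\<^sup>-\<^sup>n\<close> and \<open>e\<^sup>1\<^sup>-\<^sup>n\<close> are controlled by monotonicity; passing to the smaller radius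
changes the exponent by a factor that tends to one.\<close>
lemma upper_pointwise_dim_less:
  assumes vis: "visual_metric b a d" and fin: "finite_measure \<nu>" and sets: "sets \<nu> = sets (boundary_borel b)"
    and big: "\<And>n. n \<ge> N \<Longrightarrow> measure \<nu> (Metric_space.mball ideal_boundary d \<xi> (exp (- real n))) > exp (- (\<epsilon>' * real n))"
    and eps: "0 < \<epsilon>'" "\<epsilon>' < \<epsilon>"
  shows "upper_pointwise_dim d \<nu> \<xi> < ereal \<epsilon>"
proof -
  interpret Submetric bordification d ideal_boundary by (rule visual_metric_submetric[OF vis])
  interpret \<nu>: finite_measure \<nu> by (rule fin)
  define \<epsilon>1 where "\<epsilon>1 = (\<epsilon>' + \<epsilon>) / 2"
  have \<epsilon>1: "\<epsilon>' < \<epsilon>1" "\<epsilon>1 < \<epsilon>" using eps by (auto simp: \<epsilon>1_def)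
  define R0 where "R0 = max (real N + 1) (\<epsilon>' / (\<epsilon>1 - \<epsilon>'))"
  let ?f = "\<lambda>r. let m = measure \<nu> (sub.mball \<xi> r) in if m = 0 then \<infinity> else ereal (ln m / ln r)"
  have "?f r \<le> ereal \<epsilon>1" if r: "r \<in> {0<..<exp (- R0)}" for r
  proof -
    define R where "R = - ln r"
    have R: "R > R0"
    proof -
      have "ln r < ln (exp (- R0))" using r by (subst ln_less_cancel_iff) auto
      then show ?thesis by (simp add: R_def)
    qed
    have R1: "R > 0" "R > real N" "R * (\<epsilon>1 - \<epsilon>') \<ge> \<epsilon>'"
    proof -
      show "R > 0" "R > real N" using R by (auto simp: R0_def)
      have "R \<ge> \<epsilon>' / (\<epsilon>1 - \<epsilon>')" using R by (simp add: R0_def)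
      then show "R * (\<epsilon>1 - \<epsilon>') \<ge> \<epsilon>'" using \<epsilon>1 by (simp add: field_simps)
    qed
    define n where "n = nat \<lceil>R\<rceil>"
    have n: "real n \<ge> R" "real n \<le> R + 1" using R1(1) unfolding n_def by linarith+
    then have nN: "n \<ge> N" using R1(2) by linarith
    have "exp (- real n) \<le> exp (- R)" using n by simp
    moreover have "exp (- R) = r" using r by (simp add: R_def)
    ultimately have le: "exp (- real n) \<le> r" by simp
    define m where "m = measure \<nu> (sub.mball \<xi> r)"
    have "exp (- (\<epsilon>' * real n)) < measure \<nu> (sub.mball \<xi> (exp (- real n)))" by (rule big[OF nN])
    also have "\<dots> \<le> m"
      unfolding m_def using sets_boundary_ball[OF vis] sets
      by (intro \<nu>.finite_measure_mono sub.mball_subset_concentric le) simp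
    finally have m: "exp (- (\<epsilon>' * real n)) < m" .
    then have m0: "m > 0" using exp_gt_zero less_trans by blast
    have "ln (exp (- (\<epsilon>' * real n))) < ln m" using m m0 by (subst ln_less_cancel_iff) auto
    then have "- ln m \<le> \<epsilon>' * real n" by simp
    also have "\<dots> \<le> \<epsilon>' * (R + 1)" using n eps by (intro mult_left_mono) auto
    also have "\<dots> \<le> \<epsilon>1 * R" using R1(3) by (simp add: algebra_simps)
    finally have "- ln m / R \<le> \<epsilon>1" using R1 by (simp add: field_simps)
    then have "ln m / ln r \<le> \<epsilon>1" by (simp add: R_def)
    then show ?thesis using m0 by (simp add: Let_def m_def[symmetric])
  qed
  then have "eventually (\<lambda>r. ?f r \<le> ereal \<epsilon>1) (at_right 0)"
    using eventually_at_right_real[of 0 "exp (- R0)"] by (auto elim!: eventually_mono)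
  then have "upper_pointwise_dim d \<nu> \<xi> \<le> ereal \<epsilon>1"
    unfolding upper_pointwise_dim_def by (rule Limsup_bounded)
  also have "\<dots> < ereal \<epsilon>" using \<epsilon>1 by simp
  finally show ?thesis .
qed

text \<open>Optimise over \<open>n\<close>: for a radius \<open>e\<^sup>-\<^sup>k\<close> the condition on \<open>n\<close> holds as soon as \<open>n\<close> is about
\<open>2 k / (c ln a)\<close>, and the mass bound \<open>64\<^sup>-\<^sup>n\<close> is then \<open>e\<^sup>-\<^sup>\<beta>\<^sup>k\<close> with \<open>\<beta> = 2 ln 64 / (c ln a)\<close>.\<close>
lemma ball_mass_lower_bound:
  fixes f :: "real \<Rightarrow> real"
  assumes a: "a > 1" and c: "c > 0" and L: "L > 0" and q: "q > 0"
    and f: "\<And>n r. r > L * a powr (- (c * real n / 2 - K)) \<Longrightarrow> f r \<ge> q * (1 / 64) ^ n"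
    and eps: "2 * ln 64 / (c * ln a) < \<epsilon>'"
  shows "\<exists>N. \<forall>n\<ge>N. f (exp (- real n)) > exp (- (\<epsilon>' * real n))"
proof -
  define \<beta> where "\<beta> = 2 * ln 64 / (c * ln a)"
  have la: "ln a > 0" using a by simp
  define A where "A = 2 / c * (K + (ln L + 1) / ln a)"
  define B where "B = 2 / (c * ln a)"
  have B: "B > 0" using c la by (simp add: B_def)
  define C where "C = (\<bar>A\<bar> + 1) * ln 64 - ln q"
  have \<beta>: "\<beta> = B * ln 64" by (simp add: \<beta>_def B_def)
  obtain N :: nat where N: "\<bar>C\<bar> / (\<epsilon>' - \<beta>) + \<bar>A\<bar> / B < N" using reals_Archimedean2 by blast
  have "f (exp (- real n)) > exp (- (\<epsilon>' * real n))" if n: "n \<ge> N" for n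
  proof -
    define x where "x = A + B * real n"
    \<comment> \<open>The index at which the radius \<open>L a\<^sup>-\<^sup>(\<^sup>c\<^sup>m\<^sup>/\<^sup>2\<^sup>-\<^sup>K\<^sup>)\<close> drops below \<open>e\<^sup>-\<^sup>n\<close>; the absolute value
      only serves to keep it nonnegative.\<close>
    define m where "m = nat \<lceil>\<bar>A\<bar> + B * real n\<rceil>"
    have nn: "0 \<le> \<bar>A\<bar> + B * real n" using B by simp
    have m: "real m \<ge> \<bar>A\<bar> + B * real n" "real m \<le> \<bar>A\<bar> + B * real n + 1"
      using nn unfolding m_def by linarith+
    have "c * real m / 2 \<ge> c * x / 2" using m(1) c by (intro divide_right_mono mult_left_mono) (auto simp: x_def)
    also have "c * x / 2 = K + (real n + ln L + 1) / ln a"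
      using c la by (simp add: x_def A_def B_def field_simps)
    finally have "c * real m / 2 - K \<ge> (real n + ln L + 1) / ln a" by linarith
    then have "(c * real m / 2 - K) * ln a \<ge> (real n + ln L + 1) / ln a * ln a"
      using la by (intro mult_right_mono) auto
    then have "(c * real m / 2 - K) * ln a > real n + ln L" using la by simp
    then have "exp (ln L - (c * real m / 2 - K) * ln a) < exp (- real n)" by simp
    moreover have "L * a powr (- y) = exp (ln L - y * ln a)" for y
    proof -
      have "exp (ln L - y * ln a) = exp (ln L) * exp (- y * ln a)" by (simp flip: exp_add)
      then show ?thesis using L a by (simp add: powr_def)
    qed
    ultimately have "f (exp (- real n)) \<ge> q * (1 / 64) ^ m" by (intro f) (simp only:)
    moreover have "q * (1 / 64) ^ m > exp (- (\<epsilon>' * real n))"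
    proof -
      have "q * (1 / 64) ^ m = exp (ln q + real m * ln (1 / 64))"
        using q by (simp add: exp_add exp_of_nat_mult)
      also have "ln (1 / 64 :: real) = - ln 64" by (simp add: ln_div)
      finally have eq: "q * (1 / 64) ^ m = exp (ln q - real m * ln 64)" by simp
      have "real m * ln 64 \<le> (\<bar>A\<bar> + B * real n + 1) * ln 64" using m(2) by (intro mult_right_mono) auto
      then have "ln q - real m * ln 64 \<ge> - C - \<beta> * real n" unfolding C_def \<beta> by (simp add: algebra_simps)
      moreover have "C < (\<epsilon>' - \<beta>) * real n"
      proof -
        have pos: "\<epsilon>' - \<beta> > 0" using eps by (simp add: \<beta>_def)
        have "\<bar>C\<bar> / (\<epsilon>' - \<beta>) < real n"
          using N n B zero_le_divide_iff[of "\<bar>A\<bar>" B] by linarith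
        then show ?thesis using pos by (simp add: field_simps)
      qed
      ultimately show ?thesis unfolding eq by (simp add: algebra_simps)
    qed
    ultimately show ?thesis by linarith
  qed
  then show ?thesis by blast
qed

context hyperbolic_action
begin

text \<open>Chaining from the far end, the loss of \<open>\<delta>\<close> at each step is paid for by the growth of the products.\<close>
lemma gromov_product_chain:
  assumes "\<And>i. gp (z i) (z (Suc i)) \<ge> A + \<delta> * real i"
  shows "gp (z 0) (z k) \<ge> A - \<delta>"
  using assms
proof (induction k arbitrary: z A)
  case 0
  have "A \<le> gp (z 0) (z 1)" using 0[of 0] by simp
  also have "\<dots> \<le> dist b (z 0)" by (rule gromov_product_le_dist)
  finally show ?case using delta_nonneg by simp
next
  case (Suc k)
  have "gp (z 1) (z (Suc k)) \<ge> A + \<delta> - \<delta>"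
    using Suc.IH[of "A + \<delta>" "\<lambda>i. z (Suc i)"] Suc.prems[of "Suc i" for i] by (simp add: algebra_simps)
  moreover have "gp (z 0) (z 1) \<ge> A" using Suc.prems[of 0] by simp
  ultimately show ?case using hyp_trans[of A b "z 0" "z 1" "z (Suc k)"] by simp
qed

end

context drifting_walk
begin

lemma c_pos: "c > 0"
  using tc t_pos by (metis zero_less_divide_1_iff zero_less_mult_pos zero_less_numeral)

lemma dist_X_Suc: "dist (g (X h k b)) (g (X h (Suc k) b)) = len (clip (h k))" if "g \<in> G"
  using G_dist[OF that] G_dist[OF X_G] by (simp add: X_Suc)

lemma good_gromov_products:
  assumes h: "h \<in> good b s" and "n \<le> m"
  shows "gp (X h n b) (X h m b) \<ge> c * real n / 2 - 2 * s - \<delta>"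
proof -
  have step: "gp (X h (n + i) b) (X h (n + Suc i) b) \<ge> (c * real n / 2 - 2 * s) + \<delta> * real i" for i
  proof -
    have g: "c * real (n + i) - s \<le> dist b (X h (n + i) b)" "len (clip (h (n + i))) \<le> s + c * real (n + i) / 2"
      using h unfolding good_def by (auto simp del: of_nat_add)
    have "gp (X h (n + i) b) (X h (n + Suc i) b) \<ge> dist b (X h (n + i) b) - len (clip (h (n + i)))"
      using gromov_product_ge[of b "X h (n + i) b" "X h (n + Suc i) b"] dist_X_Suc[OF G_id, of h "n + i"] by simp
    moreover have "2 * \<delta> * real i \<le> c * real i" using delta_c by (intro mult_right_mono) auto
    moreover have "c * real (n + i) = c * real n + c * real i" by (simp add: algebra_simps)
    ultimately show ?thesis using g by linarith
  qed
  from gromov_product_chain[of "c * real n / 2 - 2 * s" "\<lambda>i. X h (n + i) b" "m - n", OF step]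
  show ?thesis using \<open>n \<le> m\<close> by simp
qed

lemma good_limit:
  assumes h: "h \<in> good b s"
  shows "\<exists>\<xi>\<in>ideal_boundary. seq_tends_to b (\<lambda>n. X h n b) \<xi> \<and>
    limitin (bord_topology b) (\<lambda>n. Inl (X h n b)) \<xi> sequentially"
proof (rule gromov_sequence_convergent)
  fix K
  obtain N :: nat where N: "2 / c * (K + 2 * s + \<delta>) < N" using reals_Archimedean2 by blast
  have ge: "gp (X h n b) (X h m b) \<ge> K" if "n \<ge> N" "n \<le> m" for n m
  proof -
    have "2 / c * (K + 2 * s + \<delta>) \<le> real n" using N that(1) by linarith
    then have "K + 2 * s + \<delta> \<le> c * real n / 2" using c_pos by (simp add: field_simps)
    then show ?thesis using good_gromov_products[OF h that(2)] by linarith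
  qed
  have "gp (X h n b) (X h m b) \<ge> K" if "n \<ge> N" "m \<ge> N" for n m
    using ge[of n m] ge[of m n] that by (cases "n \<le> m") (auto simp: gromov_product_commute)
  then show "\<exists>N. \<forall>n\<ge>N. \<forall>m\<ge>N. gp (X h n b) (X h m b) \<ge> K" by blast
qed

text \<open>On trajectories for which no slack works, a null set, the value is a fixed boundary point; this
keeps the map measurable.\<close>
definition xlim :: "(nat \<Rightarrow> 'a \<Rightarrow> 'a) \<Rightarrow> 'a bord" where
  "xlim h = (if \<exists>n::nat. h \<in> good b n
    then SOME \<xi>. \<xi> \<in> ideal_boundary \<and> seq_tends_to b (\<lambda>n. X h n b) \<xi> \<and>
      limitin (bord_topology b) (\<lambda>n. Inl (X h n b)) \<xi> sequentially
    else SOME \<xi>. \<xi> \<in> ideal_boundary)"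

lemma xlim_good:
  assumes "h \<in> good b (real n)"
  shows "xlim h \<in> ideal_boundary" "seq_tends_to b (\<lambda>n. X h n b) (xlim h)"
    "limitin (bord_topology b) (\<lambda>n. Inl (X h n b)) (xlim h) sequentially"
proof -
  have "xlim h = (SOME \<xi>. \<xi> \<in> ideal_boundary \<and> seq_tends_to b (\<lambda>n. X h n b) \<xi> \<and>
      limitin (bord_topology b) (\<lambda>n. Inl (X h n b)) \<xi> sequentially)"
    using assms unfolding xlim_def by auto
  moreover have "\<exists>\<xi>. \<xi> \<in> ideal_boundary \<and> seq_tends_to b (\<lambda>n. X h n b) \<xi> \<and>
      limitin (bord_topology b) (\<lambda>n. Inl (X h n b)) \<xi> sequentially"
    using good_limit[OF assms] by blast
  ultimately have "xlim h \<in> ideal_boundary \<and> seq_tends_to b (\<lambda>n. X h n b) (xlim h) \<and>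
      limitin (bord_topology b) (\<lambda>n. Inl (X h n b)) (xlim h) sequentially"
    by (metis (mono_tags, lifting) someI_ex)
  then show "xlim h \<in> ideal_boundary" "seq_tends_to b (\<lambda>n. X h n b) (xlim h)"
    "limitin (bord_topology b) (\<lambda>n. Inl (X h n b)) (xlim h) sequentially" by auto
qed

lemma xlim_in_boundary: "xlim h \<in> ideal_boundary"
proof (cases "\<exists>n::nat. h \<in> good b n")
  case False
  interpret prob_space W by (rule prob_space_walk_space)
  obtain h' n where "h' \<in> good b (real n)"
    using eventually_happens'[OF ae_filter_bot AE_good] by blast
  then have "\<exists>\<xi>. \<xi> \<in> (ideal_boundary :: 'a bord set)" using good_limit by blast
  then have "(SOME \<xi>. \<xi> \<in> (ideal_boundary :: 'a bord set)) \<in> ideal_boundary" by (rule someI_ex)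
  then show ?thesis using False unfolding xlim_def by simp
qed (use xlim_good(1) in blast)

text \<open>A sequence converging in a metric space has its limit in an open set \<open>V\<close> iff, for some \<open>k\<close>, the
balls of radius \<open>1/(k+1)\<close> around its late terms are contained in \<open>V\<close>. This condition involves each
position of the walk separately.\<close>
lemma measurable_xlim:
  assumes vis: "visual_metric b a d"
  shows "xlim \<in> W \<rightarrow>\<^sub>M boundary_borel b"
  unfolding boundary_borel_def
proof (rule measurable_measure_of[OF boundary_borel_generators])
  show "xlim \<in> space W \<rightarrow> ideal_boundary" using xlim_in_boundary by blast
next
  fix U :: "'a bord set" assume "U \<in> {U. openin (subtopology (bord_topology b) ideal_boundary) U}"
  then obtain V where V: "openin (bord_topology b) V" "U = V \<inter> ideal_boundary"
    by (auto simp: openin_subtopology)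
  have ms: "Metric_space bordification d" and top: "Metric_space.mtopology bordification d = bord_topology b"
    using vis by (auto simp: visual_metric_def)
  interpret Metric_space bordification d by (rule ms)
  define E where "E = (\<Union>n::nat. good b n)"
  define V' where "V' k = {x \<in> bordification. mball x (1 / real (Suc k)) \<subseteq> V}" for k
  define P where "P h \<longleftrightarrow> (\<exists>k N. \<forall>n. n \<ge> N \<longrightarrow> Inl (X h n b) \<in> V' k)" for h
  have E: "E \<in> sets W" unfolding E_def using sets_good by blast
  have "(\<lambda>h. n \<ge> N \<longrightarrow> Inl (X h n b) \<in> V' k) \<in> W \<rightarrow>\<^sub>M count_space UNIV" for n N k :: nat
    by (rule measurable_X_function) simp
  then have "Measurable.pred W P"
    unfolding P_def by (intro pred_intros_countable)
  then have P: "{h. P h} \<in> sets W" using predE by fastforce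
  have iff: "xlim h \<in> V \<longleftrightarrow> P h" if "h \<in> E" for h
  proof -
    have lim: "limitin mtopology (\<lambda>n. Inl (X h n b)) (xlim h) sequentially"
      using that xlim_good(3) top unfolding E_def by auto
    then have l: "xlim h \<in> bordification"
      and ev: "\<And>e. e > 0 \<Longrightarrow> \<exists>N. \<forall>n\<ge>N. Inl (X h n b) \<in> bordification \<and> d (Inl (X h n b)) (xlim h) < e"
      unfolding limitin_metric eventually_sequentially by auto
    show ?thesis
    proof
      assume "xlim h \<in> V"
      then obtain r where r: "r > 0" "mball (xlim h) r \<subseteq> V"
        using V(1) unfolding top[symmetric] openin_mtopology by blast
      obtain k where k: "1 / real (Suc k) < r / 2" using nat_approx_posE[of "r / 2"] r(1) by auto
      obtain N where N: "\<And>n. n \<ge> N \<Longrightarrow> Inl (X h n b) \<in> bordification \<and> d (Inl (X h n b)) (xlim h) < r / 2"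
        using ev[of "r / 2"] r(1) by auto
      have "Inl (X h n b) \<in> V' k" if "n \<ge> N" for n
      proof -
        have "mball (Inl (X h n b)) (1 / real (Suc k)) \<subseteq> mball (xlim h) r"
          using N[OF that] k l by (intro mball_subset) auto
        then show ?thesis using N[OF that] r(2) unfolding V'_def by blast
      qed
      then show "P h" unfolding P_def by blast
    next
      assume "P h"
      then obtain k N where kN: "\<And>n. n \<ge> N \<Longrightarrow> Inl (X h n b) \<in> V' k" unfolding P_def by blast
      obtain N' where N': "\<And>n. n \<ge> N' \<Longrightarrow> Inl (X h n b) \<in> bordification \<and> d (Inl (X h n b)) (xlim h) < 1 / real (Suc k)"
        using ev[of "1 / real (Suc k)"] by auto
      have "xlim h \<in> mball (Inl (X h (max N N') b)) (1 / real (Suc k))"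
        using N'[of "max N N'"] l by simp
      then show "xlim h \<in> V" using kN[of "max N N'"] unfolding V'_def by auto
    qed
  qed
  let ?\<xi>0 = "SOME \<xi>. \<xi> \<in> (ideal_boundary :: 'a bord set)"
  have "xlim -` U \<inter> space W = (E \<inter> {h. P h}) \<union> (if ?\<xi>0 \<in> U then UNIV - E else {})"
  proof -
    have "xlim h = ?\<xi>0" if "h \<notin> E" for h using that unfolding xlim_def E_def by auto
    then have "xlim h \<in> U \<longleftrightarrow> (if h \<in> E then P h else ?\<xi>0 \<in> U)" for h
      using iff[of h] xlim_in_boundary[of h] V(2) by auto
    then show ?thesis by (auto split: if_splits)
  qed
  moreover have "UNIV - E \<in> sets W" using E sets.compl_sets[of E W] by simp
  ultimately show "xlim -` U \<inter> space W \<in> sets W" using E P by auto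
qed

text \<open>Put \<open>g = x\<^sub>n\<close>. The path \<open>h'\<close> continues from \<open>g b\<close> with a trajectory that is good as seen from
\<open>g\<^sup>-\<^sup>1 b\<close>, that is, it escapes from \<open>b\<close>; the path \<open>h\<close> escapes from \<open>b\<close> as well. Both therefore stay in
the shadow of \<open>g b\<close>, whose depth is linear in \<open>n\<close>.\<close>
lemma shadow_gromov_product:
  assumes h: "h \<in> good b s" and agree: "\<And>i. i < n \<Longrightarrow> h' i = h i"
    and tail: "(\<lambda>i. h' (n + i)) \<in> good (iso_inv (X h n) b) s'" and "n \<le> m"
  shows "gp (X h m b) (X h' m b) \<ge> c * real n / 2 - 2 * s - 2 * s' - 2 * \<delta>"
proof -
  define g where "g = X h n"
  define \<omega> where "\<omega> = (\<lambda>i. h' (n + i))"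
  have gG: "g \<in> G" by (simp add: g_def X_G)
  have eq: "X h' (n + i) b = g (X \<omega> i b)" for i
    using X_cong[of n h' h, OF agree] by (simp add: X_add \<omega>_def g_def)
  have s: "s \<ge> 0" "s' \<ge> 0" using h tail good_nonneg by auto
  have dist_eq: "dist (iso_inv g b) z = dist b (g z)" for z
    using dist_iso_inv[OF G_carrier[OF gG], of z b] by (simp add: dist_commute)
  have step: "gp (g (X \<omega> i b)) (g (X \<omega> (Suc i) b)) \<ge> (len g - 2 * s') + \<delta> * real i" for i
  proof -
    have gd: "len g + c * real i - s' \<le> dist b (g (X \<omega> i b))" "len (clip (\<omega> i)) \<le> s' + c * real i / 2"
      using tail unfolding good_def \<omega>_def[symmetric] g_def[symmetric] by (auto simp: dist_eq)
    have "gp (g (X \<omega> i b)) (g (X \<omega> (Suc i) b)) \<ge> dist b (g (X \<omega> i b)) - len (clip (\<omega> i))"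
      using gromov_product_ge[of b "g (X \<omega> i b)" "g (X \<omega> (Suc i) b)"] dist_X_Suc[OF gG, of \<omega> i] by simp
    moreover have "2 * \<delta> * real i \<le> c * real i" using delta_c by (intro mult_right_mono) auto
    ultimately show ?thesis using gd by (simp add: algebra_simps)
  qed
  have 1: "gp (g b) (X h' m b) \<ge> len g - 2 * s' - \<delta>"
    using gromov_product_chain[of "len g - 2 * s'" "\<lambda>i. g (X \<omega> i b)" "m - n", OF step] eq[of "m - n"] \<open>n \<le> m\<close>
    by simp
  have "len g \<ge> c * real n - s" using h by (auto simp: good_def g_def)
  moreover have "c * real n \<ge> 0" using c_pos by simp
  ultimately have 2: "gp (g b) (X h' m b) \<ge> c * real n / 2 - 2 * s - 2 * s' - \<delta>" using 1 s by linarith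
  have 3: "gp (X h m b) (g b) \<ge> c * real n / 2 - 2 * s - 2 * s' - \<delta>"
    using good_gromov_products[OF h \<open>n \<le> m\<close>] s by (simp add: g_def gromov_product_commute)
  show ?thesis using hyp_trans[OF 3 2] by simp
qed

definition harmonic :: "'a bord measure" where
  "harmonic = distr W (boundary_borel b) xlim"

text \<open>Trajectories that agree with \<open>h\<close> up to time \<open>n\<close> and have a good continuation end in the ball. Their
probability is that of the initial segment times at least one half.\<close>
lemma AE_harmonic_ball:
  assumes vis: "visual_metric b a d" and a: "a > 1"
  shows "\<exists>\<Lambda>>0. AE h in W. \<exists>q>0. \<exists>K. \<forall>n r. r > \<Lambda> * a powr (- (c * real n / 2 - K)) \<longrightarrow>
    measure harmonic (Metric_space.mball ideal_boundary d (xlim h) r) \<ge> q * (1 / 64) ^ n"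
proof -
  interpret Submetric bordification d ideal_boundary by (rule visual_metric_submetric[OF vis])
  interpret W: prob_space W by (rule prob_space_walk_space)
  obtain \<Lambda> where \<Lambda>: "\<Lambda> > 0" "\<And>x y. x \<in> bordification \<Longrightarrow> y \<in> bordification \<Longrightarrow> d x y \<le> \<Lambda> * powr_neg a (ext_gromov_product b x y)"
    using vis unfolding visual_metric_def by blast
  have "AE h in W. \<exists>q>0. \<exists>K. \<forall>n r. r > \<Lambda> * a powr (- (c * real n / 2 - K)) \<longrightarrow>
    measure harmonic (sub.mball (xlim h) r) \<ge> q * (1 / 64) ^ n"
    using AE_good AE_path_weight
  proof eventually_elim
    case (elim h)
    obtain s :: nat where h: "h \<in> good b (real s)" using elim(1) by blast
    obtain q where q: "q > 0" "\<And>n. q * (1 / 64) ^ n \<le> (\<Prod>i<n. pmf \<mu> (h i))" using elim(2) by blast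
    define K where "K = 2 * real s + 2 * slack + 4 * \<delta>"
    have "q / 2 * (1 / 64) ^ n \<le> measure harmonic (sub.mball (xlim h) r)"
      if r: "r > \<Lambda> * a powr (- (c * real n / 2 - K))" for n r
    proof -
      define T where "T = good (iso_inv (X h n) b) slack"
      define A where "A = {h'. (\<forall>i<n. h' i = h i) \<and> (\<lambda>i. h' (n + i)) \<in> T}"
      have T: "T \<in> sets W" by (simp add: T_def sets_good)
      have "ennreal (q / 2 * (1 / 64) ^ n) \<le> ennreal ((\<Prod>i<n. pmf \<mu> (h i)) * (1 / 2))"
        using q(2)[of n] by (intro ennreal_leI) simp
      also have "\<dots> = ennreal (\<Prod>i<n. pmf \<mu> (h i)) * ennreal (1 / 2)"
        by (intro ennreal_mult prod_nonneg) auto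
      also have "\<dots> \<le> ennreal (\<Prod>i<n. pmf \<mu> (h i)) * emeasure W T"
        using prob_good[of "iso_inv (X h n) b"] unfolding T_def
        by (intro mult_left_mono) (auto simp: divide_ennreal_def)
      also have "\<dots> = emeasure W A"
        unfolding A_def by (rule emeasure_cylinder_tail(1)[OF T, symmetric])
      finally have "q / 2 * (1 / 64) ^ n \<le> measure W A"
        unfolding W.emeasure_eq_measure by (subst (asm) ennreal_le_iff) auto
      also have "\<dots> \<le> measure W (xlim -` sub.mball (xlim h) r \<inter> space W)"
      proof (rule W.finite_measure_mono_AE)
        show "xlim -` sub.mball (xlim h) r \<inter> space W \<in> sets W"
          by (rule measurable_sets[OF measurable_xlim[OF vis] sets_boundary_ball[OF vis]])
        show "AE h' in W. h' \<in> A \<longrightarrow> h' \<in> xlim -` sub.mball (xlim h) r \<inter> space W"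
          using AE_good
        proof eventually_elim
          case (elim h')
          obtain s' :: nat where h': "h' \<in> good b (real s')" using elim by blast
          show ?case
          proof
            assume "h' \<in> A"
            then have agree: "\<And>i. i < n \<Longrightarrow> h' i = h i" and tail: "(\<lambda>i. h' (n + i)) \<in> good (iso_inv (X h n) b) slack"
              by (auto simp: A_def T_def)
            have "ext_gromov_product b (xlim h) (xlim h') \<ge> ereal (c * real n / 2 - 2 * real s - 2 * slack - 2 * \<delta> - 2 * \<delta>)"
              using xlim_good(1,2)[OF h] xlim_good(1,2)[OF h'] shadow_gromov_product[OF h agree tail]
              by (intro ext_gromov_product_boundary[where N = n]) auto
            then have ext: "ereal (c * real n / 2 - K) \<le> ext_gromov_product b (xlim h) (xlim h')"
              by (simp add: K_def algebra_simps)
            have mem: "xlim h \<in> bordification" "xlim h' \<in> bordification"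
              using xlim_in_boundary subset by auto
            have "d (xlim h) (xlim h') \<le> \<Lambda> * powr_neg a (ext_gromov_product b (xlim h) (xlim h'))"
              by (rule \<Lambda>(2)[OF mem])
            also have "\<dots> \<le> \<Lambda> * a powr (- (c * real n / 2 - K))"
              using powr_neg_le[OF a ext] \<Lambda>(1) by (intro mult_left_mono) auto
            also have "\<dots> < r" by (rule r)
            finally show "h' \<in> xlim -` sub.mball (xlim h) r \<inter> space W"
              using xlim_in_boundary by simp
          qed
        qed
      qed
      also have "\<dots> = measure harmonic (sub.mball (xlim h) r)"
        unfolding harmonic_def
        by (rule measure_distr[OF measurable_xlim[OF vis] sets_boundary_ball[OF vis], symmetric])
      finally show ?thesis .
    qed
    then show ?case using q(1) by (intro exI[of _ "q / 2"] conjI exI[of _ K]) auto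
  qed
  then show ?thesis using \<Lambda>(1) by blast
qed

theorem is_harmonic_measure_harmonic:
  assumes "visual_metric b a d"
  shows "is_harmonic_measure b \<mu> harmonic"
  unfolding is_harmonic_measure_def
proof (intro bexI conjI)
  show "xlim \<in> W \<rightarrow>\<^sub>M boundary_borel b" by (rule measurable_xlim[OF assms])
  show "AE h in W. limitin (bord_topology b) (\<lambda>n. Inl (random_walk h n b)) (xlim h) sequentially"
    using AE_good AE_increments_in_G
  proof eventually_elim
    case (elim h)
    then obtain n :: nat where "h \<in> good b n" by blast
    then show ?case using xlim_good(3)[of h n] X_eq_random_walk[of h] elim(2) by simp
  qed
qed (rule harmonic_def)

theorem harmonic_dimension:
  assumes vis: "visual_metric b a d" and a: "a > 1" and eps: "2 * ln 64 / (c * ln a) < \<epsilon>"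
  shows "AE \<xi> in harmonic. upper_pointwise_dim d harmonic \<xi> < ereal \<epsilon>"
proof -
  interpret W: prob_space W by (rule prob_space_walk_space)
  have fin: "finite_measure harmonic"
    unfolding harmonic_def by (rule W.finite_measure_distr[OF measurable_xlim[OF vis]])
  have sets: "sets harmonic = sets (boundary_borel b)" by (simp add: harmonic_def)
  obtain \<epsilon>' where \<epsilon>': "2 * ln 64 / (c * ln a) < \<epsilon>'" "\<epsilon>' < \<epsilon>" using dense[OF eps] by blast
  have "0 < 2 * ln 64 / (c * ln a)" using c_pos a by simp
  then have \<epsilon>'0: "0 < \<epsilon>'" using \<epsilon>'(1) by linarith
  let ?B = "Metric_space.mball ideal_boundary d"
  define P where "P \<xi> \<longleftrightarrow> (\<exists>N. \<forall>n. n \<ge> N \<longrightarrow> measure harmonic (?B \<xi> (exp (- real n))) > exp (- (\<epsilon>' * real n)))" for \<xi>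
  obtain \<Lambda> where \<Lambda>: "\<Lambda> > 0" "AE h in W. \<exists>q>0. \<exists>K. \<forall>n r. r > \<Lambda> * a powr (- (c * real n / 2 - K)) \<longrightarrow>
    measure harmonic (?B (xlim h) r) \<ge> q * (1 / 64) ^ n"
    using AE_harmonic_ball[OF vis a] by blast
  have "AE h in W. P (xlim h)"
    using \<Lambda>(2)
  proof eventually_elim
    case (elim h)
    then obtain q K where q: "q > 0" "\<And>n r. r > \<Lambda> * a powr (- (c * real n / 2 - K)) \<Longrightarrow>
      measure harmonic (?B (xlim h) r) \<ge> q * (1 / 64) ^ n" by blast
    show ?case unfolding P_def by (rule ball_mass_lower_bound[OF a c_pos \<Lambda>(1) q \<epsilon>'(1)])
  qed
  moreover have "{\<xi> \<in> space (boundary_borel b). P \<xi>} \<in> sets (boundary_borel b)"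
  proof -
    let ?S = "\<lambda>n::nat. {\<xi> \<in> ideal_boundary. measure harmonic (?B \<xi> (exp (- real n))) > exp (- (\<epsilon>' * real n))}"
    have S: "?S n \<in> sets (boundary_borel b)" for n by (rule sets_ball_measure_greater[OF vis fin sets])
    have "(\<Union>N. \<Inter>n. ?S (N + n)) \<in> sets (boundary_borel b)"
      by (intro sets.countable_UN image_subsetI sets.countable_INT S) simp
    also have "(\<Union>N. \<Inter>n. ?S (N + n)) = {\<xi> \<in> space (boundary_borel b). P \<xi>}"
    proof -
      have shift: "(\<forall>n. R (N + n)) \<longleftrightarrow> (\<forall>n. n \<ge> N \<longrightarrow> R n)" for R and N :: nat
        by (metis le_add1 le_Suc_ex)
      show ?thesis
        unfolding P_def space_boundary_borel shift[symmetric] by auto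
    qed
    finally show ?thesis .
  qed
  ultimately have "AE \<xi> in harmonic. P \<xi>"
    unfolding harmonic_def by (subst AE_distr_iff[OF measurable_xlim[OF vis]]) auto
  then show ?thesis
  proof eventually_elim
    case (elim \<xi>)
    then obtain N where "\<And>n. n \<ge> N \<Longrightarrow> measure harmonic (?B \<xi> (exp (- real n))) > exp (- (\<epsilon>' * real n))"
      unfolding P_def by blast
    from upper_pointwise_dim_less[OF vis fin sets this \<epsilon>'0 \<epsilon>'(2)] show ?case .
  qed
qed

lemma finite_first_moment_law: "finite_first_moment b G \<mu>"
  unfolding finite_first_moment_def
proof (rule nonneg_bdd_above_summable_on)
  show "bdd_above (sum (\<lambda>g. pmf \<mu> g * dist b (g b)) ` {F. F \<subseteq> G \<and> finite F})"
  proof (rule bdd_aboveI2)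
    fix F assume "F \<in> {F. F \<subseteq> G \<and> finite F}"
    then have F: "finite F" by simp
    have "pmf \<mu> g * dist b (g b) \<le> 1 / t * (exp (t * len g) * pmf \<mu> g)" for g
    proof -
      have "t * len g \<le> exp (t * len g)" using exp_ge_add_one_self[of "t * len g"] by linarith
      then have "len g \<le> 1 / t * exp (t * len g)" using t_pos by (simp add: field_simps)
      then have "pmf \<mu> g * len g \<le> pmf \<mu> g * (1 / t * exp (t * len g))" by (intro mult_left_mono) auto
      then show ?thesis by (simp add: mult_ac)
    qed
    then have "(\<Sum>g\<in>F. pmf \<mu> g * dist b (g b)) \<le> (\<Sum>g\<in>F. 1 / t * (exp (t * len g) * pmf \<mu> g))"
      by (intro sum_mono)
    also have "\<dots> = 1 / t * (\<Sum>g\<in>F. exp (t * len g) * pmf \<mu> g)" by (simp add: sum_distrib_left)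
    also have "\<dots> \<le> 1 / t * 2"
    proof (rule mult_left_mono)
      have "ennreal (\<Sum>g\<in>F. exp (t * len g) * pmf \<mu> g) = (\<Sum>g\<in>F. (ennreal (exp (t * len g)) * indicator F g) * ennreal (pmf \<mu> g))"
        by (subst sum_ennreal[symmetric]) (auto simp: ennreal_mult intro!: sum.cong)
      also have "\<dots> = (\<integral>\<^sup>+ g. ennreal (exp (t * len g)) * indicator F g \<partial>measure_pmf \<mu>)"
        by (rule nn_integral_measure_pmf_support[symmetric]) (use F in auto)
      also have "\<dots> \<le> (\<integral>\<^sup>+ g. ennreal (exp (t * len g)) \<partial>measure_pmf \<mu>)"
        by (intro nn_integral_mono) (auto simp: indicator_def)
      also have "\<dots> \<le> ennreal 2" using moment by simp
      finally show "(\<Sum>g\<in>F. exp (t * len g) * pmf \<mu> g) \<le> 2" by (subst (asm) ennreal_le_iff) auto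
    qed (use t_pos in auto)
    finally show "(\<Sum>g\<in>F. pmf \<mu> g * dist b (g b)) \<le> 1 / t * 2" .
  qed
qed auto

end

theorem theorem5p1:
  fixes b :: "'a::gromov_hyperbolic_space"
    and a :: real
    and d :: "'a bord \<Rightarrow> 'a bord \<Rightarrow> real"
    and G :: "('a \<Rightarrow> 'a) set"
    and \<epsilon> :: real
  assumes "a > 1"
    and "visual_metric b a d"
    and "subgroup G isometry_group"
    and "properly_discontinuous G"
    and "non_elementary b G"
    and "\<epsilon> > 0"
  shows "\<exists>(\<mu> :: ('a \<Rightarrow> 'a) pmf) \<nu>.
           set_pmf \<mu> \<subseteq> G \<and>
           symmetric_on G \<mu> \<and>
           finite_first_moment b G \<mu> \<and>
           generate isometry_group (set_pmf \<mu>) = G \<and>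
           is_harmonic_measure b \<mu> \<nu> \<and>
           (AE \<xi> in \<nu>. upper_pointwise_dim d \<nu> \<xi> < ereal \<epsilon>)"
proof -
  obtain \<delta> where \<delta>: "\<delta> \<ge> 0" "\<And>p x y z :: 'a. gromov_product p x z \<ge> min (gromov_product p x y) (gromov_product p y z) - \<delta>"
    using hyperbolic by metis
  interpret hyperbolic_action b \<delta> G
    by (rule hyperbolic_action.intro[OF \<delta> assms(3,4)])
  have la: "ln a > 0" using assms(1) by simp
  \<comment> \<open>The first bound is the one required for chaining Gromov products, the second one makes the
    dimension bound smaller than \<open>\<epsilon>\<close>.\<close>
  define c0 where "c0 = max (2 * \<delta>) (2 * ln 64 / (\<epsilon> * ln a) + 1)"
  obtain \<mu> t c where \<mu>: "set_pmf \<mu> = G" "\<forall>g\<in>G. pmf \<mu> (iso_inv g) = pmf \<mu> g"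
    "0 < t" "c0 \<le> c" "t * c = 1 / 50"
    "\<And>y. (\<integral>\<^sup>+ h. ennreal (exp (- t * dist y (h b))) \<partial>measure_pmf \<mu>) \<le> ennreal (19 / 20 * exp (- t * dist y b))"
    "(\<integral>\<^sup>+ h. ennreal (exp (t * len h)) \<partial>measure_pmf \<mu>) \<le> 2"
    "(\<integral>\<^sup>+ h. ennreal (1 / sqrt (pmf \<mu> h)) \<partial>measure_pmf \<mu>) \<le> 4"
    using exists_step_law[OF three_directions_if_non_elementary[OF assms(1,2,5)], of c0] by blast
  interpret drifting_walk b \<delta> G \<mu> t c
  proof (rule drifting_walk.intro[OF hyperbolic_action_axioms], rule drifting_walk_axioms.intro)
    show "2 * \<delta> \<le> c" using \<mu>(4) by (simp add: c0_def)
  qed (fact \<mu>)+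
  have "2 * ln 64 / (\<epsilon> * ln a) < c" using \<mu>(4) by (simp add: c0_def)
  then have "2 * ln 64 / (c * ln a) < \<epsilon>" using la assms(6) c_pos by (simp add: field_simps)
  then have dim: "AE \<xi> in harmonic. upper_pointwise_dim d harmonic \<xi> < ereal \<epsilon>"
    by (rule harmonic_dimension[OF assms(2,1)])
  have gen: "generate isometry_group (set_pmf \<mu>) = G"
  proof
    show "generate isometry_group (set_pmf \<mu>) \<subseteq> G"
      using isom.generate_subgroup_incl[OF _ assms(3)] \<mu>(1) by blast
    show "G \<subseteq> generate isometry_group (set_pmf \<mu>)"
      using \<mu>(1) generate.incl by fast
  qed
  show ?thesis
    using \<mu>(1,2) finite_first_moment_law gen is_harmonic_measure_harmonic[OF assms(2)] dim
    by (intro exI[of _ \<mu>] exI[of _ harmonic]) (simp add: symmetric_on_def)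
qed

end
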